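(* Let $\mathcal J:\mathcal P_2(\mathbb R^d)\to(-\infty,+\infty]$ be proper, lower semi-continuous and $\lambda$-convex along generalised geodesics for some $\lambda\in\mathbb R$. Assume $\mathcal J$ has at least one minimiser, set $\hat{\mathcal J}=\min\mathcal J$, and assume that for some $r_0\in(\hat{\mathcal J},+\infty]$, $\theta\in(0,1]$ and $c_g>0$ one has, for all $\rho\in\mathcal P_2(\mathbb R^d)$, $$\hat{\mathcal J}<\mathcal J[\rho]<r_0\ \Rightarrow\ \forall\nu\in\partial\mathcal J[\rho],\quad c_g\,(\mathcal J[\rho]-\hat{\mathcal J})^{1-\theta}\le\|\nu\|_\rho .$$ Let $\rho_0\in\mathcal P_2(\mathbb R^d)$ with $\hat{\mathcal J}\le\mathcal J[\rho_0]<r_0$ and let $\rho:[0,+\infty)\to\mathcal P_2(\mathbb R^d)$ be the solution of the subgradient dynamics $$\frac{d}{dt}\rho(t)+\partial\mathcal J[\rho(t)]\ni0\quad\text{for a.e. }t\in(0,+\infty),\qquad\rho(0)=\rho_0 .$$ Then this trajectory has finite length and converges for the Monge-Kantorovich metric $\mathcal W_2$ to a minimiser $\rho_\infty$ of $\mathcal J$. Moreover: (i) If $\theta\in(0,1/2)$, then for all $t\ge0$, $$\mathcal J[\rho(t)]-\hat{\mathcal J}\le\left\{(\mathcal J[\rho_0]-\hat{\mathcal J})^{2\theta-1}+c_g^2(1-2\theta)t\right\}^{-\frac1{1-2\theta}},$$ $$\mathcal W_2(\rho(t),\rho_\infty)\le\frac1{c_g\theta}\left\{(\mathcal J[\rho_0]-\hat{\mathcal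 J})^{2\theta-1}+c_g^2(1-2\theta)t\right\}^{-\frac\theta{1-2\theta}}.$$ (ii) If $\theta=1/2$, then for all $t\ge0$, $$\mathcal J[\rho(t)]-\hat{\mathcal J}\le(\mathcal J[\rho_0]-\hat{\mathcal J})\exp(-c_g^2t),$$ $$\mathcal W_2(\rho(t),\rho_\infty)\le\frac2{c_g}\sqrt{\mathcal J[\rho_0]-\hat{\mathcal J}}\ \exp\left(-\frac{c_g^2t}2\right).$$ (iii) If $\theta\in(1/2,1]$, the trajectory stabilises in finite time (i.e. it is equal to $\rho_\infty$ from some finite final time on), and the final time is at most $$T=\frac{(\mathcal J[\rho_0]-\hat{\mathcal J})^{2\theta-1}}{c_g^2(2\theta-1)} ;$$ and for $t\in[0,T]$, $$\mathcal J[\rho(t)]-\hat{\mathcal J}\le\left\{(\mathcal J[\rho_0]-\hat{\mathcal J})^{2\theta-1}-c_g^2(2\theta-1)t\right\}^{\frac1{2\theta-1}},$$ $$\mathcal W_2(\rho(t),\rho_\infty)\le\frac1{c_g\theta}\left\{(\mathcal J[\rho_0]-\hat{\mathcal J})^{2\theta-1}-c_g^2(2\theta-1)t\right\}^{\frac\theta{2\theta-1}}.$$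
   Context: $\mathcal P_2(\mathbb R^d)$ is the set of Borel probability measures on $\mathbb R^d$ with finite second moment, equipped with the Monge-Kantorovich (2-Wasserstein) distance $\mathcal W_2^2(\mu,\nu)=\min_{\gamma\in\Pi(\mu,\nu)}\iint|x-y|^2d\gamma(x,y)$, where $\Pi(\mu,\nu)$ is the set of couplings of $\mu$ and $\nu$; $\Gamma_{\rm opt}(\mu,\nu)$ denotes the set of optimal couplings. Lower semi-continuity is with respect to $\mathcal W_2$. $\operatorname{dom}\mathcal J=\{\mathcal J<+\infty\}$, and $\mathcal J$ is proper if $\operatorname{dom}\mathcal J\neq\emptyset$. Generalised geodesics and $\lambda$-convexity: let $\rho,\nu_0,\nu_1\in\mathcal P_2(\mathbb R^d)$ and let $\Psi$ be a probability measure on $(\mathbb R^d)^3$ with marginals $\rho,\nu_0,\nu_1$ such that its image under $(x,y,z)\mapsto(x,y)$ is in $\Gamma_{\rm opt}(\rho,\nu_0)$ and its image under $(x,y,z)\mapsto(x,z)$ is in $\Gamma_{\rm opt}(\rho,\nu_1)$. The generalised geodesic from $\nu_0$ to $\nu_1$ with base $\rho$ induced by $\Psi$ is $\nu_t=(\pi^t)_\#\Psi$, with $\pi^t(x,y,z)=(1-t)y+tz$, $t\in[0,1]$. $\mathcal J$ is $\lambda$-convex along generalised geodesics if for all $\nu_0,\nu_1\in\operatorname{dom}\mathcal J$, every base $\rho$ and every generalised geodesic $(\nu_t)$ with base $\rho$ induced by such a $\Psi$, for all $t\in[0,1]$, $$\mathcal J[\nu_t]\le(1-t)\mathcal J[\nu_0]+t\mathcal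 J[\nu_1]-\frac\lambda2\iiint|x_3-x_2|^2d\Psi(x_1,x_2,x_3).$$ Subdifferential: for $\mu\in\operatorname{dom}\mathcal J$ and $\gamma\in L^2_\mu(\mathbb R^d;\mathbb R^d)$, $\gamma\in\partial\mathcal J[\mu]$ iff for every $\nu\in\mathcal P_2(\mathbb R^d)$ there exists $\Psi\in\Gamma_{\rm opt}(\mu,\nu)$ with $\mathcal J[\nu]\ge\mathcal J[\mu]+\int\gamma(x)\cdot(y-x)\,d\Psi(x,y)+\frac\lambda2\mathcal W_2^2(\mu,\nu)$; $\partial\mathcal J[\mu]=\emptyset$ if $\mu\notin\operatorname{dom}\mathcal J$. $\|\cdot\|_\rho$ is the norm of $L^2_\rho(\mathbb R^d;\mathbb R^d)$. Curves and dynamics: a curve $\gamma$ in $\mathcal P_2(\mathbb R^d)$ is absolutely continuous if $\mathcal W_2(\gamma(s),\gamma(t))\le\int_s^tv(\tau)d\tau$ for $s\le t$ for some integrable $v$ (locally integrable on $[0,+\infty)$ for curves defined there); its metric derivative $\left|\frac{d\gamma}{dt}\right|(t)=\lim_{h\to0}\mathcal W_2(\gamma(t+h),\gamma(t))/|h|$ then exists for a.e. $t$, and its length is $\int\left|\frac{d\gamma}{dt}\right|(t)\,dt$. A solution of the subgradient dynamics is an absolutely continuous curve $\rho$ whose (tangent) velocity field $v(t)\in L^2_{\rho(t)}(\mathbb R^d;\mathbb R^d)$ (lying, for a.e. $t$, in the $L^2_{\rho(t)}$-closure of smooth gradients, and satisfying $\partial_t\rho+\nabla\cdot(\rho v)=0$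 in the sense of distributions, with $\|v(t)\|_{\rho(t)}=\left|\frac{d\rho}{dt}\right|(t)$ for a.e. $t$) satisfies $-v(t)\in\partial\mathcal J[\rho(t)]$ for a.e. $t>0$. The following facts from Ambrosio-Gigli-Savaré are taken as known: for $\rho_0\in\operatorname{dom}\mathcal J$ such a solution exists and is unique, $t\mapsto\mathcal J[\rho(t)]$ is non-increasing and absolutely continuous, and $\frac{d}{dt}\mathcal J[\rho(t)]=-\left|\frac{d\rho}{dt}\right|^2(t)$ for a.e. $t>0$. Convention: in (i), if $\mathcal J[\rho_0]=\hat{\mathcal J}$, then $(\mathcal J[\rho_0]-\hat{\mathcal J})^{2\theta-1}=+\infty$ and the right-hand sides are $0$. *)

theory Defs
  imports "HOL-Probability.Probability"
begin

section \<open>The Wasserstein space\<close>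

definition P2 :: "'a::euclidean_space measure set" where
  "P2 = {\<mu>. sets \<mu> = sets borel \<and> prob_space \<mu> \<and> integrable \<mu> (\<lambda>x. (norm x)\<^sup>2)}"

definition couplings :: "'a::euclidean_space measure \<Rightarrow> 'a measure \<Rightarrow> ('a \<times> 'a) measure set" where
  "couplings \<mu> \<nu> = {\<gamma>. sets \<gamma> = sets borel \<and> prob_space \<gamma>
     \<and> distr \<gamma> borel fst = \<mu> \<and> distr \<gamma> borel snd = \<nu>}"

definition transport_cost :: "('a::euclidean_space \<times> 'a) measure \<Rightarrow> real" where
  "transport_cost \<gamma> = (\<integral>(x, y). (norm (x - y))\<^sup>2 \<partial>\<gamma>)"

text \<open>For measures in \<^const>\<open>P2\<close> the cost of every coupling is finite and the infimum is attained.\<close>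

definition W2 :: "'a::euclidean_space measure \<Rightarrow> 'a measure \<Rightarrow> real" where
  "W2 \<mu> \<nu> = sqrt (INF \<gamma>\<in>couplings \<mu> \<nu>. transport_cost \<gamma>)"

definition opt_couplings :: "'a::euclidean_space measure \<Rightarrow> 'a measure \<Rightarrow> ('a \<times> 'a) measure set" where
  "opt_couplings \<mu> \<nu> = {\<gamma> \<in> couplings \<mu> \<nu>. transport_cost \<gamma> = (W2 \<mu> \<nu>)\<^sup>2}"

section \<open>Functionals\<close>

text \<open>A functional is a map from measures to \<^typ>\<open>ereal\<close>; only its values on \<^const>\<open>P2\<close> matter.\<close>

definition domJ :: "('a::euclidean_space measure \<Rightarrow> ereal) \<Rightarrow> 'a measure set" where
  "domJ J = {\<mu> \<in> P2. J \<mu> < \<infinity>}"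

definition is_minimiser :: "('a::euclidean_space measure \<Rightarrow> ereal) \<Rightarrow> 'a measure \<Rightarrow> bool" where
  "is_minimiser J \<mu> \<longleftrightarrow> \<mu> \<in> P2 \<and> (\<forall>\<nu>\<in>P2. J \<mu> \<le> J \<nu>)"

definition W2_lsc :: "('a::euclidean_space measure \<Rightarrow> ereal) \<Rightarrow> bool" where
  "W2_lsc J \<longleftrightarrow> (\<forall>\<mu>\<in>P2. \<forall>\<sigma> :: nat \<Rightarrow> 'a measure.
     (\<forall>n. \<sigma> n \<in> P2) \<longrightarrow> (\<lambda>n. W2 (\<sigma> n) \<mu>) \<longlonglongrightarrow> 0 \<longrightarrow> J \<mu> \<le> liminf (\<lambda>n. J (\<sigma> n)))"

text \<open>Plans inducing generalised geodesics from \<open>\<nu>0\<close> to \<open>\<nu>1\<close> with base \<open>\<rho>\<close>; the three marginals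
  \<open>\<rho>\<close>, \<open>\<nu>0\<close>, \<open>\<nu>1\<close> are prescribed by the two coupling conditions.\<close>

definition geodesic_plans ::
    "'a::euclidean_space measure \<Rightarrow> 'a measure \<Rightarrow> 'a measure \<Rightarrow> ('a \<times> 'a \<times> 'a) measure set" where
  "geodesic_plans \<rho> \<nu>0 \<nu>1 = {\<Psi>. sets \<Psi> = sets borel \<and> prob_space \<Psi>
     \<and> distr \<Psi> borel (\<lambda>(x, y, z). (x, y)) \<in> opt_couplings \<rho> \<nu>0
     \<and> distr \<Psi> borel (\<lambda>(x, y, z). (x, z)) \<in> opt_couplings \<rho> \<nu>1}"

definition gen_geodesic :: "('a::euclidean_space \<times> 'a \<times> 'a) measure \<Rightarrow> real \<Rightarrow> 'a measure" where
  "gen_geodesic \<Psi> t = distr \<Psi> borel (\<lambda>(x, y, z). (1 - t) *\<^sub>R y + t *\<^sub>R z)"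

text \<open>The quadratic term carries no factor \<open>t * (1 - t)\<close>, unlike in Ambrosio, Gigli and Savare. For
  \<open>lam \<le> 0\<close> this is weaker than the variant with that factor; for \<open>lam > 0\<close> it is stronger (taking
  \<open>t = 0\<close> it forces the domain to be at most a singleton).\<close>

definition lambda_convex_gg :: "real \<Rightarrow> ('a::euclidean_space measure \<Rightarrow> ereal) \<Rightarrow> bool" where
  "lambda_convex_gg lam J \<longleftrightarrow>
     (\<forall>\<nu>0\<in>domJ J. \<forall>\<nu>1\<in>domJ J. \<forall>\<rho>\<in>P2. \<forall>\<Psi>\<in>geodesic_plans \<rho> \<nu>0 \<nu>1. \<forall>t\<in>{0..1}.
        J (gen_geodesic \<Psi> t) \<le> ereal (1 - t) * J \<nu>0 + ereal t * J \<nu>1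
          - ereal (lam / 2 * (\<integral>(x, y, z). (norm (z - y))\<^sup>2 \<partial>\<Psi>)))"

section \<open>Square-integrable vector fields and the subdifferential\<close>

definition L2_fields :: "'a::euclidean_space measure \<Rightarrow> ('a \<Rightarrow> 'a) set" where
  "L2_fields \<mu> = {f. f \<in> borel_measurable \<mu> \<and> integrable \<mu> (\<lambda>x. (norm (f x))\<^sup>2)}"

definition L2_norm_on :: "'a::euclidean_space measure \<Rightarrow> ('a \<Rightarrow> 'a) \<Rightarrow> real" where
  "L2_norm_on \<mu> f = sqrt (\<integral>x. (norm (f x))\<^sup>2 \<partial>\<mu>)"

text \<open>Elements of \<open>L\<^sup>2\<close> are represented by functions; membership depends only on the
  almost-everywhere class.\<close>

definition subdiff ::
    "real \<Rightarrow> ('a::euclidean_space measure \<Rightarrow> ereal) \<Rightarrow> 'a measure \<Rightarrow> ('a \<Rightarrow> 'a) set" where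
  "subdiff lam J \<mu> = {\<gamma> \<in> L2_fields \<mu>. \<mu> \<in> domJ J \<and>
     (\<forall>\<nu>\<in>P2. \<exists>\<Psi>\<in>opt_couplings \<mu> \<nu>.
        J \<nu> \<ge> J \<mu> + ereal (\<integral>(x, y). \<gamma> x \<bullet> (y - x) \<partial>\<Psi>) + ereal (lam / 2 * (W2 \<mu> \<nu>)\<^sup>2))}"

section \<open>Absolutely continuous curves on the half-line\<close>

definition abs_cont_curve :: "('b \<Rightarrow> 'b \<Rightarrow> real) \<Rightarrow> (real \<Rightarrow> 'b) \<Rightarrow> bool" where
  "abs_cont_curve d c \<longleftrightarrow> (\<exists>g :: real \<Rightarrow> real.
     (\<forall>T\<ge>0. set_integrable lborel {0..T} g) \<and>
     (\<forall>s t. 0 \<le> s \<longrightarrow> s \<le> t \<longrightarrow> d (c s) (c t) \<le> (LINT \<tau>:{s..t}|lborel. g \<tau>)))"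

definition metric_deriv :: "('b \<Rightarrow> 'b \<Rightarrow> real) \<Rightarrow> (real \<Rightarrow> 'b) \<Rightarrow> real \<Rightarrow> real" where
  "metric_deriv d c t = Lim (at 0) (\<lambda>h. d (c (t + h)) (c t) / \<bar>h\<bar>)"

definition finite_length :: "('b \<Rightarrow> 'b \<Rightarrow> real) \<Rightarrow> (real \<Rightarrow> 'b) \<Rightarrow> bool" where
  "finite_length d c \<longleftrightarrow> set_integrable lborel {0..} (metric_deriv d c)"

section \<open>Velocity fields and the subgradient dynamics\<close>

text \<open>\<open>C\<^sup>k\<close> functions: all directional derivatives of a \<open>C\<^sup>k\<^sup>+\<^sup>1\<close> function are \<open>C\<^sup>k\<close>, which in finite
  dimension is the usual notion.\<close>

primrec Ck_fun :: "nat \<Rightarrow> ('b::euclidean_space \<Rightarrow> real) \<Rightarrow> bool" where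
  "Ck_fun 0 f \<longleftrightarrow> continuous_on UNIV f"
| "Ck_fun (Suc k) f \<longleftrightarrow> (\<forall>x. f differentiable (at x))
     \<and> (\<forall>u. Ck_fun k (\<lambda>x. frechet_derivative f (at x) u))"

definition test_functions :: "'b::euclidean_space set \<Rightarrow> ('b \<Rightarrow> real) set" where
  "test_functions U = {\<phi>. (\<forall>k. Ck_fun k \<phi>)
     \<and> compact (closure {x. \<phi> x \<noteq> 0}) \<and> closure {x. \<phi> x \<noteq> 0} \<subseteq> U}"

definition grad :: "('a::euclidean_space \<Rightarrow> real) \<Rightarrow> 'a \<Rightarrow> 'a" where
  "grad f x = (\<Sum>b\<in>Basis. frechet_derivative f (at x) b *\<^sub>R b)"

definition continuity_equation ::
    "(real \<Rightarrow> 'a::euclidean_space measure) \<Rightarrow> (real \<Rightarrow> 'a \<Rightarrow> 'a) \<Rightarrow> bool" where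
  "continuity_equation \<rho> v \<longleftrightarrow> (\<forall>\<phi>\<in>test_functions ({0<..} \<times> UNIV).
     (LINT t:{0<..}|lborel.
        (\<integral>x. deriv (\<lambda>s. \<phi> (s, x)) t + grad (\<lambda>y. \<phi> (t, y)) x \<bullet> v t x \<partial>(\<rho> t))) = 0)"

definition tangent_velocity ::
    "(real \<Rightarrow> 'a::euclidean_space measure) \<Rightarrow> (real \<Rightarrow> 'a \<Rightarrow> 'a) \<Rightarrow> bool" where
  "tangent_velocity \<rho> v \<longleftrightarrow>
     (\<lambda>(t, x). v t x) \<in> borel_measurable borel
   \<and> (AE t in lborel. t > 0 \<longrightarrow>
        v t \<in> L2_fields (\<rho> t)
      \<and> (\<forall>\<epsilon>>0. \<exists>\<phi>\<in>test_functions UNIV. L2_norm_on (\<rho> t) (\<lambda>x. v t x - grad \<phi> x) < \<epsilon>)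
      \<and> L2_norm_on (\<rho> t) (v t) = metric_deriv W2 \<rho> t)
   \<and> continuity_equation \<rho> v"

text \<open>Curves are functions on \<^typ>\<open>real\<close> of which only the values at nonnegative times matter.\<close>

definition subgradient_solution ::
    "real \<Rightarrow> ('a::euclidean_space measure \<Rightarrow> ereal) \<Rightarrow> 'a measure \<Rightarrow> (real \<Rightarrow> 'a measure) \<Rightarrow> bool" where
  "subgradient_solution lam J \<rho>0 \<rho> \<longleftrightarrow>
     (\<forall>t\<ge>0. \<rho> t \<in> P2) \<and> \<rho> 0 = \<rho>0 \<and> abs_cont_curve W2 \<rho>
   \<and> (\<exists>v. tangent_velocity \<rho> v
        \<and> (AE t in lborel. t > 0 \<longrightarrow> (\<lambda>x. - v t x) \<in> subdiff lam J (\<rho> t)))"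

end

theory Submission
  imports Defs
begin

text \<open>
  Along the flow the energy gap \<open>E(t) = J[\<rho>(t)] - Jhat\<close> satisfies \<open>E' = - m\<^sup>2\<close>, with \<open>m\<close> the metric
  derivative, and the gradient inequality reads \<open>c\<^sub>g E\<^sup>1\<^sup>-\<^sup>\<theta> \<le> m\<close> as long as \<open>E > 0\<close>. Hence
  \<open>m \<le> - (E\<^sup>\<theta> / (c\<^sub>g \<theta>))'\<close>, so the curve after time \<open>t\<close> has length at most \<open>E(t)\<^sup>\<theta> / (c\<^sub>g \<theta>)\<close> and is
  Cauchy; and \<open>E' \<le> - c\<^sub>g\<^sup>2 E\<^sup>2\<^sup>-\<^sup>2\<^sup>\<theta>\<close>, which integrates to the stated decay of \<open>E\<close>. Lower
  semicontinuity makes the limit a minimiser. Besides the theory of absolutely continuous curves, this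
  needs that \<open>W2\<close> is a complete metric on \<open>P2\<close>; disintegration of plans is avoided by conditioning
  on small cells.
\<close>

text \<open>The function \<open>y powr \<theta>\<close> has unbounded slope at 0 when \<theta> < 1,
  so the chain rule is applied only on time intervals at whose right end the energy gap is still
  positive: there the gap ranges over a compact part of the positive half-line, and any C1 function
  of it is again absolutely continuous. From extinction on the gap is constant, so its derivative -
  m^2 vanishes and the curve stands still; a supremum argument joins the two regimes. The factor
  1/(c \<theta>) comes from (E^\<theta>)' = - \<theta> E^(\<theta>-1) m^2 \<le> - \<theta> c m. All
  derivatives exist only almost everywhere, hence the fundamental theorem of calculus for absolutely
  continuous functions is built first. Finite length is a statement about
  \<open>metric_deriv\<close> itself, a \<open>Lim\<close> with an arbitrary value where the limit
  fails to exist, so that very function has to be shown measurable.\<close>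

section \<open>Absolutely continuous functions on the line\<close>

text \<open>The intervals on which the difference quotient is off by more than \<open>e\<close> form a Vitali cover
  of the bad set, while Henstock's lemma bounds the total length of any disjoint family of them.\<close>

lemma indefinite_integral_deriv_negligible_aux:
  fixes f :: "real \<Rightarrow> real"
  assumes f: "f integrable_on {a..b}" and e: "e > 0"
  shows "negligible {x \<in> {a<..<b}. \<forall>d>0. \<exists>u v. a \<le> u \<and> v \<le> b \<and> u < v \<and> u \<le> x \<and> x \<le> v \<and> v - u < d \<and>
     \<bar>integral {u..v} f - (v - u) * f x\<bar> > e * (v - u)}" (is "negligible ?B")
proof -
  define B where "B = ?B"
  have "\<exists>T. B \<subseteq> T \<and> T \<in> lmeasurable \<and> measure lebesgue T \<le> \<eta>" if \<eta>: "\<eta> > 0" for \<eta> :: real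
  proof -
  have "f integrable_on cbox a b" using f by simp
  \<comment> \<open>Every bad interval of length l contributes an error above e * l, so dividing the
    total error by e leaves total length at most \<eta>.\<close>
  moreover have "0 < e * \<eta>" using e \<eta> by simp
  ultimately obtain \<gamma> where \<gamma>: "gauge \<gamma>"
    and \<gamma>2: "\<And>p. p tagged_partial_division_of cbox a b \<Longrightarrow> \<gamma> fine p \<Longrightarrow>
        (\<Sum>(x, k)\<in>p. norm (measure lborel k *\<^sub>R f x - integral k f)) < e * \<eta>"
    by (rule Henstock_lemma) blast
  \<comment> \<open>Each bad interval is kept together with its tag x, where Henstock's lemma
    evaluates f. Midpoint and half-length turn it into a ball, the shape in which the Vitali theorem
    is used; the tag need not be the midpoint.\<close>
  define K where "K = {(x, u, v). x \<in> B \<and> a \<le> u \<and> v \<le> b \<and> u < v \<and> u \<le> x \<and> x \<le> v \<and> {u..v} \<subseteq> \<gamma> x \<and>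
     \<bar>integral {u..v} f - (v - u) * f x\<bar> > e * (v - u)}"
  define c where "c = (\<lambda>(x::real, u::real, v::real). (u + v) / 2)"
  define r where "r = (\<lambda>(x::real, u::real, v::real). (v - u) / 2)"
  have cb: "cball (c i) (r i) = {fst (snd i)..snd (snd i)}" for i
    by (cases i) (simp add: c_def r_def cball_eq_atLeastAtMost field_simps)
  have 1: "0 < r i" if "i \<in> K" for i using that by (auto simp: K_def r_def)
  have 2: "\<exists>i. i \<in> K \<and> x \<in> cball (c i) (r i) \<and> r i < d" if x: "x \<in> B" and d: "0 < d" for x d
  proof -
    from \<gamma> have "x \<in> \<gamma> x" "open (\<gamma> x)" by (auto simp: gauge_def)
    then obtain s where s: "s > 0" "ball x s \<subseteq> \<gamma> x" by (meson openE)
    have "\<forall>d>0. \<exists>u v. a \<le> u \<and> v \<le> b \<and> u < v \<and> u \<le> x \<and> x \<le> v \<and> v - u < d \<and>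
        \<bar>integral {u..v} f - (v - u) * f x\<bar> > e * (v - u)" using x by (simp add: B_def)
    moreover have "0 < min d s" using d s by simp
    ultimately have "\<exists>u v. a \<le> u \<and> v \<le> b \<and> u < v \<and> u \<le> x \<and> x \<le> v \<and> v - u < min d s \<and>
        \<bar>integral {u..v} f - (v - u) * f x\<bar> > e * (v - u)" by (elim allE impE)
    then obtain u v where uv: "a \<le> u" "v \<le> b" "u < v" "u \<le> x" "x \<le> v" "v - u < min d s"
      "\<bar>integral {u..v} f - (v - u) * f x\<bar> > e * (v - u)" by (elim exE conjE)
    have "{u..v} \<subseteq> ball x s" using uv by (auto simp: dist_real_def)
    then have "{u..v} \<subseteq> \<gamma> x" using s by simp
    then have "(x, u, v) \<in> K" using uv x unfolding K_def by simp
    moreover have "x \<in> cball (c (x,u,v)) (r (x,u,v))" using uv by (simp add: cb)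
    moreover have "r (x,u,v) < d" using uv by (simp add: r_def)
    ultimately show ?thesis by blast
  qed
  obtain C where C: "countable C" "C \<subseteq> K"
     "pairwise (\<lambda>i j. disjnt (cball (c i) (r i)) (cball (c j) (r j))) C"
     "negligible (B - (\<Union>i \<in> C. cball (c i) (r i)))"
    using Vitali_covering_theorem_cballs[of K r B c] 1 2 by blast
  let ?U = "\<Union>i \<in> C. cball (c i) (r i)"
  have fin: "measure lebesgue (\<Union>i\<in>F. cball (c i) (r i)) \<le> \<eta>" if F: "F \<subseteq> C" "finite F" for F
  proof -
    define h where "h = (\<lambda>(x::real, u::real, v::real). (x, {u..v}))"
    have dj: "disjnt {fst (snd i)..snd (snd i)} {fst (snd j)..snd (snd j)}" if "i \<in> F" "j \<in> F" "i \<noteq> j" for i j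
      using pairwiseD[OF C(3), of i j] F that by (auto simp only: cb)
    have ne: "{fst (snd i)..snd (snd i)} \<noteq> {}" if "i \<in> F" for i
      using that F C(2) by (auto simp: K_def)
    have inj: "inj_on h F"
    proof (rule inj_onI)
      fix i j assume ij: "i \<in> F" "j \<in> F" "h i = h j"
      have "snd (h i) = {fst (snd i)..snd (snd i)}" "snd (h j) = {fst (snd j)..snd (snd j)}"
        by (simp_all add: h_def split_beta)
      then show "i = j" using dj[of i j] ne[of i] ij by (metis disjnt_self_iff_empty)
    qed
    have "h ` F tagged_partial_division_of cbox a b"
      unfolding tagged_partial_division_of_def
    proof (intro conjI allI impI)
      show "finite (h ` F)" using F by simp
      fix x k assume "(x, k) \<in> h ` F"
      then obtain u v where uv: "(x,u,v) \<in> F" "k = {u..v}" by (auto simp: h_def)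
      then have "(x,u,v) \<in> K" using F C by auto
      then show "x \<in> k" "k \<subseteq> cbox a b" "\<exists>a b. k = cbox a b" using uv by (auto simp: K_def)
    next
      fix x1 k1 x2 k2 assume "(x1, k1) \<in> h ` F \<and> (x2, k2) \<in> h ` F \<and> (x1, k1) \<noteq> (x2, k2)"
      then obtain i j where ij: "i \<in> F" "j \<in> F" "h i = (x1, k1)" "h j = (x2, k2)" "i \<noteq> j"
        by (metis imageE)
      have "k1 = {fst (snd i)..snd (snd i)}" "k2 = {fst (snd j)..snd (snd j)}"
        using ij(3,4) by (auto simp: h_def split_beta)
      then have "k1 \<inter> k2 = {}" using dj[of i j] ij by (simp add: disjnt_def)
      then show "interior k1 \<inter> interior k2 = {}" using interior_subset by blast
    qed
    moreover have "\<gamma> fine h ` F"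
      using F C(2) by (force simp: fine_def h_def K_def)
    ultimately have S: "(\<Sum>(x, k)\<in>h ` F. norm (measure lborel k *\<^sub>R f x - integral k f)) < e * \<eta>" by (rule \<gamma>2)
    have "e * measure lebesgue (\<Union>i\<in>F. cball (c i) (r i)) \<le> e * (\<Sum>i\<in>F. measure lebesgue (cball (c i) (r i)))"
      using e F by (intro mult_left_mono measure_UNION_le) auto
    also have "\<dots> = (\<Sum>(x,u,v)\<in>F. e * (v - u))"
      unfolding sum_distrib_left
    proof (rule sum.cong[OF refl])
      fix i assume i: "i \<in> F"
      obtain x u v where [simp]: "i = (x,u,v)" by (cases i)
      have "u < v" using i F C(2) by (auto simp: K_def)
      then show "e * measure lebesgue (cball (c i) (r i)) = (case i of (x, u, v) \<Rightarrow> e * (v - u))" by (simp add: cb)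
    qed
    also have "\<dots> \<le> (\<Sum>(x,u,v)\<in>F. norm (measure lborel {u..v} *\<^sub>R f x - integral {u..v} f))"
    proof (rule sum_mono)
      fix i assume i: "i \<in> F"
      obtain x u v where [simp]: "i = (x,u,v)" by (cases i)
      have "(x,u,v) \<in> K" using i F C(2) by auto
      then show "(case i of (x, u, v) \<Rightarrow> e * (v - u)) \<le> (case i of (x,u,v) \<Rightarrow> norm (measure lborel {u..v} *\<^sub>R f x - integral {u..v} f))"
        by (auto simp: K_def abs_minus_commute)
    qed
    also have "\<dots> = (\<Sum>(x, k)\<in>h ` F. norm (measure lborel k *\<^sub>R f x - integral k f))"
      by (subst sum.reindex[OF inj]) (auto intro!: sum.cong simp: h_def)
    finally have "e * measure lebesgue (\<Union>i\<in>F. cball (c i) (r i)) \<le> e * \<eta>" using S by linarith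
    then show ?thesis using e by simp
  qed
  \<comment> \<open>The bound is uniform over finite subfamilies, so it passes to the countable
    union.\<close>
  have U: "?U \<in> lmeasurable" and mU: "measure lebesgue ?U \<le> \<eta>"
    using fmeasurable_UN_bound[OF C(1), of "\<lambda>i. cball (c i) (r i)" lebesgue \<eta>]
      measure_UN_bound[OF C(1), of "\<lambda>i. cball (c i) (r i)" lebesgue \<eta>] fin by auto
  let ?N = "B - ?U"
  show "\<exists>T. B \<subseteq> T \<and> T \<in> lmeasurable \<and> measure lebesgue T \<le> \<eta>"
  proof (intro exI conjI)
    show "B \<subseteq> ?N \<union> ?U" by blast
    show "?N \<union> ?U \<in> lmeasurable" using U C(4) by (intro fmeasurable.Un) (auto simp: negligible_iff_measure)
    have "measure lebesgue (?N \<union> ?U) \<le> measure lebesgue ?N + measure lebesgue ?U"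
      using U C(4) by (intro measure_Un_le) (auto simp: negligible_iff_measure)
    then show "measure lebesgue (?N \<union> ?U) \<le> \<eta>" using mU C(4) by (simp add: negligible_iff_measure)
  qed
qed
  then show ?thesis unfolding negligible_outer_le B_def by blast
qed

text \<open>Where differentiability fails, for some n the error exceeds 1/(n+1) times the length on
  arbitrarily short intervals, so the exceptional set lies in a countable union of the null sets
  just treated. The difference quotient at h uses the interval between x and x + h.\<close>

lemma indefinite_integral_deriv_negligible:
  fixes f :: "real \<Rightarrow> real"
  assumes f: "f integrable_on {a..b}"
  shows "negligible {x \<in> {a<..<b}. \<not> ((\<lambda>x. integral {a..x} f) has_real_derivative f x) (at x)}"
proof -
  let ?B = "\<lambda>e. {x \<in> {a<..<b}. \<forall>d>0. \<exists>u v. a \<le> u \<and> v \<le> b \<and> u < v \<and> u \<le> x \<and> x \<le> v \<and> v - u < d \<and>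
     \<bar>integral {u..v} f - (v - u) * f x\<bar> > e * (v - u)}"
  have "negligible (\<Union>(range (\<lambda>n::nat. ?B (1 / real (Suc n)))))"
  proof (rule negligible_countable_Union)
    fix X assume "X \<in> range (\<lambda>n::nat. ?B (1 / real (Suc n)))"
    then obtain n where "X = ?B (1 / real (Suc n))" by blast
    moreover have "0 < 1 / real (Suc n)" by simp
    ultimately show "negligible X" using indefinite_integral_deriv_negligible_aux[OF f] by blast
  qed simp
  moreover have "{x \<in> {a<..<b}. \<not> ((\<lambda>x. integral {a..x} f) has_real_derivative f x) (at x)}
     \<subseteq> (\<Union>n::nat. ?B (1 / real (Suc n)))"
  proof (rule subsetI, rule ccontr)
    fix x assume x: "x \<in> {x \<in> {a<..<b}. \<not> ((\<lambda>x. integral {a..x} f) has_real_derivative f x) (at x)}"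
      and nB: "x \<notin> (\<Union>n::nat. ?B (1 / real (Suc n)))"
    have "((\<lambda>x. integral {a..x} f) has_real_derivative f x) (at x)"
      unfolding DERIV_def tendsto_iff eventually_at dist_real_def
    proof (intro allI impI)
      fix e :: real assume "e > 0"
      then obtain n where n: "1 / real (Suc n) < e" using nat_approx_posE by (metis)
      from nB have "x \<notin> ?B (1 / real (Suc n))" by simp
      with x obtain d where d: "d > 0" "\<And>u v. a \<le> u \<Longrightarrow> v \<le> b \<Longrightarrow> u < v \<Longrightarrow> u \<le> x \<Longrightarrow> x \<le> v \<Longrightarrow> v - u < d \<Longrightarrow>
         \<bar>integral {u..v} f - (v - u) * f x\<bar> \<le> 1 / real (Suc n) * (v - u)" 
        by (clarsimp simp only: mem_Collect_eq not_less not_all not_ex not_imp de_Morgan_conj greaterThanLessThan_iff) (meson not_le)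
      let ?d = "min d (min (x - a) (b - x))"
      show "\<exists>d>0. \<forall>h\<in>UNIV. h \<noteq> 0 \<and> \<bar>h - 0\<bar> < d \<longrightarrow> \<bar>(integral {a..x + h} f - integral {a..x} f) / h - f x\<bar> < e"
      proof (intro exI[of _ ?d] conjI ballI impI)
        show "?d > 0" using x d by auto
        fix h :: real assume h: "h \<noteq> 0 \<and> \<bar>h - 0\<bar> < ?d"
        show "\<bar>(integral {a..x + h} f - integral {a..x} f) / h - f x\<bar> < e"
        proof (cases "h > 0")
          case True
          have "integral {a..x} f + integral {x..x+h} f = integral {a..x+h} f"
            using h x True by (intro Henstock_Kurzweil_Integration.integral_combine integrable_subinterval_real[OF f]) auto
          moreover have "\<bar>integral {x..x+h} f - ((x+h) - x) * f x\<bar> \<le> 1 / real (Suc n) * ((x+h) - x)"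
            using h x True by (intro d) auto
          ultimately have "\<bar>(integral {a..x + h} f - integral {a..x} f) - h * f x\<bar> \<le> 1 / real (Suc n) * h" by auto
          moreover have "(integral {a..x + h} f - integral {a..x} f) - h * f x =
              ((integral {a..x + h} f - integral {a..x} f) / h - f x) * h"
            unfolding left_diff_distrib[of _ "f x"] using h by simp
          ultimately have "\<bar>((integral {a..x + h} f - integral {a..x} f) / h - f x) * h\<bar> \<le> 1 / real (Suc n) * h"
            by (simp only:)
          then have "\<bar>(integral {a..x + h} f - integral {a..x} f) / h - f x\<bar> * h \<le> 1 / real (Suc n) * h"
            using True by (simp only: abs_mult abs_of_pos)
          then have "\<bar>(integral {a..x + h} f - integral {a..x} f) / h - f x\<bar> \<le> 1 / real (Suc n)"
            using True by (rule mult_right_le_imp_le)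
          then show ?thesis using n by linarith
        next
          case False
          then have False: "h < 0" using h by auto
          have "integral {a..x+h} f + integral {x+h..x} f = integral {a..x} f"
            using h x False by (intro Henstock_Kurzweil_Integration.integral_combine integrable_subinterval_real[OF f]) auto
          moreover have "\<bar>integral {x+h..x} f - (x - (x+h)) * f x\<bar> \<le> 1 / real (Suc n) * (x - (x+h))"
            using h x False by (intro d) auto
          ultimately have "\<bar>(integral {a..x + h} f - integral {a..x} f) - h * f x\<bar> \<le> 1 / real (Suc n) * (-h)" by (auto simp: abs_le_iff)
          moreover have "(integral {a..x + h} f - integral {a..x} f) - h * f x =
              ((integral {a..x + h} f - integral {a..x} f) / h - f x) * h"
            unfolding left_diff_distrib[of _ "f x"] using h by simp
          ultimately have "\<bar>((integral {a..x + h} f - integral {a..x} f) / h - f x) * h\<bar> \<le> 1 / real (Suc n) * (-h)"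
            by (simp only:)
          then have "\<bar>(integral {a..x + h} f - integral {a..x} f) / h - f x\<bar> * (-h) \<le> 1 / real (Suc n) * (-h)"
            using False by (simp only: abs_mult abs_of_neg)
          then have "\<bar>(integral {a..x + h} f - integral {a..x} f) / h - f x\<bar> \<le> 1 / real (Suc n)"
            by (rule mult_right_le_imp_le) (use False in simp)
          then show ?thesis using n by linarith
        qed
      qed
    qed
    then show False using x by blast
  qed
  ultimately show ?thesis by (rule negligible_subset)
qed

text \<open>On (-n, n) the function \<phi> is the indefinite integral from -n plus the constant
  \<phi> (-n), and countably many such windows cover the line. \<open>negligible\<close> refers to
  the completed measure, hence the passage through \<open>AE_completion_iff\<close>.\<close>

lemma AE_deriv_primitive:
  fixes f \<phi> :: "real \<Rightarrow> real"
  assumes f: "integrable lborel f"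
    and \<phi>: "\<And>s t. s \<le> t \<Longrightarrow> \<phi> t - \<phi> s = (LINT x:{s..t}|lborel. f x)"
  shows "AE x in lborel. (\<phi> has_real_derivative f x) (at x)"
proof -
  have si: "set_integrable lborel {s..t} f" for s t
    unfolding set_integrable_def using f by (intro integrable_mult_indicator) auto
  have eq: "\<phi> t - \<phi> s = integral {s..t} f" if "s \<le> t" for s t
    using \<phi>[OF that] set_borel_integral_eq_integral(2)[OF si] by simp
  have "AE x in lborel. x \<in> {- real n<..<real n} \<longrightarrow> (\<phi> has_real_derivative f x) (at x)" for n
  proof -
    let ?N = "{x \<in> {- real n<..<real n}. \<not> ((\<lambda>x. integral {- real n..x} f) has_real_derivative f x) (at x)}"
    have "f integrable_on {- real n..real n}" using set_borel_integral_eq_integral(1)[OF si] .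
    then have "negligible ?N" by (rule indefinite_integral_deriv_negligible)
    then have "AE x in lborel. x \<notin> ?N"
      using AE_not_in[of ?N lebesgue] by (simp add: negligible_iff_null_sets AE_completion_iff)
    then show ?thesis
    proof (rule AE_mp, intro AE_I2 impI)
      fix x assume "x \<notin> ?N" and x: "x \<in> {- real n<..<real n}"
      then have "((\<lambda>x. integral {- real n..x} f + \<phi> (- real n)) has_real_derivative f x) (at x)"
        by (auto intro!: derivative_eq_intros)
      then show "(\<phi> has_real_derivative f x) (at x)"
      proof (rule has_field_derivative_transform_within_open)
        show "open {- real n<..<real n}" "x \<in> {- real n<..<real n}" using x by auto
        show "integral {- real n..y} f + \<phi> (- real n) = \<phi> y" if "y \<in> {- real n<..<real n}" for y
          using eq[of "- real n" y] that by simp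
      qed
    qed
  qed
  then have "AE x in lborel. \<forall>n. x \<in> {- real n<..<real n} \<longrightarrow> (\<phi> has_real_derivative f x) (at x)"
    unfolding AE_all_countable by blast
  then show ?thesis
  proof (rule AE_mp, intro AE_I2 impI)
    fix x assume A: "\<forall>n. x \<in> {- real n<..<real n} \<longrightarrow> (\<phi> has_real_derivative f x) (at x)"
    obtain n where "\<bar>x\<bar> < real n" using reals_Archimedean2 by blast
    then show "(\<phi> has_real_derivative f x) (at x)" using A by (auto simp: abs_less_iff)
  qed
qed

section \<open>Densities of absolutely continuous functions\<close>

lemma exists_sum_measure:
  assumes "sets N = sets M"
  obtains L where "sets L = sets M" "\<And>A. A \<in> sets M \<Longrightarrow> emeasure L A = emeasure M A + emeasure N A"
proof
  let ?L = "measure_of (space M) (sets M) (\<lambda>A. emeasure M A + emeasure N A)"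
  show "sets ?L = sets M" by simp
  show "emeasure ?L A = emeasure M A + emeasure N A" if "A \<in> sets M" for A
  proof (rule emeasure_measure_of_sigma[OF _ _ _ that])
    show "sigma_algebra (space M) (sets M)" by (rule sets.sigma_algebra_axioms)
    show "positive (sets M) (\<lambda>A. emeasure M A + emeasure N A)" by (simp add: positive_def)
    show "countably_additive (sets M) (\<lambda>A. emeasure M A + emeasure N A)"
    proof (rule countably_additiveI)
      fix A :: "nat \<Rightarrow> 'a set" assume A: "range A \<subseteq> sets M" "disjoint_family A" "(\<Union>i. A i) \<in> sets M"
      have "(\<Sum>i. emeasure M (A i) + emeasure N (A i)) = (\<Sum>i. emeasure M (A i)) + (\<Sum>i. emeasure N (A i))"
        by (rule suminf_add[symmetric]) auto
      also have "\<dots> = emeasure M (\<Union>i. A i) + emeasure N (\<Union>i. A i)"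
        using A assms by (simp add: suminf_emeasure)
      finally show "(\<Sum>i. emeasure M (A i) + emeasure N (A i)) = emeasure M (\<Union>i. A i) + emeasure N (\<Union>i. A i)" .
    qed
  qed
qed

text \<open>With \<open>G\<close> a primitive of \<open>g\<close>, both \<open>G + \<phi>\<close> and \<open>G - \<phi>\<close> are nondecreasing, and their Stieltjes
  measures add up to the measure with density \<open>2 * g\<close>; so Radon-Nikodym applies to each of them.\<close>

lemma abs_cont_has_density:
  fixes \<phi> g :: "real \<Rightarrow> real"
  assumes g: "integrable lborel g" "\<And>x. 0 \<le> g x"
    and ac: "\<And>s t. s \<le> t \<Longrightarrow> \<bar>\<phi> t - \<phi> s\<bar> \<le> (LINT x:{s..t}|lborel. g x)"
  obtains f where "integrable lborel f" "\<And>s t. s \<le> t \<Longrightarrow> \<phi> t - \<phi> s = (LINT x:{s..t}|lborel. f x)"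
proof -
  have [measurable]: "g \<in> borel_measurable borel" using g by auto
  have si: "set_integrable lborel A f" if "A \<in> sets borel" "integrable lborel f" for A and f :: "real \<Rightarrow> real"
    unfolding set_integrable_def using that by (intro integrable_mult_indicator) auto
  \<comment> \<open>Finite because g is integrable on the whole line; its distribution function G is
    a primitive of g with the right continuity that Stieltjes measures require.\<close>
  define \<nu> where "\<nu> = density lborel (\<lambda>x. ennreal (g x))"
  have [measurable_cong, simp]: "sets \<nu> = sets borel" "space \<nu> = UNIV" by (auto simp: \<nu>_def)
  have \<nu>: "emeasure \<nu> A = ennreal (LINT x:A|lborel. g x)" if [measurable]: "A \<in> sets borel" for A
  proof -
    have "emeasure \<nu> A = (\<integral>\<^sup>+ x. ennreal (indicator A x *\<^sub>R g x) \<partial>lborel)"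
      by (auto simp: \<nu>_def emeasure_density intro!: nn_integral_cong split: split_indicator)
    also have "\<dots> = ennreal (LINT x:A|lborel. g x)"
      unfolding set_lebesgue_integral_def
      using si[OF that g(1)] g(2) by (intro nn_integral_eq_integral) (auto simp: set_integrable_def)
    finally show ?thesis .
  qed
  have \<nu>0: "0 \<le> (LINT x:A|lborel. g x)" for A
    unfolding set_lebesgue_integral_def using g(2) by (intro Bochner_Integration.integral_nonneg) auto
  have "finite_measure \<nu>"
    by (rule finite_measureI) (simp add: \<nu>[of UNIV])
  then interpret finite_borel_measure \<nu>
    by (intro finite_borel_measure.intro finite_borel_measure_axioms.intro) simp_all
  define G where "G = cdf \<nu>"
  have half_open: "(LINT x:{s..t}|lborel. f x) = (LINT x:{s<..t}|lborel. f x)" for s t and f :: "real \<Rightarrow> real"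
    by (rule set_integral_discrete_difference[where X = "{s}"]) auto
  have Gdiff: "G t - G s = (LINT x:{s..t}|lborel. g x)" if "s \<le> t" for s t
  proof (cases "s = t")
    case False
    then have "G t - G s = measure \<nu> {s<..t}" using that by (simp add: G_def cdf_diff_eq)
    also have "\<dots> = (LINT x:{s<..t}|lborel. g x)" using \<nu>0 by (simp add: measure_def \<nu>)
    finally show ?thesis by (simp add: half_open)
  qed (use half_open[of t t g] in \<open>simp add: set_lebesgue_integral_def\<close>)
  have G\<phi>: "\<bar>\<phi> t - \<phi> s\<bar> \<le> G t - G s" if "s \<le> t" for s t
    using ac[OF that] Gdiff[OF that] by simp
  have G_rc: "continuous (at_right a) G" for a
    unfolding G_def by (rule cdf_is_right_cont)
  have \<phi>_rc: "continuous (at_right a) \<phi>" for a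
  proof -
    have "((\<lambda>x. G x - G a) \<longlongrightarrow> G a - G a) (at_right a)"
      using G_rc[of a] unfolding continuous_within by (intro tendsto_intros)
    then have "((\<lambda>x. G x - G a) \<longlongrightarrow> 0) (at_right a)" by simp
    moreover have "eventually (\<lambda>x. norm (\<phi> x - \<phi> a) \<le> G x - G a) (at_right a)"
      using G\<phi> by (auto simp: eventually_at_filter)
    ultimately have "((\<lambda>x. \<phi> x - \<phi> a) \<longlongrightarrow> 0) (at_right a)"
      by (rule Lim_null_comparison[rotated])
    then show ?thesis unfolding continuous_within by (simp add: Lim_null[symmetric])
  qed
  define H where "H = (\<lambda>x. G x + \<phi> x)"
  define K where "K = (\<lambda>x. G x - \<phi> x)"
  have mono: "H s \<le> H t" "K s \<le> K t" if "s \<le> t" for s t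
    using G\<phi>[OF that] by (auto simp: H_def K_def)
  have rc: "continuous (at_right a) H" "continuous (at_right a) K" for a
    unfolding H_def K_def by (intro continuous_intros G_rc \<phi>_rc)+
  have eH: "emeasure (interval_measure H) {s<..t} = ennreal (H t - H s)" if "s \<le> t" for s t
    using that mono rc by (intro emeasure_interval_measure_Ioc)
  have eK: "emeasure (interval_measure K) {s<..t} = ennreal (K t - K s)" if "s \<le> t" for s t
    using that mono rc by (intro emeasure_interval_measure_Ioc)
  obtain L where L: "sets L = sets (interval_measure H)" "\<And>A. A \<in> sets (interval_measure H) \<Longrightarrow>
      emeasure L A = emeasure (interval_measure H) A + emeasure (interval_measure K) A"
    by (rule exists_sum_measure[of "interval_measure K" "interval_measure H"]) auto
  \<comment> \<open>Both sides agree on half-open intervals, since H + K = 2 G, and these form a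
    generating pi-system. The summand belonging to H is thus dominated by 2 \<nu>, which makes it
    absolutely continuous with respect to Lebesgue measure.\<close>
  have LD: "L = scale_measure 2 \<nu>"
  proof (rule measure_eqI_generator_eq[where E = "range (\<lambda>(a, b). {a <.. b::real})" and \<Omega> = UNIV
        and A = "\<lambda>n. {- real n<..real n}"])
    show "Int_stable (range (\<lambda>(a, b). {a <.. b::real}))"
      by (auto simp: Int_stable_def)
    show "sets L = sigma_sets UNIV (range (\<lambda>(a, b). {a <.. b::real}))"
      using L by (simp add: borel_sigma_sets_Ioc)
    show "sets (scale_measure 2 \<nu>) = sigma_sets UNIV (range (\<lambda>(a, b). {a <.. b::real}))"
      by (simp add: borel_sigma_sets_Ioc)
    show "emeasure L X = emeasure (scale_measure 2 \<nu>) X" if "X \<in> range (\<lambda>(a, b). {a <.. b::real})" for X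
    proof -
      from that obtain a b where X: "X = {a<..b}" by auto
      show ?thesis
      proof (cases "a \<le> b")
        case True
        have "emeasure L X = ennreal (H b - H a) + ennreal (K b - K a)"
          using L True by (simp add: X eH eK)
        also have "\<dots> = ennreal (2 * (G b - G a))"
          using mono[OF True] by (subst ennreal_plus[symmetric]) (auto simp: H_def K_def)
        also have "\<dots> = 2 * ennreal (LINT x:{a<..b}|lborel. g x)"
          using \<nu>0 by (simp add: Gdiff[OF True] half_open ennreal_mult)
        finally show ?thesis by (simp add: X \<nu>)
      qed (simp add: X)
    qed
    show "(\<Union>n. {- real n<..real n}) = UNIV"
    proof (rule set_eqI)
      fix x :: real
      obtain n where "\<bar>x\<bar> < real n" using reals_Archimedean2 by blast
      then have "x \<in> {- real n<..real n}" by auto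
      then show "x \<in> (\<Union>n. {- real n<..real n}) \<longleftrightarrow> x \<in> UNIV" by blast
    qed
    show "emeasure L {- real n<..real n} \<noteq> \<infinity>" for n
      using L by (simp add: eH eK)
  qed auto
  have NH_le: "emeasure (interval_measure H) A \<le> 2 * emeasure \<nu> A" if "A \<in> sets borel" for A
    using L(2)[of A] that by (simp add: LD)
  have "absolutely_continuous lborel (interval_measure H)"
    unfolding absolutely_continuous_def
  proof
    fix A assume A: "A \<in> null_sets (lborel :: real measure)"
    have "absolutely_continuous lborel \<nu>"
      unfolding \<nu>_def by (rule absolutely_continuousI_density) auto
    then have "A \<in> null_sets \<nu>" using A unfolding absolutely_continuous_def by blast
    then have "emeasure \<nu> A = 0" "A \<in> sets borel" by auto
    then show "A \<in> null_sets (interval_measure H)" using NH_le[of A] by auto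
  qed
  then obtain f0 where [measurable]: "f0 \<in> borel_measurable lborel" and f0: "density lborel f0 = interval_measure H"
    using sigma_finite_measure.Radon_Nikodym[OF sigma_finite_lborel, of "interval_measure H"] by auto
  have f0_int: "emeasure (interval_measure H) A = (\<integral>\<^sup>+ x. f0 x * indicator A x \<partial>lborel)" if "A \<in> sets borel" for A
    using that by (simp add: f0[symmetric] emeasure_density)
  have "(\<integral>\<^sup>+ x. f0 x \<partial>lborel) \<le> 2 * emeasure \<nu> UNIV"
    using f0_int[of UNIV] NH_le[of UNIV] by simp
  also have "\<dots> < \<infinity>" by (simp add: \<nu> ennreal_mult_less_top)
  finally have fin: "(\<integral>\<^sup>+ x. f0 x \<partial>lborel) < \<infinity>" .
  then have AEf: "AE x in lborel. f0 x \<noteq> \<infinity>" by (intro nn_integral_noteq_infinite) auto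
  define f1 where "f1 = (\<lambda>x. enn2real (f0 x))"
  have [measurable]: "f1 \<in> borel_measurable borel" unfolding f1_def by simp
  have f1_f0: "AE x in lborel. ennreal (f1 x) = f0 x"
    using AEf by eventually_elim (simp add: f1_def less_top)
  have f1_int: "integrable lborel f1"
  proof (rule integrableI_nonneg)
    show "(\<integral>\<^sup>+ x. ennreal (f1 x) \<partial>lborel) < \<infinity>"
      using fin nn_integral_cong_AE[OF f1_f0] by simp
  qed (auto simp: f1_def)
  have Hdiff: "H t - H s = (LINT x:{s..t}|lborel. f1 x)" if "s \<le> t" for s t
  proof -
    have "ennreal (H t - H s) = (\<integral>\<^sup>+ x. f0 x * indicator {s<..t} x \<partial>lborel)"
      using eH[OF that] f0_int[of "{s<..t}"] by simp
    also have "\<dots> = (\<integral>\<^sup>+ x. ennreal (indicator {s<..t} x *\<^sub>R f1 x) \<partial>lborel)"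
    proof (rule nn_integral_cong_AE)
      show "AE x in lborel. f0 x * indicator {s<..t} x = ennreal (indicator {s<..t} x *\<^sub>R f1 x)"
        using f1_f0 by eventually_elim (auto split: split_indicator)
    qed
    also have "\<dots> = ennreal (LINT x:{s<..t}|lborel. f1 x)"
      unfolding set_lebesgue_integral_def
      using si[OF _ f1_int, of "{s<..t}"] by (intro nn_integral_eq_integral) (auto simp: set_integrable_def f1_def)
    finally have "H t - H s = (LINT x:{s<..t}|lborel. f1 x)"
      using mono(1)[OF that] by (subst (asm) ennreal_inj) (auto simp: set_lebesgue_integral_def f1_def intro!: Bochner_Integration.integral_nonneg)
    then show ?thesis by (simp add: half_open)
  qed
  show ?thesis
  proof
    \<comment> \<open>Since \<phi> = H - G, its density is that of H minus g.\<close>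
    show "integrable lborel (\<lambda>x. f1 x - g x)" using f1_int g by simp
    show "\<phi> t - \<phi> s = (LINT x:{s..t}|lborel. f1 x - g x)" if "s \<le> t" for s t
    proof -
      have "(LINT x:{s..t}|lborel. f1 x - g x) = (H t - H s) - (G t - G s)"
        using Hdiff[OF that] Gdiff[OF that] si f1_int g by (simp add: set_integral_diff)
      then show ?thesis by (simp add: H_def)
    qed
  qed
qed

lemma primitive_exists:
  fixes f :: "real \<Rightarrow> real"
  assumes f: "integrable lborel f"
  obtains F where "\<And>s t. s \<le> t \<Longrightarrow> F t - F s = (LINT x:{s..t}|lborel. f x)" "continuous_on UNIV F"
proof -
  define F where "F x = (if 0 \<le> x then (LINT y:{0..x}|lborel. f y) else - (LINT y:{x..0}|lborel. f y))" for x
  have si: "set_integrable lborel {s..t} f" for s t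
    unfolding set_integrable_def using f by (intro integrable_mult_indicator) auto
  note HK = set_borel_integral_eq_integral[OF si]
  have comb: "(LINT y:{r..s}|lborel. f y) + (LINT y:{s..t}|lborel. f y) = (LINT y:{r..t}|lborel. f y)"
    if "r \<le> s" "s \<le> t" for r s t
    using that HK by (simp add: Henstock_Kurzweil_Integration.integral_combine)
  have F: "F t - F s = (LINT x:{s..t}|lborel. f x)" if "s \<le> t" for s t
    using that comb[of 0 s t] comb[of s 0 t] comb[of s t 0] by (auto simp: F_def)
  have "continuous_on {- real n<..<real n} F" for n
  proof -
    have "continuous_on {- real n..real n} (\<lambda>x. F (- real n) + integral {- real n..x} f)"
      by (intro continuous_intros indefinite_integral_continuous_1 HK)
    then have "continuous_on {- real n..real n} F"
    proof (rule continuous_on_eq)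
      fix x assume "x \<in> {- real n..real n}"
      then have "F x - F (- real n) = integral {- real n..x} f" using F[of "- real n" x] HK(2) by simp
      then show "F (- real n) + integral {- real n..x} f = F x" by linarith
    qed
    then show ?thesis by (rule continuous_on_subset) auto
  qed
  then have "continuous_on (\<Union>n. {- real n<..<real n}) F"
    by (intro continuous_on_open_UN) auto
  moreover have "(\<Union>n. {- real n<..<real n}) = UNIV"
  proof (rule set_eqI)
    fix x :: real
    obtain n where "\<bar>x\<bar> < real n" using reals_Archimedean2 by blast
    then have "x \<in> {- real n<..<real n}" by auto
    then show "x \<in> (\<Union>n. {- real n<..<real n}) \<longleftrightarrow> x \<in> UNIV" by blast
  qed
  ultimately have "continuous_on UNIV F" by simp
  with F show ?thesis by (rule that)
qed

text \<open>The bound on f is read off at points where \<phi> and a primitive G of g are both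
  differentiable: the difference quotients of \<phi> are dominated by those of G, for either sign of
  h.\<close>

lemma abs_cont_FTC:
  fixes \<phi> g :: "real \<Rightarrow> real"
  assumes g: "integrable lborel g" "\<And>x. 0 \<le> g x"
    and ac: "\<And>s t. s \<le> t \<Longrightarrow> \<bar>\<phi> t - \<phi> s\<bar> \<le> (LINT x:{s..t}|lborel. g x)"
  obtains f where "integrable lborel f" "\<And>s t. s \<le> t \<Longrightarrow> \<phi> t - \<phi> s = (LINT x:{s..t}|lborel. f x)"
    "AE x in lborel. (\<phi> has_real_derivative f x) (at x)" "AE x in lborel. \<bar>f x\<bar> \<le> g x"
proof -
  obtain f where f: "integrable lborel f" "\<And>s t. s \<le> t \<Longrightarrow> \<phi> t - \<phi> s = (LINT x:{s..t}|lborel. f x)"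
    using abs_cont_has_density[OF assms] by blast
  have d: "AE x in lborel. (\<phi> has_real_derivative f x) (at x)"
    by (rule AE_deriv_primitive[OF f])
  obtain G where G: "\<And>s t. s \<le> t \<Longrightarrow> G t - G s = (LINT x:{s..t}|lborel. g x)"
    using primitive_exists[OF g(1)] by blast
  have "AE x in lborel. (G has_real_derivative g x) (at x)"
    by (rule AE_deriv_primitive[OF g(1) G])
  with d have "AE x in lborel. \<bar>f x\<bar> \<le> g x"
  proof eventually_elim
    case (elim x)
    have "((\<lambda>h. \<bar>(\<phi> (x + h) - \<phi> x) / h\<bar>) \<longlongrightarrow> \<bar>f x\<bar>) (at 0)"
      using elim(1) unfolding DERIV_def by (rule tendsto_rabs)
    moreover have "((\<lambda>h. (G (x + h) - G x) / h) \<longlongrightarrow> g x) (at 0)"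
      using elim(2) unfolding DERIV_def .
    moreover have "\<bar>(\<phi> (x + h) - \<phi> x) / h\<bar> \<le> (G (x + h) - G x) / h" for h
    proof (cases "h \<ge> 0")
      case True
      then have "\<bar>\<phi> (x + h) - \<phi> x\<bar> \<le> G (x + h) - G x" using ac[of x "x+h"] G[of x "x+h"] by simp
      then show ?thesis using True by (simp add: abs_divide divide_right_mono)
    next
      case False
      then have "\<bar>\<phi> (x + h) - \<phi> x\<bar> \<le> G x - G (x + h)" using ac[of "x+h" x] G[of "x+h" x] by simp
      then have "\<bar>\<phi> (x + h) - \<phi> x\<bar> / (- h) \<le> (G x - G (x + h)) / (- h)" using False by (intro divide_right_mono) auto
      also have "(G x - G (x + h)) / (- h) = (G (x + h) - G x) / h"
        by (subst minus_divide_divide[symmetric]) simp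
      finally show ?thesis using False by (simp add: abs_divide)
    qed
    ultimately show ?case by (intro tendsto_le[OF at_neq_bot]) (auto intro: always_eventually)
  qed
  with f d show ?thesis using that by blast
qed

text \<open>The derivative D coincides almost everywhere with the density of \<phi> by uniqueness of
  derivatives, so the pointwise bound integrates. The endpoints s and t form a null set.\<close>

lemma abs_cont_le_integral:
  fixes \<phi> g w :: "real \<Rightarrow> real"
  assumes g: "integrable lborel g" "\<And>x. 0 \<le> g x"
    and ac: "\<And>s t. s \<le> t \<Longrightarrow> \<bar>\<phi> t - \<phi> s\<bar> \<le> (LINT x:{s..t}|lborel. g x)"
    and w: "set_integrable lborel {s..t} w"
    and le: "AE x in lborel. s < x \<longrightarrow> x < t \<longrightarrow> (\<exists>D. (\<phi> has_real_derivative D) (at x) \<and> D \<le> w x)"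
    and st: "s \<le> t"
  shows "\<phi> t - \<phi> s \<le> (LINT x:{s..t}|lborel. w x)"
proof -
  obtain f where f: "integrable lborel f" "\<And>s t. s \<le> t \<Longrightarrow> \<phi> t - \<phi> s = (LINT x:{s..t}|lborel. f x)"
    "AE x in lborel. (\<phi> has_real_derivative f x) (at x)"
    using abs_cont_FTC[OF g ac] by metis
  have "AE x in lborel. x \<noteq> s" "AE x in lborel. x \<noteq> t" by (rule AE_lborel_singleton)+
  with f(3) le have "AE x\<in>{s..t} in lborel. f x \<le> w x"
  proof eventually_elim
    case (elim x)
    then show ?case using DERIV_unique by fastforce
  qed
  moreover have "set_integrable lborel {s..t} f"
    unfolding set_integrable_def using f by (intro integrable_mult_indicator) auto
  ultimately have "(LINT x:{s..t}|lborel. f x) \<le> (LINT x:{s..t}|lborel. w x)"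
    using w by (intro set_integral_mono_AE) auto
  then show ?thesis using f(2)[OF st] by simp
qed

section \<open>The metric derivative\<close>

text \<open>Here \<open>p s t\<close> stands for the distance between the points of a curve at times \<open>s\<close> and \<open>t\<close>. The
  metric derivative is the supremum over rational \<open>r\<close> of the derivatives of \<open>\<lambda>t. p r t\<close>, since the
  points at rational times are dense in the image of the curve.\<close>

lemma metric_derivative_exists:
  fixes p :: "real \<Rightarrow> real \<Rightarrow> real" and g :: "real \<Rightarrow> real"
  assumes g: "integrable lborel g" "\<And>x. 0 \<le> g x"
    and sym: "\<And>s t. p s t = p t s"
    and nonneg: "\<And>s t. 0 \<le> p s t"
    and triangle: "\<And>r s t. p r t \<le> p r s + p s t"
    and ac: "\<And>s t. s \<le> t \<Longrightarrow> p s t \<le> (LINT x:{s..t}|lborel. g x)"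
  obtains m where "integrable lborel m" "\<And>x. 0 \<le> m x"
    "\<And>s t. s \<le> t \<Longrightarrow> p s t \<le> (LINT x:{s..t}|lborel. m x)"
    "AE t in lborel. ((\<lambda>h. p (t + h) t / \<bar>h\<bar>) \<longlongrightarrow> m t) (at 0)"
proof -
  have [measurable]: "g \<in> borel_measurable borel" using g by auto
  have p_diff: "\<bar>p r t - p r s\<bar> \<le> p s t" for r s t
    using triangle[of r t s] triangle[of r s t] sym[of s t] by linarith
  define Q where "Q r f \<longleftrightarrow> integrable lborel f \<and>
    (\<forall>s t. s \<le> t \<longrightarrow> p (of_rat r) t - p (of_rat r) s = (LINT x:{s..t}|lborel. f x)) \<and>
    (AE x in lborel. (p (of_rat r) has_real_derivative f x) (at x)) \<and> (AE x in lborel. \<bar>f x\<bar> \<le> g x)" for r :: rat and f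
  have "\<exists>f. Q r f" for r
  proof -
    have "\<bar>p (of_rat r) t - p (of_rat r) s\<bar> \<le> (LINT x:{s..t}|lborel. g x)" if "s \<le> t" for s t
      using p_diff[of "of_rat r" t s] ac[OF that] by linarith
    from abs_cont_FTC[OF g this] show ?thesis unfolding Q_def by metis
  qed
  then have "\<forall>r. \<exists>f. Q r f" by simp
  from choice[OF this] obtain f where fQ: "\<And>r. Q r (f r)" by blast
  have f: "\<And>r. integrable lborel (f r)"
    "\<And>r s t. s \<le> t \<Longrightarrow> p (of_rat r) t - p (of_rat r) s = (LINT x:{s..t}|lborel. f r x)"
    "\<And>r. AE x in lborel. (p (of_rat r) has_real_derivative f r x) (at x)"
    "\<And>r. AE x in lborel. \<bar>f r x\<bar> \<le> g x"
    using fQ unfolding Q_def by simp_all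
  have [measurable]: "f r \<in> borel_measurable borel" for r using f(1)[of r] by auto
  \<comment> \<open>Truncation at g keeps the supremum bounded at every point, as real-valued
    suprema require; it changes nothing almost everywhere, because there the absolute value of each
    \<open>f r\<close> is at most g.\<close>
  define m where "m x = (SUP r. min \<bar>f r x\<bar> (g x))" for x
  have bdd: "bdd_above (range (\<lambda>r. min \<bar>f r x\<bar> (g x)))" for x by (auto intro: bdd_aboveI[of _ "g x"])
  have m_ub: "min \<bar>f r x\<bar> (g x) \<le> m x" for r x
    unfolding m_def using bdd by (rule cSUP_upper[rotated]) simp
  have m0: "0 \<le> m x" for x using m_ub[of 0 x] g(2)[of x] by (smt (verit))
  have mg: "m x \<le> g x" for x unfolding m_def by (intro cSUP_least) auto
  have [measurable]: "m \<in> borel_measurable borel"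
    unfolding m_def using bdd by (intro borel_measurable_cSUP) auto
  have m: "integrable lborel m"
    by (rule Bochner_Integration.integrable_bound[OF g(1)]) (use m0 mg g(2) in \<open>auto intro!: AE_I2\<close>)
  have si: "set_integrable lborel {s..t} h" if "integrable lborel h" for s t and h :: "real \<Rightarrow> real"
    unfolding set_integrable_def using that by (intro integrable_mult_indicator) auto
  have f_le_m: "AE x in lborel. \<bar>f r x\<bar> \<le> m x" for r
    using f(4)[of r] by eventually_elim (use m_ub in \<open>metis min.absorb1\<close>)
  have p_rat: "p (of_rat r) t - p (of_rat r) s \<le> (LINT x:{s..t}|lborel. m x)" if "s \<le> t" for r s t
  proof -
    have "(LINT x:{s..t}|lborel. f r x) \<le> (LINT x:{s..t}|lborel. m x)"
      using f_le_m[of r] by (intro set_integral_mono_AE si f m) (auto elim!: eventually_mono)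
    then show ?thesis using f(2)[OF that] by simp
  qed
  obtain G where G: "\<And>s t. s \<le> t \<Longrightarrow> G t - G s = (LINT x:{s..t}|lborel. g x)" and contG: "continuous_on UNIV G"
    using primitive_exists[OF g(1)] by blast
  \<comment> \<open>A rational r just to the right of s replaces s; it may lie beyond t. The
    distance from s to r is paid twice, once in the triangle inequality and once in
    \<open>p_rat\<close>, hence the tolerance e / 2.\<close>
  have p_le_m: "p s t \<le> (LINT x:{s..t}|lborel. m x)" if "s \<le> t" for s t
  proof (rule field_le_epsilon)
    fix e :: real assume e: "e > 0"
    have "(G \<longlongrightarrow> G s) (at_right s)"
      using contG by (auto simp: continuous_on_def intro: tendsto_within_subset)
    then have "eventually (\<lambda>x. dist (G x) (G s) < e / 2) (at_right s)"
      using e by (intro tendstoD) auto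
    then obtain b where b: "b > s" "\<And>x. s < x \<Longrightarrow> x < b \<Longrightarrow> dist (G x) (G s) < e / 2"
      by (auto simp: eventually_at_right_field)
    obtain r where r: "s < of_rat r" "of_rat r < b" using of_rat_dense[OF b(1)] by blast
    have "p s (of_rat r) < e / 2"
      using ac[of s "of_rat r"] G[of s "of_rat r"] b(2)[of "of_rat r"] r by (simp add: dist_real_def)
    then show "p s t \<le> (LINT x:{s..t}|lborel. m x) + e"
      using p_rat[OF that, of r] triangle[of s t "of_rat r"] sym[of s "of_rat r"] by linarith
  qed
  obtain M where M: "\<And>s t. s \<le> t \<Longrightarrow> M t - M s = (LINT x:{s..t}|lborel. m x)"
    using primitive_exists[OF m] by blast
  have "AE x in lborel. (M has_real_derivative m x) (at x)"
    using m M by (rule AE_deriv_primitive)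
  moreover have "AE x in lborel. \<forall>r. (p (of_rat r) has_real_derivative f r x) (at x)"
    unfolding AE_all_countable using f(3) by blast
  moreover have "AE x in lborel. \<forall>r. \<bar>f r x\<bar> \<le> g x"
    unfolding AE_all_countable using f(4) by blast
  ultimately have "AE t in lborel. ((\<lambda>h. p (t + h) t / \<bar>h\<bar>) \<longlongrightarrow> m t) (at 0)"
  proof eventually_elim
    \<comment> \<open>The metric quotient lies between the quotients of the functions
      \<open>p (of_rat r)\<close>, from below, and that of the primitive M of m, from above; the
      supremum over r of the lower limits is m t.\<close>
    case (elim t)
    have up: "p (t + h) t / \<bar>h\<bar> \<le> (M (t + h) - M t) / h" for h
    proof (cases "h \<ge> 0")
      case True
      then have "p (t + h) t \<le> M (t + h) - M t" using p_le_m[of t "t+h"] M[of t "t+h"] sym[of t "t+h"] by simp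
      then show ?thesis using True by (simp add: divide_right_mono)
    next
      case False
      then have "p (t + h) t \<le> M t - M (t + h)" using p_le_m[of "t+h" t] M[of "t+h" t] by simp
      then have "p (t + h) t / (- h) \<le> (M t - M (t + h)) / (- h)" using False by (intro divide_right_mono) auto
      also have "(M t - M (t + h)) / (- h) = (M (t + h) - M t) / h"
        by (subst minus_divide_divide[symmetric]) simp
      finally show ?thesis using False by simp
    qed
    have lo: "\<bar>(p (of_rat r) (t + h) - p (of_rat r) t) / h\<bar> \<le> p (t + h) t / \<bar>h\<bar>" for r h
      using p_diff[of "of_rat r" "t + h" t] sym[of t "t+h"] by (simp add: abs_divide divide_right_mono)
    show ?case
    proof (rule order_tendstoI)
      fix a assume "m t < a"
      moreover have "((\<lambda>h. (M (t + h) - M t) / h) \<longlongrightarrow> m t) (at 0)" using elim(1) by (simp add: DERIV_def)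
      ultimately have "eventually (\<lambda>h. (M (t + h) - M t) / h < a) (at 0)" by (rule order_tendstoD(2)[rotated])
      then show "eventually (\<lambda>h. p (t + h) t / \<bar>h\<bar> < a) (at 0)"
      proof eventually_elim
        case (elim h)
        then show ?case using up[of h] by linarith
      qed
    next
      fix a assume "a < m t"
      then obtain r where "a < min \<bar>f r t\<bar> (g t)"
        unfolding m_def using less_cSUP_iff[OF _ bdd, of a t] by auto
      then have "a < \<bar>f r t\<bar>" by simp
      moreover have "((\<lambda>h. \<bar>(p (of_rat r) (t + h) - p (of_rat r) t) / h\<bar>) \<longlongrightarrow> \<bar>f r t\<bar>) (at 0)"
        using elim(2) unfolding DERIV_def by (intro tendsto_rabs) blast
      ultimately have "eventually (\<lambda>h. a < \<bar>(p (of_rat r) (t + h) - p (of_rat r) t) / h\<bar>) (at 0)"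
        by (rule order_tendstoD(1)[rotated])
      then show "eventually (\<lambda>h. a < p (t + h) t / \<bar>h\<bar>) (at 0)"
      proof eventually_elim
        case (elim h)
        then show ?case using lo[of r h] by linarith
      qed
    qed
  qed
  then show ?thesis using that m m0 p_le_m by blast
qed

text \<open>Where the limit does not exist, \<^const>\<open>Lim\<close> is a fixed junk value, so it is enough that the set
  of convergence is Borel; by continuity it is a countable intersection of \<open>F\<^sub>\<sigma>\<close> sets.\<close>

lemma Lim_at_0_borel_measurable:
  fixes D :: "real \<Rightarrow> real \<Rightarrow> real"
  assumes cont: "\<And>h. h \<noteq> 0 \<Longrightarrow> continuous_on UNIV (\<lambda>t. D t h)"
  shows "(\<lambda>t. Lim (at 0) (D t)) \<in> borel_measurable borel"
proof -
  \<comment> \<open>Cauchy criterion for h tending to 0: oscillation at most 1/(n+1) within radius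
    1/(k+1). As an intersection over all admissible h and h', \<open>S n k\<close> is closed, and
    \<open>G\<close> below is exactly the set of convergence.\<close>
  define S where "S = (\<lambda>n k. {t. \<forall>h h'. h \<noteq> 0 \<and> h' \<noteq> 0 \<and> \<bar>h\<bar> < 1 / real (Suc k) \<and> \<bar>h'\<bar> < 1 / real (Suc k) \<longrightarrow>
       \<bar>D t h - D t h'\<bar> \<le> 1 / real (Suc n)})"
  have clS: "closed (S n k)" for n k
  proof -
    let ?A = "{h. h \<noteq> 0 \<and> \<bar>h\<bar> < 1 / real (Suc k)}"
    have "S n k = (\<Inter>h\<in>?A. \<Inter>h'\<in>?A. {t. \<bar>D t h - D t h'\<bar> \<le> 1 / real (Suc n)})"
      by (auto simp: S_def)
    also have "closed \<dots>"
      by (intro closed_INT ballI closed_Collect_le continuous_intros cont) auto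
    finally show ?thesis .
  qed
  define G where "G = (\<Inter>n. \<Union>k. S n k)"
  have G_borel: "G \<in> sets borel" unfolding G_def using clS by (intro sets.countable_INT'' sets.countable_UN) auto
  have conv: "(D t \<longlongrightarrow> lim (\<lambda>i. D t (1 / real (Suc i)))) (at 0)" if "t \<in> G" for t
  proof -
    have C: "\<exists>k. \<forall>h h'. h \<noteq> 0 \<and> h' \<noteq> 0 \<and> \<bar>h\<bar> < 1 / real (Suc k) \<and> \<bar>h'\<bar> < 1 / real (Suc k) \<longrightarrow>
       \<bar>D t h - D t h'\<bar> < e" if e: "e > 0" for e
    proof -
      obtain n where n: "1 / real (Suc n) < e" using nat_approx_posE[OF e] by blast
      obtain k where "t \<in> S n k" using \<open>t \<in> G\<close> unfolding G_def by blast
      then show ?thesis unfolding S_def using n by (intro exI[of _ k]) force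
    qed
    have "Cauchy (\<lambda>i. D t (1 / real (Suc i)))"
    proof (rule metric_CauchyI)
      fix e :: real assume "e > 0"
      then obtain k where k: "\<And>h h'. h \<noteq> 0 \<Longrightarrow> h' \<noteq> 0 \<Longrightarrow> \<bar>h\<bar> < 1 / real (Suc k) \<Longrightarrow> \<bar>h'\<bar> < 1 / real (Suc k) \<Longrightarrow>
       \<bar>D t h - D t h'\<bar> < e" using C by metis
      have "\<bar>1 / real (Suc i)\<bar> < 1 / real (Suc k)" if "i > k" for i
        using that by (auto simp: field_simps)
      then have "dist (D t (1 / real (Suc i))) (D t (1 / real (Suc j))) < e" if "i > k" "j > k" for i j
        unfolding dist_real_def using that by (intro k) auto
      then show "\<exists>M. \<forall>i\<ge>M. \<forall>j\<ge>M. dist (D t (1 / real (Suc i))) (D t (1 / real (Suc j))) < e"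
        by (intro exI[of _ "Suc k"]) auto
    qed
    then have L: "(\<lambda>i. D t (1 / real (Suc i))) \<longlonglongrightarrow> lim (\<lambda>i. D t (1 / real (Suc i)))" (is "_ \<longlonglongrightarrow> ?l")
      using Cauchy_convergent_iff convergent_LIMSEQ_iff by blast
    show ?thesis
    proof (rule tendstoI)
      fix e :: real assume e: "e > 0"
      then obtain k where k: "\<And>h h'. h \<noteq> 0 \<Longrightarrow> h' \<noteq> 0 \<Longrightarrow> \<bar>h\<bar> < 1 / real (Suc k) \<Longrightarrow> \<bar>h'\<bar> < 1 / real (Suc k) \<Longrightarrow>
       \<bar>D t h - D t h'\<bar> < e / 2" using C[of "e / 2"] by auto
      have "eventually (\<lambda>i. dist (D t (1 / real (Suc i))) ?l < e / 2) sequentially"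
        using L e by (intro tendstoD) auto
      moreover have "eventually (\<lambda>i. i > k) sequentially" by (rule eventually_gt_at_top)
      ultimately have "eventually (\<lambda>i. dist (D t (1 / real (Suc i))) ?l < e / 2 \<and> i > k) sequentially"
        by (rule eventually_conj)
      then obtain i where i: "dist (D t (1 / real (Suc i))) ?l < e / 2" "i > k"
        by (auto simp: eventually_sequentially)
      have ik: "\<bar>1 / real (Suc i)\<bar> < 1 / real (Suc k)" using i(2) by (auto simp: field_simps)
      have "dist (D t h) ?l < e" if h: "h \<noteq> 0" "\<bar>h\<bar> < 1 / real (Suc k)" for h
      proof -
        have "\<bar>D t h - D t (1 / real (Suc i))\<bar> < e / 2" using h ik by (intro k) auto
        then show ?thesis using i(1) unfolding dist_real_def by linarith
      qed
      then show "eventually (\<lambda>h. dist (D t h) ?l < e) (at 0)"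
        unfolding eventually_at by (intro exI[of _ "1 / real (Suc k)"]) (auto simp: dist_real_def)
    qed
  qed
  have nconv: "\<nexists>l. (D t \<longlongrightarrow> l) (at 0)" if "t \<notin> G" for t
  proof
    assume "\<exists>l. (D t \<longlongrightarrow> l) (at 0)"
    then obtain l where l: "(D t \<longlongrightarrow> l) (at 0)" by blast
    have "\<exists>k. t \<in> S n k" for n
    proof -
      define e where "e = 1 / real (Suc n)"
      have "eventually (\<lambda>h. dist (D t h) l < e / 2) (at 0)"
        by (rule tendstoD[OF l]) (simp add: e_def)
      then obtain d where d: "d > 0" "\<And>h. h \<noteq> 0 \<Longrightarrow> \<bar>h\<bar> < d \<Longrightarrow> \<bar>D t h - l\<bar> < e / 2"
        by (auto simp: eventually_at dist_real_def)
      obtain k where k: "1 / real (Suc k) < d" using nat_approx_posE[OF d(1)] by blast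
      have "\<bar>D t h - D t h'\<bar> \<le> e"
        if "h \<noteq> 0 \<and> h' \<noteq> 0 \<and> \<bar>h\<bar> < 1 / real (Suc k) \<and> \<bar>h'\<bar> < 1 / real (Suc k)" for h h'
      proof -
        have "\<bar>h\<bar> < d" "\<bar>h'\<bar> < d" using that k by linarith+
        then have "\<bar>D t h - l\<bar> < e / 2" "\<bar>D t h' - l\<bar> < e / 2" using that d(2) by blast+
        then show ?thesis by linarith
      qed
      then show ?thesis unfolding S_def e_def by blast
    qed
    then show False using that unfolding G_def by blast
  qed
  \<comment> \<open>On G the limit may be taken along h = 1/(i+1), which is a limit of a sequence of
    measurable functions; off G the definite description in \<open>Lim\<close> has an empty
    predicate and so gives one constant.\<close>
  have eq: "(\<lambda>t. Lim (at 0) (D t)) = (\<lambda>t. if t \<in> G then lim (\<lambda>i. D t (1 / real (Suc i))) else (THE l. False))"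
  proof
    fix t
    show "Lim (at 0) (D t) = (if t \<in> G then lim (\<lambda>i. D t (1 / real (Suc i))) else (THE l. False))"
    proof (cases "t \<in> G")
      case True
      then show ?thesis using tendsto_Lim[OF _ conv[OF True]] by simp
    next
      case False
      then have "(\<lambda>l. (D t \<longlongrightarrow> l) (at 0)) = (\<lambda>l. False)" using nconv by blast
      then show ?thesis using False by (simp add: t2_space_class.Lim_def)
    qed
  qed
  have DI: "(\<lambda>t. D t (1 / real (Suc i))) \<in> borel_measurable borel" for i
    by (intro borel_measurable_continuous_onI cont) simp
  show ?thesis
    unfolding eq using G_borel DI by (intro measurable_If_set borel_measurable_lim_metric) auto
qed

section \<open>Curves on intervals and on the half-line\<close>

text \<open>Freezing a curve outside [u, v] extends it to the whole line, where the preceding lemmas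
  apply. Only an integral bound is asked of \<open>p\<close>, so it can stand for the distance along
  a curve as well as for the increment of a real function.\<close>

lemma clamped_curve_bound:
  fixes g :: "real \<Rightarrow> real" and p :: "real \<Rightarrow> real \<Rightarrow> real"
  assumes g: "set_integrable lborel {u..v} g" and uv: "u \<le> v"
    and p: "\<And>a b. u \<le> a \<Longrightarrow> a \<le> b \<Longrightarrow> b \<le> v \<Longrightarrow> p a b \<le> (LINT x:{a..b}|lborel. g x)"
  shows "integrable lborel (\<lambda>x. indicator {u..v} x * \<bar>g x\<bar>)"
    "a \<le> b \<Longrightarrow> p (max u (min v a)) (max u (min v b)) \<le> (LINT x:{a..b}|lborel. indicator {u..v} x * \<bar>g x\<bar>)"
proof -
  let ?h = "\<lambda>x. indicator {u..v} x * \<bar>g x\<bar>"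
  show h: "integrable lborel ?h"
    using set_integrable_abs[OF g] by (simp add: set_integrable_def)
  have h_set: "set_integrable lborel {a..b} ?h" for a b
    unfolding set_integrable_def using h by (intro integrable_mult_indicator) auto
  have h_nonneg: "0 \<le> (LINT x:{a..b}|lborel. ?h x)" for a b
    unfolding set_lebesgue_integral_def by (intro Bochner_Integration.integral_nonneg) auto
  have inner: "p a b \<le> (LINT x:{a..b}|lborel. ?h x)" if ab: "u \<le> a" "a \<le> b" "b \<le> v" for a b
  proof -
    have "p a b \<le> (LINT x:{a..b}|lborel. g x)" using p ab by simp
    also have "\<dots> \<le> (LINT x:{a..b}|lborel. ?h x)"
    proof (rule set_integral_mono)
      show "set_integrable lborel {a..b} g" by (rule set_integrable_subset[OF g]) (use ab in auto)
      show "g x \<le> ?h x" if "x \<in> {a..b}" for x using that ab by auto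
    qed (rule h_set)
    finally show ?thesis .
  qed
  show "p (max u (min v a)) (max u (min v b)) \<le> (LINT x:{a..b}|lborel. ?h x)" if "a \<le> b"
  proof (cases "a \<le> v \<and> u \<le> b")
    case True
    define a' b' where "a' = max u (min v a)" "b' = max u (min v b)"
    have ab': "u \<le> a'" "a' \<le> b'" "b' \<le> v" "a \<le> a'" "b' \<le> b" using True that uv by (auto simp: a'_b'_def)
    have "p a' b' \<le> (LINT x:{a'..b'}|lborel. ?h x)" using ab' by (intro inner)
    also have "\<dots> \<le> (LINT x:{a..b}|lborel. ?h x)"
      unfolding set_lebesgue_integral_def
      using h_set[of a b] h_set[of a' b'] ab'
      by (intro integral_mono) (auto simp: set_integrable_def split: split_indicator)
    finally show ?thesis by (simp add: a'_b'_def)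
  next
    case False
    \<comment> \<open>If [a, b] misses [u, v], both times are frozen at the same endpoint, and
      \<open>p c c\<close> is bounded by an integral over a single point.\<close>
    then have "max u (min v a) = max u (min v b)" using that uv by auto
    moreover have "p c c \<le> 0" if "u \<le> c" "c \<le> v" for c
    proof -
      have "p c c \<le> (LINT x:{c..c}|lborel. g x)" using that by (intro p) auto
      also have "\<dots> = integral {c..c} g"
        by (intro set_borel_integral_eq_integral set_integrable_subset[OF g]) (use that in auto)
      finally show ?thesis by simp
    qed
    ultimately have "p (max u (min v a)) (max u (min v b)) \<le> 0" using uv by auto
    then show ?thesis using h_nonneg[of a b] by linarith
  qed
qed

text \<open>Monotonicity confines E on [s, t] to the compact interval [E t, E s] inside the positive
  half-line, on which \<psi> is Lipschitz with some constant L. Hence \<psi> composed with E is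
  absolutely continuous with majorant L * g, even if \<psi> is singular at 0.\<close>

lemma comparison_along_decreasing:
  fixes E e' g w \<psi> \<psi>' :: "real \<Rightarrow> real"
  assumes st: "s \<le> t" and pos: "0 < E t"
    and mono: "\<And>a b. s \<le> a \<Longrightarrow> a \<le> b \<Longrightarrow> b \<le> t \<Longrightarrow> E b \<le> E a"
    and g: "set_integrable lborel {s..t} g"
    and ac: "\<And>a b. s \<le> a \<Longrightarrow> a \<le> b \<Longrightarrow> b \<le> t \<Longrightarrow> \<bar>E b - E a\<bar> \<le> (LINT x:{a..b}|lborel. g x)"
    and deriv: "AE x in lborel. s < x \<longrightarrow> x < t \<longrightarrow> (E has_real_derivative e' x) (at x)"
    and \<psi>: "\<And>y. 0 < y \<Longrightarrow> (\<psi> has_real_derivative \<psi>' y) (at y)" "continuous_on {0<..} \<psi>'"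
    and w: "set_integrable lborel {s..t} w"
    and le: "AE x in lborel. s < x \<longrightarrow> x < t \<longrightarrow> \<psi>' (E x) * e' x \<le> w x"
  shows "\<psi> (E t) - \<psi> (E s) \<le> (LINT x:{s..t}|lborel. w x)"
proof -
  have "compact (\<psi>' ` {E t..E s})"
    by (intro compact_continuous_image continuous_on_subset[OF \<psi>(2)]) (use pos in auto)
  then obtain L where L: "0 < L" "\<And>y. y \<in> {E t..E s} \<Longrightarrow> \<bar>\<psi>' y\<bar> \<le> L"
    using compact_imp_bounded[of "\<psi>' ` {E t..E s}"] by (auto simp: bounded_pos)
  have lip: "\<bar>\<psi> y - \<psi> z\<bar> \<le> L * \<bar>y - z\<bar>" if "y \<in> {E t..E s}" "z \<in> {E t..E s}" for y z
  proof -
    have "norm (\<psi> y - \<psi> z) \<le> L * norm (y - z)"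
    proof (rule field_differentiable_bound[of "{E t..E s}"])
      show "(\<psi> has_field_derivative \<psi>' x) (at x within {E t..E s})" if "x \<in> {E t..E s}" for x
        using \<psi>(1)[of x] that pos by (auto intro: has_field_derivative_at_within)
    qed (use L that in auto)
    then show ?thesis by simp
  qed
  have E_in: "E a \<in> {E t..E s}" if "s \<le> a" "a \<le> t" for a using mono that by simp
  define \<phi> where "\<phi> x = \<psi> (E (max s (min t x)))" for x
  let ?h = "\<lambda>x. indicator {s..t} x * \<bar>L * g x\<bar>"
  have Lg: "set_integrable lborel {s..t} (\<lambda>x. L * g x)" using g by (intro set_integrable_mult_right) auto
  have p: "\<bar>\<psi> (E b) - \<psi> (E a)\<bar> \<le> (LINT x:{a..b}|lborel. L * g x)" if "s \<le> a" "a \<le> b" "b \<le> t" for a b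
  proof -
    have "\<bar>\<psi> (E b) - \<psi> (E a)\<bar> \<le> L * \<bar>E b - E a\<bar>" using that by (intro lip E_in) auto
    also have "\<dots> \<le> L * (LINT x:{a..b}|lborel. g x)" using ac that L by (intro mult_left_mono) auto
    finally show ?thesis by simp
  qed
  have "\<phi> t - \<phi> s \<le> (LINT x:{s..t}|lborel. w x)"
  proof (rule abs_cont_le_integral[of ?h \<phi>])
    show "integrable lborel ?h" by (rule clamped_curve_bound(1)[OF Lg st p])
    show "\<bar>\<phi> b - \<phi> a\<bar> \<le> (LINT x:{a..b}|lborel. ?h x)" if "a \<le> b" for a b
      unfolding \<phi>_def
      using p that by (intro clamped_curve_bound(2)[OF Lg st, of "\<lambda>a b. \<bar>\<psi> (E b) - \<psi> (E a)\<bar>"])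
    show "AE x in lborel. s < x \<longrightarrow> x < t \<longrightarrow> (\<exists>D. (\<phi> has_real_derivative D) (at x) \<and> D \<le> w x)"
      using deriv le
    proof (eventually_elim, intro impI)
      fix x assume A: "s < x \<longrightarrow> x < t \<longrightarrow> (E has_real_derivative e' x) (at x)"
        "s < x \<longrightarrow> x < t \<longrightarrow> \<psi>' (E x) * e' x \<le> w x" and x: "s < x" "x < t"
      have "0 < E x" using mono[of x t] pos x by simp
      then have "((\<lambda>x. \<psi> (E x)) has_real_derivative \<psi>' (E x) * e' x) (at x)"
        using A(1) x by (intro DERIV_chain2[of \<psi>] \<psi>(1)) auto
      then have "(\<phi> has_real_derivative \<psi>' (E x) * e' x) (at x)"
        by (rule has_field_derivative_transform_within_open[where S = "{s<..<t}"]) (use x in \<open>auto simp: \<phi>_def\<close>)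
      then show "\<exists>D. (\<phi> has_real_derivative D) (at x) \<and> D \<le> w x" using A(2) x by blast
    qed
  qed (use w st in auto)
  then show ?thesis using st by (simp add: \<phi>_def)
qed

text \<open>\<open>metric_derivative_exists\<close> is applied to the curve frozen outside [0, T];
  the function it yields agrees with \<open>metric_deriv d c\<close> almost everywhere on (0, T),
  and T is arbitrary. Since \<open>lborel\<close> is not complete, agreement almost everywhere does
  not give measurability, which is proved for \<open>metric_deriv d c\<close> itself.\<close>

lemma half_line_metric_derivative:
  fixes d :: "'b \<Rightarrow> 'b \<Rightarrow> real" and c :: "real \<Rightarrow> 'b"
  assumes nonneg: "\<And>s t. 0 \<le> s \<Longrightarrow> 0 \<le> t \<Longrightarrow> 0 \<le> d (c s) (c t)"
    and sym: "\<And>s t. 0 \<le> s \<Longrightarrow> 0 \<le> t \<Longrightarrow> d (c s) (c t) = d (c t) (c s)"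
    and triangle: "\<And>r s t. 0 \<le> r \<Longrightarrow> 0 \<le> s \<Longrightarrow> 0 \<le> t \<Longrightarrow> d (c r) (c t) \<le> d (c r) (c s) + d (c s) (c t)"
    and ac: "abs_cont_curve d c"
  shows "set_borel_measurable lborel {0..} (metric_deriv d c)"
    and "0 \<le> s \<Longrightarrow> set_integrable lborel {s..t} (metric_deriv d c)"
    and "0 \<le> s \<Longrightarrow> s \<le> t \<Longrightarrow> d (c s) (c t) \<le> (LINT x:{s..t}|lborel. metric_deriv d c x)"
    and "AE t in lborel. 0 < t \<longrightarrow> 0 \<le> metric_deriv d c t"
proof -
  obtain g where g: "\<And>T. 0 \<le> T \<Longrightarrow> set_integrable lborel {0..T} g"
    "\<And>s t. 0 \<le> s \<Longrightarrow> s \<le> t \<Longrightarrow> d (c s) (c t) \<le> (LINT \<tau>:{s..t}|lborel. g \<tau>)"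
    using ac unfolding abs_cont_curve_def by blast
  \<comment> \<open>The curve is held at c 0 for negative times, so that quotients are under control
    for every t and h on the line.\<close>
  define q where "q s t = d (c (max 0 s)) (c (max 0 t))" for s t
  have q_nonneg: "0 \<le> q s t" and q_sym: "q s t = q t s" and q_tri: "q r t \<le> q r s + q s t" for r s t
    unfolding q_def by (auto intro!: nonneg sym triangle)
  have q_diff: "\<bar>q a b - q a' b'\<bar> \<le> q a a' + q b b'" for a b a' b'
    using q_tri[of a b a'] q_tri[of a' b b'] q_tri[of a' b' a] q_tri[of a b' b] q_sym[of a' a] q_sym[of b b'] by linarith
  \<comment> \<open>m is the local metric derivative on (0, T). G is a continuous function whose
    increments dominate distances; it yields the continuity of t \<mapsto> q (t + h) t that the
    measurability of the limit rests on.\<close>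
  define Q where "Q T m G \<longleftrightarrow> integrable lborel m \<and> (\<forall>x. 0 \<le> m x) \<and>
     (\<forall>s t. 0 \<le> s \<longrightarrow> s \<le> t \<longrightarrow> t \<le> T \<longrightarrow> d (c s) (c t) \<le> (LINT x:{s..t}|lborel. m x)) \<and>
     (AE t in lborel. 0 < t \<longrightarrow> t < T \<longrightarrow> ((\<lambda>h. q (t + h) t / \<bar>h\<bar>) \<longlongrightarrow> m t) (at 0)) \<and>
     continuous_on UNIV G \<and> (\<forall>a b. a \<le> b \<longrightarrow> b \<le> T \<longrightarrow> q a b \<le> G b - G a)" for T and m G :: "real \<Rightarrow> real"
  have local_ex: "\<exists>m G. Q T m G" if T: "0 < T" for T
  proof -
    define p where "p a b = d (c (max 0 (min T a))) (c (max 0 (min T b)))" for a b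
    let ?h = "\<lambda>x. indicator {0..T} x * \<bar>g x\<bar>"
    have T0: "0 \<le> T" using T by simp
    have b: "d (c a) (c b) \<le> (LINT \<tau>:{a..b}|lborel. g \<tau>)" if "0 \<le> a" "a \<le> b" "b \<le> T" for a b
      using g(2) that by simp
    have h: "integrable lborel ?h"
      by (rule clamped_curve_bound(1)[OF g(1)[OF T0] T0 b])
    have ph: "p a b \<le> (LINT x:{a..b}|lborel. ?h x)" if "a \<le> b" for a b
      unfolding p_def using b that by (intro clamped_curve_bound(2)[OF g(1)[OF T0] T0, of "\<lambda>a b. d (c a) (c b)"])
    obtain m where m: "integrable lborel m" "\<And>x. 0 \<le> m x"
      "\<And>s t. s \<le> t \<Longrightarrow> p s t \<le> (LINT x:{s..t}|lborel. m x)"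
      "AE t in lborel. ((\<lambda>h. p (t + h) t / \<bar>h\<bar>) \<longlongrightarrow> m t) (at 0)"
    proof (rule metric_derivative_exists[of ?h p])
      show "p s t = p t s" "0 \<le> p s t" "p r t \<le> p r s + p s t" for r s t
        unfolding p_def by (auto intro!: nonneg sym triangle)
    qed (use h ph in auto)
    obtain G where G: "\<And>s t. s \<le> t \<Longrightarrow> G t - G s = (LINT x:{s..t}|lborel. ?h x)" "continuous_on UNIV G"
      using primitive_exists[OF h] by blast
    have pq: "p a b = q a b" if "a \<le> T" "b \<le> T" for a b
      using that by (simp add: p_def q_def min_absorb2)
    have "AE t in lborel. 0 < t \<longrightarrow> t < T \<longrightarrow> ((\<lambda>h. q (t + h) t / \<bar>h\<bar>) \<longlongrightarrow> m t) (at 0)"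
      using m(4)
    proof (eventually_elim, intro impI)
      fix t assume A: "((\<lambda>h. p (t + h) t / \<bar>h\<bar>) \<longlongrightarrow> m t) (at 0)" and t: "0 < t" "t < T"
      have "eventually (\<lambda>h. p (t + h) t / \<bar>h\<bar> = q (t + h) t / \<bar>h\<bar>) (at 0)"
        unfolding eventually_at using t by (intro exI[of _ "T - t"]) (auto simp: dist_real_def pq)
      with A show "((\<lambda>h. q (t + h) t / \<bar>h\<bar>) \<longlongrightarrow> m t) (at 0)"
        by (rule Lim_transform_eventually)
    qed
    moreover have "d (c s) (c t) \<le> (LINT x:{s..t}|lborel. m x)" if "0 \<le> s" "s \<le> t" "t \<le> T" for s t
      using m(3)[OF that(2)] that pq[of s t] by (simp add: q_def)
    moreover have "q a b \<le> G b - G a" if "a \<le> b" "b \<le> T" for a b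
      using ph[OF that(1)] G(1)[OF that(1)] pq[of a b] that by simp
    ultimately show ?thesis
      unfolding Q_def using m(1,2) G(2) by (intro exI[of _ m] exI[of _ G]) simp
  qed
  define D where "D t h = q (t + h) t / \<bar>h\<bar>" for t h
  have contq: "continuous_on UNIV (\<lambda>t. q (t + h) t)" for h
    unfolding continuous_on_eq_continuous_at[OF open_UNIV]
  proof
    fix t0 :: real
    define T where "T = \<bar>t0\<bar> + \<bar>h\<bar> + 1"
    have "0 < T" by (simp add: T_def)
    then obtain m G where Q: "Q T m G" using local_ex by blast
    have contG: "isCont G x" for x
      using Q unfolding Q_def by (auto simp: continuous_on_eq_continuous_at)
    have qG: "q a b \<le> \<bar>G b - G a\<bar>" if "a \<le> T" "b \<le> T" for a b
    proof (cases "a \<le> b")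
      case True
      then have "q a b \<le> G b - G a" using Q that unfolding Q_def by simp
      then show ?thesis by linarith
    next
      case False
      then have "q b a \<le> G a - G b" using Q that unfolding Q_def by simp
      then show ?thesis using q_sym[of a b] by linarith
    qed
    have "isCont (\<lambda>t. G (t + h)) t0" by (intro continuous_at_compose[of _ "\<lambda>t. t + h" G, unfolded comp_def] continuous_intros contG)
    then have l: "((\<lambda>t. \<bar>G (t0 + h) - G (t + h)\<bar> + \<bar>G t0 - G t\<bar>) \<longlongrightarrow> \<bar>G (t0 + h) - G (t0 + h)\<bar> + \<bar>G t0 - G t0\<bar>) (at t0)"
      using contG[of t0] unfolding isCont_def by (intro tendsto_intros)
    have "eventually (\<lambda>t. norm (q (t + h) t - q (t0 + h) t0) \<le> \<bar>G (t0 + h) - G (t + h)\<bar> + \<bar>G t0 - G t\<bar>) (at t0)"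
      unfolding eventually_at
    proof (intro exI[of _ 1] conjI ballI impI)
      fix t assume "t \<noteq> t0 \<and> dist t t0 < 1"
      then have "t \<le> T" "t + h \<le> T" "t0 \<le> T" "t0 + h \<le> T" by (auto simp: T_def dist_real_def)
      then have "q (t + h) (t0 + h) \<le> \<bar>G (t0 + h) - G (t + h)\<bar>" "q t t0 \<le> \<bar>G t0 - G t\<bar>" by (auto intro!: qG)
      then show "norm (q (t + h) t - q (t0 + h) t0) \<le> \<bar>G (t0 + h) - G (t + h)\<bar> + \<bar>G t0 - G t\<bar>"
        using q_diff[of "t + h" t "t0 + h" t0] by simp
    qed simp
    then have "((\<lambda>t. q (t + h) t - q (t0 + h) t0) \<longlongrightarrow> 0) (at t0)"
      by (rule Lim_null_comparison) (use l in simp)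
    then show "isCont (\<lambda>t. q (t + h) t) t0" unfolding isCont_def by (simp add: Lim_null[symmetric])
  qed
  have L_meas: "(\<lambda>t. Lim (at 0) (D t)) \<in> borel_measurable borel"
  proof (rule Lim_at_0_borel_measurable)
    show "continuous_on UNIV (\<lambda>t. D t h)" if "h \<noteq> 0" for h
      unfolding D_def using that by (intro continuous_intros contq) auto
  qed
  have md_eq: "metric_deriv d c t = Lim (at 0) (D t)" if t: "0 < t" for t
  proof -
    have "eventually (\<lambda>h. d (c (t + h)) (c t) / \<bar>h\<bar> = D t h) (at 0)"
      unfolding eventually_at using t by (intro exI[of _ t]) (auto simp: dist_real_def D_def q_def max_def)
    then have "((\<lambda>h. d (c (t + h)) (c t) / \<bar>h\<bar>) \<longlongrightarrow> l) (at 0) \<longleftrightarrow> (D t \<longlongrightarrow> l) (at 0)" for l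
      by (rule tendsto_cong)
    then show ?thesis by (simp add: metric_deriv_def t2_space_class.Lim_def)
  qed
  define md where "md t = (if 0 < t then Lim (at 0) (D t) else if t = 0 then metric_deriv d c 0 else 0)" for t
  have [measurable]: "md \<in> borel_measurable borel"
    unfolding md_def using L_meas by measurable
  have md: "metric_deriv d c t = md t" if "0 \<le> t" for t using that md_eq by (auto simp: md_def)
  have meas: "set_borel_measurable lborel A (metric_deriv d c)" if "A \<subseteq> {0..}" "A \<in> sets borel" for A
  proof -
    have "(\<lambda>x. indicator A x *\<^sub>R metric_deriv d c x) = (\<lambda>x. indicator A x *\<^sub>R md x)"
      using that md by (auto split: split_indicator simp: fun_eq_iff)
    moreover have "(\<lambda>x. indicator A x *\<^sub>R md x) \<in> borel_measurable borel" using that(2) by measurable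
    ultimately show ?thesis by (simp add: set_borel_measurable_def)
  qed
  show "set_borel_measurable lborel {0..} (metric_deriv d c)" by (rule meas) auto
  have ae: "AE t in lborel. 0 < t \<longrightarrow> t < T \<longrightarrow> metric_deriv d c t = m t" if "Q T m G" for T m G
    using that unfolding Q_def
  proof (elim conjE)
    assume "AE t in lborel. 0 < t \<longrightarrow> t < T \<longrightarrow> ((\<lambda>h. q (t + h) t / \<bar>h\<bar>) \<longlongrightarrow> m t) (at 0)"
    then show ?thesis
    proof (eventually_elim, intro impI)
      fix t assume A: "0 < t \<longrightarrow> t < T \<longrightarrow> ((\<lambda>h. q (t + h) t / \<bar>h\<bar>) \<longlongrightarrow> m t) (at 0)" "0 < t" "t < T"
      then have "(D t \<longlongrightarrow> m t) (at 0)" unfolding D_def by simp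
      then show "metric_deriv d c t = m t" using md_eq[OF A(2)] tendsto_Lim[of "at 0" "D t" "m t"] by simp
    qed
  qed
  have ae_set: "AE x in lborel. indicator {s..t} x *\<^sub>R metric_deriv d c x = indicator {s..t} x *\<^sub>R m x"
    if "0 \<le> s" "t < T" "Q T m G" for s t T m G
  proof -
    have "AE x in lborel. x \<noteq> (0::real)" by (rule AE_lborel_singleton)
    with ae[OF that(3)] show ?thesis
    proof eventually_elim
      case (elim x)
      then show ?case using that(1,2) by (cases "x \<in> {s..t}") auto
    qed
  qed
  show integrable: "set_integrable lborel {s..t} (metric_deriv d c)" if "0 \<le> s" for s t
  proof -
    \<comment> \<open>The horizon lies strictly beyond t because Q identifies the metric derivative
      only at times below it.\<close>
    obtain m G where Q: "Q (\<bar>t\<bar> + 1) m G" using local_ex[of "\<bar>t\<bar> + 1"] by fastforce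
    have "set_integrable lborel {s..t} m"
      unfolding set_integrable_def using Q by (intro integrable_mult_indicator) (auto simp: Q_def)
    moreover have "AE x in lborel. indicator {s..t} x *\<^sub>R metric_deriv d c x = indicator {s..t} x *\<^sub>R m x"
      using that by (intro ae_set[OF _ _ Q]) auto
    moreover have "set_borel_measurable lborel {s..t} (metric_deriv d c)" using that by (intro meas) auto
    ultimately show ?thesis
      unfolding set_integrable_def set_borel_measurable_def
      by (subst integrable_cong_AE) (auto dest: borel_measurable_integrable)
  qed
  show "d (c s) (c t) \<le> (LINT x:{s..t}|lborel. metric_deriv d c x)" if st: "0 \<le> s" "s \<le> t" for s t
  proof -
    obtain m G where Q: "Q (t + 1) m G" using local_ex[of "t + 1"] st by fastforce
    have "d (c s) (c t) \<le> (LINT x:{s..t}|lborel. m x)" using Q st unfolding Q_def by simp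
    also have "\<dots> = (LINT x:{s..t}|lborel. metric_deriv d c x)"
    proof -
      have "AE x in lborel. indicator {s..t} x *\<^sub>R metric_deriv d c x = indicator {s..t} x *\<^sub>R m x"
        using st by (intro ae_set[OF _ _ Q]) auto
      moreover have "set_integrable lborel {s..t} m"
        unfolding set_integrable_def using Q by (intro integrable_mult_indicator) (auto simp: Q_def)
      ultimately show ?thesis
        unfolding set_lebesgue_integral_def using integrable[OF st(1), of t]
        by (intro integral_cong_AE) (auto simp: set_integrable_def elim!: eventually_mono)
    qed
    finally show ?thesis .
  qed
  show "AE t in lborel. 0 < t \<longrightarrow> 0 \<le> metric_deriv d c t"
  proof -
    have "AE t in lborel. 0 < t \<longrightarrow> t < real (Suc n) \<longrightarrow> 0 \<le> metric_deriv d c t" for n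
    proof -
      obtain m G where Q: "Q (real (Suc n)) m G" using local_ex[of "real (Suc n)"] by fastforce
      have m: "0 \<le> m x" for x using Q unfolding Q_def by simp
      from ae[OF Q] show ?thesis by eventually_elim (use m in simp)
    qed
    then have "AE t in lborel. \<forall>n. 0 < t \<longrightarrow> t < real (Suc n) \<longrightarrow> 0 \<le> metric_deriv d c t"
      unfolding AE_all_countable by blast
    then show ?thesis
    proof (eventually_elim, intro impI)
      fix t :: real assume A: "\<forall>n. 0 < t \<longrightarrow> t < real (Suc n) \<longrightarrow> 0 \<le> metric_deriv d c t" "0 < t"
      obtain n where "t < real n" using reals_Archimedean2 by blast
      then have "t < real (Suc n)" by simp
      then show "0 \<le> metric_deriv d c t" using A by blast
    qed
  qed
qed

section \<open>The Wasserstein distance is a complete metric\<close>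

lemma measurable_fst_borel [measurable]:
  "fst \<in> borel_measurable (borel :: ('a::second_countable_topology \<times> 'b::second_countable_topology) measure)"
  unfolding borel_prod[symmetric] by (rule measurable_fst)

lemma measurable_snd_borel [measurable]:
  "snd \<in> borel_measurable (borel :: ('a::second_countable_topology \<times> 'b::second_countable_topology) measure)"
  unfolding borel_prod[symmetric] by (rule measurable_snd)

lemma P2_D:
  assumes "\<mu> \<in> P2"
  shows "sets \<mu> = sets borel" "prob_space \<mu>" "integrable \<mu> (\<lambda>x. (norm x)\<^sup>2)"
  using assms by (auto simp: P2_def)

lemma couplings_D:
  assumes "\<gamma> \<in> couplings \<mu> \<nu>"
  shows "sets \<gamma> = sets borel" "prob_space \<gamma>" "distr \<gamma> borel fst = \<mu>" "distr \<gamma> borel snd = \<nu>"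
  using assms by (auto simp: couplings_def)

lemma nn_integral_fst_coupling:
  fixes f :: "'a::euclidean_space \<Rightarrow> ennreal"
  assumes "\<gamma> \<in> couplings \<mu> \<nu>" and [measurable]: "f \<in> borel_measurable borel"
  shows "(\<integral>\<^sup>+z. f (fst z) \<partial>\<gamma>) = (\<integral>\<^sup>+x. f x \<partial>\<mu>)"
proof -
  note D = couplings_D[OF assms(1)]
  note [measurable_cong] = D(1)
  have "fst \<in> \<gamma> \<rightarrow>\<^sub>M borel" unfolding measurable_cong_sets[OF D(1) refl] by measurable
  then show ?thesis unfolding D(3)[symmetric] by (simp add: nn_integral_distr)
qed

lemma nn_integral_snd_coupling:
  fixes f :: "'a::euclidean_space \<Rightarrow> ennreal"
  assumes "\<gamma> \<in> couplings \<mu> \<nu>" and [measurable]: "f \<in> borel_measurable borel"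
  shows "(\<integral>\<^sup>+z. f (snd z) \<partial>\<gamma>) = (\<integral>\<^sup>+x. f x \<partial>\<nu>)"
proof -
  note D = couplings_D[OF assms(1)]
  have "snd \<in> \<gamma> \<rightarrow>\<^sub>M borel" unfolding measurable_cong_sets[OF D(1) refl] by measurable
  then show ?thesis unfolding D(4)[symmetric] by (simp add: nn_integral_distr)
qed

text \<open>An extended-real version of \<open>transport_cost\<close>: Tonelli and monotonicity then
  apply without integrability conditions.\<close>

abbreviation sqcost :: "('a::euclidean_space \<times> 'a) measure \<Rightarrow> ennreal" where
  "sqcost \<gamma> \<equiv> (\<integral>\<^sup>+z. ennreal ((norm (fst z - snd z))\<^sup>2) \<partial>\<gamma>)"

text \<open>Covers infinite cost too: the Bochner integral and \<open>enn2real\<close> both default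
  to 0 there.\<close>

lemma transport_cost_enn2real:
  assumes "sets \<gamma> = sets borel"
  shows "transport_cost \<gamma> = enn2real (sqcost \<gamma>)"
proof -
  have "(\<lambda>z::'a \<times> 'a. (norm (fst z - snd z))\<^sup>2) \<in> borel_measurable borel" by measurable
  then have "(\<lambda>z::'a \<times> 'a. (norm (fst z - snd z))\<^sup>2) \<in> borel_measurable \<gamma>"
    unfolding measurable_cong_sets[OF assms refl] .
  then show ?thesis
    unfolding transport_cost_def split_beta by (subst integral_eq_nn_integral) auto
qed

lemma sq_norm_diff_le: "(norm (x - y))\<^sup>2 \<le> 2 * (norm x)\<^sup>2 + 2 * (norm (y::'a::real_inner))\<^sup>2"
proof -
  have "(norm (x - y))\<^sup>2 \<le> (norm x + norm y)\<^sup>2" by (intro power_mono norm_triangle_ineq4) auto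
  also have "\<dots> \<le> 2 * (norm x)\<^sup>2 + 2 * (norm y)\<^sup>2"
    using zero_le_power2[of "norm x - norm y"] by (simp add: power2_sum power2_diff)
  finally show ?thesis .
qed

lemma P2_nn_integral:
  assumes "\<mu> \<in> P2"
  shows "(\<integral>\<^sup>+x. ennreal ((norm x)\<^sup>2) \<partial>\<mu>) < \<infinity>"
  using P2_D(3)[OF assms] by (auto simp: integrable_iff_bounded)

lemma P2_I:
  assumes "sets \<mu> = sets borel" "prob_space \<mu>" "(\<integral>\<^sup>+x. ennreal ((norm x)\<^sup>2) \<partial>\<mu>) < \<infinity>"
  shows "\<mu> \<in> P2"
proof -
  have "(\<lambda>x. (norm x)\<^sup>2) \<in> borel_measurable \<mu>"
    unfolding measurable_cong_sets[OF assms(1) refl] by simp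
  then have "integrable \<mu> (\<lambda>x. (norm x)\<^sup>2)" using assms(3) by (intro integrableI_nonneg) auto
  then show ?thesis using assms by (simp add: P2_def)
qed

lemma sqcost_finite:
  assumes "\<mu> \<in> P2" "\<nu> \<in> P2" "\<gamma> \<in> couplings \<mu> \<nu>"
  shows "sqcost \<gamma> < \<infinity>"
proof -
  note [measurable_cong] = couplings_D(1)[OF assms(3)]
  have "sqcost \<gamma> \<le> (\<integral>\<^sup>+z. 2 * ennreal ((norm (fst z))\<^sup>2) + 2 * ennreal ((norm (snd z))\<^sup>2) \<partial>\<gamma>)"
  proof (rule nn_integral_mono)
    fix z :: "'a \<times> 'a"
    have "ennreal ((norm (fst z - snd z))\<^sup>2) \<le> ennreal (2 * (norm (fst z))\<^sup>2 + 2 * (norm (snd z))\<^sup>2)"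
      by (intro ennreal_leI sq_norm_diff_le)
    also have "\<dots> = 2 * ennreal ((norm (fst z))\<^sup>2) + 2 * ennreal ((norm (snd z))\<^sup>2)"
      by (simp add: ennreal_plus ennreal_mult)
    finally show "ennreal ((norm (fst z - snd z))\<^sup>2) \<le> 2 * ennreal ((norm (fst z))\<^sup>2) + 2 * ennreal ((norm (snd z))\<^sup>2)" .
  qed
  also have "\<dots> = 2 * (\<integral>\<^sup>+z. ennreal ((norm (fst z))\<^sup>2) \<partial>\<gamma>) + 2 * (\<integral>\<^sup>+z. ennreal ((norm (snd z))\<^sup>2) \<partial>\<gamma>)"
    by (subst nn_integral_add) (auto simp: nn_integral_cmult)
  also have "\<dots> = 2 * (\<integral>\<^sup>+x. ennreal ((norm x)\<^sup>2) \<partial>\<mu>) + 2 * (\<integral>\<^sup>+x. ennreal ((norm x)\<^sup>2) \<partial>\<nu>)"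
    using nn_integral_fst_coupling[OF assms(3), of "\<lambda>x. ennreal ((norm x)\<^sup>2)"]
      nn_integral_snd_coupling[OF assms(3), of "\<lambda>x. ennreal ((norm x)\<^sup>2)"] by simp
  also have "\<dots> < \<infinity>"
    using P2_nn_integral[OF assms(1)] P2_nn_integral[OF assms(2)] by (simp add: ennreal_mult_less_top)
  finally show ?thesis .
qed

lemma transport_cost_nonneg: "0 \<le> transport_cost \<gamma>"
  unfolding transport_cost_def by (intro Bochner_Integration.integral_nonneg) auto

text \<open>The product measure is a coupling. Nonemptiness matters because a real infimum over the
  empty set carries no information.\<close>

lemma couplings_nonempty:
  assumes "\<mu> \<in> P2" "\<nu> \<in> P2"
  shows "couplings \<mu> \<nu> \<noteq> {}"
proof -
  interpret \<mu>: prob_space \<mu> using P2_D[OF assms(1)] by simp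
  interpret \<nu>: prob_space \<nu> using P2_D[OF assms(2)] by simp
  interpret P: pair_prob_space \<mu> \<nu> ..
  note s[measurable_cong] = P2_D(1)[OF assms(1)] P2_D(1)[OF assms(2)]
  have sets: "sets (\<mu> \<Otimes>\<^sub>M \<nu>) = sets borel"
    unfolding borel_prod[symmetric] by (intro sets_pair_measure_cong s)
  have "distr (\<mu> \<Otimes>\<^sub>M \<nu>) borel fst = distr (\<mu> \<Otimes>\<^sub>M \<nu>) \<mu> fst"
    by (intro distr_cong) (auto simp: s)
  also have "\<dots> = \<mu>" by (rule \<nu>.distr_pair_fst)
  finally have 1: "distr (\<mu> \<Otimes>\<^sub>M \<nu>) borel fst = \<mu>" .
  have "distr (\<mu> \<Otimes>\<^sub>M \<nu>) borel snd = \<nu>"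
  proof (rule measure_eqI)
    fix A assume "A \<in> sets (distr (\<mu> \<Otimes>\<^sub>M \<nu>) borel snd)"
    then have [measurable]: "A \<in> sets borel" by simp
    have "snd -` A \<inter> space (\<mu> \<Otimes>\<^sub>M \<nu>) = space \<mu> \<times> A"
      using sets.sets_into_space[of A \<nu>] s by (auto simp: space_pair_measure)
    then show "emeasure (distr (\<mu> \<Otimes>\<^sub>M \<nu>) borel snd) A = emeasure \<nu> A"
      using \<nu>.emeasure_pair_measure_Times[of "space \<mu>" \<mu> A] sets.top[of \<mu>] s \<mu>.emeasure_space_1
      by (simp add: emeasure_distr)
  qed (simp add: s)
  with 1 sets have "\<mu> \<Otimes>\<^sub>M \<nu> \<in> couplings \<mu> \<nu>"
    by (simp add: couplings_def P.prob_space_axioms)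
  then show ?thesis by blast
qed

section \<open>Near-optimal plans, symmetry and separation of points\<close>

lemma W2_leI:
  assumes "\<gamma> \<in> couplings \<mu> \<nu>" "0 \<le> r" "sqcost \<gamma> \<le> ennreal (r\<^sup>2)"
  shows "W2 \<mu> \<nu> \<le> r"
proof -
  have "(INF \<gamma>\<in>couplings \<mu> \<nu>. transport_cost \<gamma>) \<le> transport_cost \<gamma>"
    by (intro cINF_lower assms bdd_belowI2[of _ 0] transport_cost_nonneg)
  also have "\<dots> \<le> r\<^sup>2"
    unfolding transport_cost_enn2real[OF couplings_D(1)[OF assms(1)]]
    using enn2real_mono[OF assms(3)] by simp
  finally show ?thesis
    unfolding W2_def using assms(2) by (intro real_le_lsqrt) auto
qed

lemma W2_nonneg:
  assumes "\<mu> \<in> P2" "\<nu> \<in> P2"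
  shows "0 \<le> W2 \<mu> \<nu>"
  unfolding W2_def using couplings_nonempty[OF assms]
  by (intro real_sqrt_ge_zero cINF_greatest transport_cost_nonneg)

text \<open>A strict bound on an infimum is met by some element; such near-optimal plans are what
  the metric properties below work with.\<close>

lemma W2_lessD:
  assumes "\<mu> \<in> P2" "\<nu> \<in> P2" "W2 \<mu> \<nu> < r"
  obtains \<gamma> where "\<gamma> \<in> couplings \<mu> \<nu>" "sqcost \<gamma> \<le> ennreal (r\<^sup>2)"
proof -
  have r: "0 < r" using W2_nonneg[OF assms(1,2)] assms(3) by linarith
  have "sqrt (INF \<gamma>\<in>couplings \<mu> \<nu>. transport_cost \<gamma>) < sqrt (r\<^sup>2)"
    using assms(3) r by (simp add: W2_def del: real_sqrt_less_iff)
  then have "(INF \<gamma>\<in>couplings \<mu> \<nu>. transport_cost \<gamma>) < r\<^sup>2" by (simp only: real_sqrt_less_iff)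
  then obtain \<gamma> where \<gamma>: "\<gamma> \<in> couplings \<mu> \<nu>" "transport_cost \<gamma> < r\<^sup>2"
    using cINF_less_iff[OF couplings_nonempty[OF assms(1,2)] bdd_belowI2[of _ 0 transport_cost]]
      transport_cost_nonneg by blast
  have "sqcost \<gamma> = ennreal (transport_cost \<gamma>)"
    unfolding transport_cost_enn2real[OF couplings_D(1)[OF \<gamma>(1)]]
    using sqcost_finite[OF assms(1,2) \<gamma>(1)] by (simp add: less_top)
  also have "\<dots> \<le> ennreal (r\<^sup>2)" using \<gamma>(2) by (intro ennreal_leI) auto
  finally show ?thesis using that \<gamma>(1) by blast
qed

lemma couplings_swap:
  assumes "\<gamma> \<in> couplings \<mu> \<nu>"
  shows "distr \<gamma> borel (\<lambda>z. (snd z, fst z)) \<in> couplings \<nu> \<mu>"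
    "sqcost (distr \<gamma> borel (\<lambda>z. (snd z, fst z))) = sqcost \<gamma>"
proof -
  note D = couplings_D[OF assms]
  have m[measurable]: "(\<lambda>z. (snd z, fst z)) \<in> \<gamma> \<rightarrow>\<^sub>M borel" "fst \<in> \<gamma> \<rightarrow>\<^sub>M borel" "snd \<in> \<gamma> \<rightarrow>\<^sub>M borel"
    unfolding measurable_cong_sets[OF D(1) refl] by measurable
  interpret prob_space \<gamma> by (rule D)
  show "distr \<gamma> borel (\<lambda>z. (snd z, fst z)) \<in> couplings \<nu> \<mu>"
    using D m by (simp add: couplings_def prob_space_distr distr_distr comp_def)
  show "sqcost (distr \<gamma> borel (\<lambda>z. (snd z, fst z))) = sqcost \<gamma>"
    by (subst nn_integral_distr[OF m(1)]) (simp_all add: norm_minus_commute)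
qed

lemma W2_sym:
  assumes "\<mu> \<in> P2" "\<nu> \<in> P2"
  shows "W2 \<mu> \<nu> = W2 \<nu> \<mu>"
proof -
  have "W2 \<nu> \<mu> \<le> W2 \<mu> \<nu>" if "\<mu> \<in> P2" "\<nu> \<in> P2" for \<mu> \<nu> :: "'a measure"
  proof (rule dense_ge)
    fix r assume r: "W2 \<mu> \<nu> < r"
    from W2_lessD[OF that r] obtain \<gamma> where "\<gamma> \<in> couplings \<mu> \<nu>" "sqcost \<gamma> \<le> ennreal (r\<^sup>2)" .
    then show "W2 \<nu> \<mu> \<le> r"
      using r W2_nonneg[OF that] couplings_swap[of \<gamma> \<mu> \<nu>]
      by (intro W2_leI[of "distr \<gamma> borel (\<lambda>z. (snd z, fst z))"]) auto
  qed
  then show ?thesis using assms by (intro antisym) auto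
qed

text \<open>By Chebyshev's inequality a plan of cost at most e^4 carries mass at most e^2 farther
  than e, so \<mu> C is at most e^2 plus the \<nu>-mass of the closed e-neighbourhood of C. As e
  tends to 0 these neighbourhoods shrink to C.\<close>

lemma W2_eq_0_imp_measure_closed_le:
  assumes "\<mu> \<in> P2" "\<nu> \<in> P2" "W2 \<mu> \<nu> = 0" "closed C"
  shows "measure \<mu> C \<le> measure \<nu> C"
proof (cases "C = {}")
  \<comment> \<open>\<open>infdist\<close> to the empty set is 0, so for empty C the neighbourhoods
    below would be the whole space.\<close>
  case False
  interpret \<mu>: prob_space \<mu> using P2_D[OF assms(1)] by simp
  interpret \<nu>: prob_space \<nu> using P2_D[OF assms(2)] by simp
  note s[measurable_cong] = P2_D(1)[OF assms(1)] P2_D(1)[OF assms(2)]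
  define e where "e n = 1 / real (Suc n)" for n
  define U where "U n = {x. infdist x C \<le> e n}" for n
  have e: "e n > 0" for n by (simp add: e_def)
  have U_closed: "closed (U n)" for n unfolding U_def by (intro closed_Collect_le continuous_intros)
  have le: "measure \<mu> C \<le> measure \<nu> (U n) + (e n)\<^sup>2" for n
  proof -
    have "W2 \<mu> \<nu> < (e n)\<^sup>2" using assms(3) e[of n] by simp
    from W2_lessD[OF assms(1,2) this] obtain \<gamma> where \<gamma>: "\<gamma> \<in> couplings \<mu> \<nu>" "sqcost \<gamma> \<le> ennreal (((e n)\<^sup>2)\<^sup>2)" .
    note [measurable_cong] = couplings_D(1)[OF \<gamma>(1)]
    have [measurable]: "C \<in> sets borel" "U n \<in> sets borel" using assms(4) U_closed by auto
    have "emeasure \<mu> C = (\<integral>\<^sup>+x. indicator C x \<partial>\<mu>)" using s by simp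
    also have "\<dots> = (\<integral>\<^sup>+z. indicator C (fst z) \<partial>\<gamma>)" by (subst nn_integral_fst_coupling[OF \<gamma>(1)]) auto
    also have "\<dots> \<le> (\<integral>\<^sup>+z. indicator (U n) (snd z) + ennreal (1 / (e n)\<^sup>2) * ennreal ((norm (fst z - snd z))\<^sup>2) \<partial>\<gamma>)"
    proof (rule nn_integral_mono)
      fix z :: "'a \<times> 'a"
      show "indicator C (fst z) \<le> (indicator (U n) (snd z) + ennreal (1 / (e n)\<^sup>2) * ennreal ((norm (fst z - snd z))\<^sup>2) :: ennreal)"
      proof (cases "fst z \<in> C \<and> snd z \<notin> U n")
        case True
        then have "e n < dist (snd z) (fst z)" using infdist_le[of "fst z" C "snd z"] by (auto simp: U_def)
        then have "(e n)\<^sup>2 \<le> (norm (fst z - snd z))\<^sup>2" using e[of n] by (intro power_mono) (auto simp: dist_norm norm_minus_commute)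
        then have "1 \<le> 1 / (e n)\<^sup>2 * (norm (fst z - snd z))\<^sup>2" using e[of n] by (simp add: field_simps)
        then have "ennreal 1 \<le> ennreal (1 / (e n)\<^sup>2 * (norm (fst z - snd z))\<^sup>2)" by (rule ennreal_leI)
        then show ?thesis using True by (subst ennreal_mult[symmetric]) auto
      qed (auto split: split_indicator)
    qed
    also have "\<dots> = emeasure \<nu> (U n) + ennreal (1 / (e n)\<^sup>2) * sqcost \<gamma>"
      using nn_integral_snd_coupling[OF \<gamma>(1), of "indicator (U n)"] s
      by (subst nn_integral_add) (auto simp: nn_integral_cmult)
    also have "\<dots> \<le> emeasure \<nu> (U n) + ennreal (1 / (e n)\<^sup>2) * ennreal (((e n)\<^sup>2)\<^sup>2)"
      by (intro add_mono mult_left_mono \<gamma>) auto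
    also have "\<dots> = ennreal (measure \<nu> (U n) + (e n)\<^sup>2)"
      using e[of n] by (simp add: \<nu>.emeasure_eq_measure ennreal_mult[symmetric] ennreal_plus[symmetric] power2_eq_square del: ennreal_plus)
    finally show ?thesis
      using e[of n] by (simp add: \<mu>.emeasure_eq_measure del: ennreal_plus)
  qed
  have e0: "e \<longlonglongrightarrow> 0" unfolding e_def by (rule LIMSEQ_Suc[OF lim_1_over_n])
  have "(\<Inter>n. U n) = C"
  proof -
    have "x \<in> C" if "\<And>n. infdist x C \<le> e n" for x
    proof -
      have "infdist x C \<le> 0" using e0 that by (intro LIMSEQ_le_const[of e]) auto
      then show ?thesis using in_closed_iff_infdist_zero[OF assms(4) False, of x] infdist_nonneg[of x C] by simp
    qed
    moreover have "infdist x C \<le> e n" if "x \<in> C" for x n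
      using that e[of n] by simp
    ultimately show ?thesis unfolding U_def by blast
  qed
  moreover have "(\<lambda>n. measure \<nu> (U n)) \<longlonglongrightarrow> measure \<nu> (\<Inter>n. U n)"
  proof (rule \<nu>.finite_Lim_measure_decseq)
    show "range U \<subseteq> sets \<nu>" using U_closed s by auto
    show "decseq U"
    proof (rule decseq_SucI)
      fix n have "e (Suc n) \<le> e n" by (simp add: e_def field_simps)
      then show "U (Suc n) \<le> U n" by (auto simp: U_def)
    qed
  qed
  ultimately have "(\<lambda>n. measure \<nu> (U n) + (e n)\<^sup>2) \<longlonglongrightarrow> measure \<nu> C + 0\<^sup>2"
    using e0 by (intro tendsto_intros) auto
  then show ?thesis using le by (intro LIMSEQ_le_const[of "\<lambda>n. measure \<nu> (U n) + (e n)\<^sup>2"]) auto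
qed simp

text \<open>Exchanging the roles of the two measures gives equality on closed sets, a generating
  pi-system.\<close>

lemma W2_eq_0_imp_eq:
  assumes "\<mu> \<in> P2" "\<nu> \<in> P2" "W2 \<mu> \<nu> = 0"
  shows "\<mu> = \<nu>"
proof -
  interpret \<mu>: prob_space \<mu> using P2_D[OF assms(1)] by simp
  interpret \<nu>: prob_space \<nu> using P2_D[OF assms(2)] by simp
  note s = P2_D(1)[OF assms(1)] P2_D(1)[OF assms(2)]
  have b: "sets (borel::'a measure) = sigma_sets UNIV (Collect closed)"
    unfolding borel_eq_closed by simp
  show ?thesis
  proof (rule measure_eqI_generator_eq[where E = "Collect closed" and \<Omega> = UNIV and A = "\<lambda>_. UNIV"])
    show "Int_stable (Collect closed :: 'a set set)" by (auto simp: Int_stable_def)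
    show "emeasure \<mu> X = emeasure \<nu> X" if "X \<in> Collect closed" for X
      using W2_eq_0_imp_measure_closed_le[OF assms, of X] W2_eq_0_imp_measure_closed_le[OF assms(2,1), of X]
        that W2_sym[OF assms(1,2)] assms(3) by (simp add: \<mu>.emeasure_eq_measure \<nu>.emeasure_eq_measure)
  qed (auto simp: s b \<mu>.emeasure_eq_measure)
qed

section \<open>Gluing of plans and the triangle inequality\<close>

text \<open>The index of x is that of the first point of a countable dense set within \<epsilon>/2
  of x; points sharing an index are both \<epsilon>/2-close to the same point. The level sets of q
  are the cells.\<close>

lemma exists_fine_cell_index:
  assumes "0 < \<epsilon>"
  obtains q :: "'a::{second_countable_topology, metric_space} \<Rightarrow> nat"
  where "q \<in> borel \<rightarrow>\<^sub>M count_space UNIV" "\<And>x y. q x = q y \<Longrightarrow> dist x y < \<epsilon>"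
proof -
  obtain D :: "'a set" where D: "countable D" "\<And>X. open X \<Longrightarrow> X \<noteq> {} \<Longrightarrow> \<exists>d\<in>D. d \<in> X"
    using countable_dense_setE by blast
  define d where "d = from_nat_into D"
  have ex: "\<exists>n. dist x (d n) < \<epsilon> / 2" for x
  proof -
    have "ball x (\<epsilon> / 2) \<noteq> {}" using assms by simp
    then obtain y where y: "y \<in> D" "y \<in> ball x (\<epsilon> / 2)" using D(2)[of "ball x (\<epsilon> / 2)"] by auto
    then obtain n where "d n = y" unfolding d_def using from_nat_into_surj[OF D(1)] by blast
    then show ?thesis using y by (intro exI[of _ n]) simp
  qed
  define q where "q x = (LEAST n. dist x (d n) < \<epsilon> / 2)" for x
  have q: "dist x (d (q x)) < \<epsilon> / 2" for x unfolding q_def using ex by (rule LeastI_ex)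
  have "q \<in> borel \<rightarrow>\<^sub>M count_space UNIV" unfolding q_def by measurable
  moreover have "dist x y < \<epsilon>" if "q x = q y" for x y
    using q[of x] q[of y] that dist_triangle2[of x y "d (q x)"] by simp
  ultimately show ?thesis using that by blast
qed

text \<open>A substitute for disintegration: the second coordinate of the kernel is drawn from \<open>\<gamma>\<close>
  conditioned on a whole cell of diameter below \<open>\<delta>\<close> instead of on a single point.\<close>

lemma approximate_disintegration:
  fixes \<gamma> :: "('a::euclidean_space \<times> 'a) measure"
  assumes \<gamma>: "\<gamma> \<in> couplings \<mu> \<nu>" and \<delta>: "0 < \<delta>"
  obtains \<Lambda> :: "'a \<Rightarrow> ('a \<times> 'a) measure"
  where "\<Lambda> \<in> borel \<rightarrow>\<^sub>M subprob_algebra borel" "\<And>y. prob_space (\<Lambda> y)" "\<And>y. sets (\<Lambda> y) = sets borel"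
    "\<And>h. h \<in> borel_measurable borel \<Longrightarrow> (\<integral>\<^sup>+y. (\<integral>\<^sup>+z. h z \<partial>\<Lambda> y) \<partial>\<mu>) = (\<integral>\<^sup>+z. h z \<partial>\<gamma>)"
    "AE y in \<mu>. AE z in \<Lambda> y. dist y (fst z) < \<delta>"
proof -
  obtain q :: "'a \<Rightarrow> nat" where q[measurable]: "q \<in> borel \<rightarrow>\<^sub>M count_space UNIV"
    and q_dist: "\<And>x y. q x = q y \<Longrightarrow> dist x y < \<delta>"
    using exists_fine_cell_index[OF \<delta>] by blast
  note D = couplings_D[OF \<gamma>]
  note [measurable_cong] = D(1)
  interpret \<gamma>: prob_space \<gamma> by (rule D)
  have space_\<gamma>: "space \<gamma> = UNIV" using sets_eq_imp_space_eq[OF D(1)] by simp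
  define A where "A n = {z \<in> space \<gamma>. q (fst z) = n}" for n
  have A[measurable]: "A n \<in> sets \<gamma>" for n unfolding A_def by measurable
  \<comment> \<open>Conditioning on a null cell is meaningless, so \<gamma> itself stands in there.
    Every \<open>L n\<close> is then a probability measure, and \<open>L_int\<close> survives on
    null cells because both sides vanish.\<close>
  define L where "L n = (if emeasure \<gamma> (A n) = 0 then \<gamma> else uniform_measure \<gamma> (A n))" for n
  have sets_L: "sets (L n) = sets borel" for n by (simp add: L_def D)
  have prob_L: "prob_space (L n)" for n
    unfolding L_def using D(2) by (auto intro!: prob_space_uniform_measure simp: \<gamma>.emeasure_eq_measure)
  have L_int: "(\<integral>\<^sup>+z. h z \<partial>L n) * emeasure \<gamma> (A n) = (\<integral>\<^sup>+z. h z * indicator (A n) z \<partial>\<gamma>)"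
    if [measurable]: "h \<in> borel_measurable borel" for h n
  proof (cases "emeasure \<gamma> (A n) = 0")
    case True
    then have "AE z in \<gamma>. z \<notin> A n" using A by (intro AE_not_in) auto
    then have "(\<integral>\<^sup>+z. h z * indicator (A n) z \<partial>\<gamma>) = (\<integral>\<^sup>+z. 0 \<partial>\<gamma>)"
      by (intro nn_integral_cong_AE) (auto elim!: eventually_mono)
    then show ?thesis using True by simp
  next
    case False
    moreover from this have "emeasure \<gamma> (A n) / emeasure \<gamma> (A n) = 1" by (intro ennreal_divide_self) (simp_all add: less_top[symmetric])
    ultimately show ?thesis
      by (simp add: L_def nn_integral_uniform_measure ennreal_divide_times)
  qed
  let ?\<Lambda> = "\<lambda>y. L (q y)"
  have L_meas: "L \<in> count_space UNIV \<rightarrow>\<^sub>M subprob_algebra borel"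
    using prob_L sets_L by (auto simp: space_subprob_algebra prob_space_imp_subprob_space)
  have "?\<Lambda> \<in> borel \<rightarrow>\<^sub>M subprob_algebra borel"
    by (rule measurable_compose[OF q L_meas])
  moreover have "(\<integral>\<^sup>+y. (\<integral>\<^sup>+z. h z \<partial>?\<Lambda> y) \<partial>\<mu>) = (\<integral>\<^sup>+z. h z \<partial>\<gamma>)"
    if h[measurable]: "h \<in> borel_measurable borel" for h
  proof -
    define F where "F n = (\<integral>\<^sup>+z. h z \<partial>L n)" for n
    have pointwise: "(\<Sum>n. c n * indicator (A n) z) = c (q (fst z))" if "z \<in> space \<gamma>" for z and c :: "nat \<Rightarrow> ennreal"
    proof -
      have "(\<Sum>n. c n * indicator (A n) z) = (\<Sum>n\<in>{q (fst z)}. c n * indicator (A n) z)"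
        by (rule suminf_finite) (auto simp: A_def)
      then show ?thesis using that by (simp add: A_def)
    qed
    have "(\<integral>\<^sup>+y. F (q y) \<partial>\<mu>) = (\<integral>\<^sup>+z. F (q (fst z)) \<partial>\<gamma>)"
      by (rule nn_integral_fst_coupling[OF \<gamma>, symmetric]) measurable
    also have "\<dots> = (\<integral>\<^sup>+z. (\<Sum>n. F n * indicator (A n) z) \<partial>\<gamma>)"
      by (intro nn_integral_cong) (simp add: pointwise)
    also have "\<dots> = (\<Sum>n. F n * emeasure \<gamma> (A n))"
      by (subst nn_integral_suminf) (auto simp: nn_integral_cmult_indicator)
    also have "\<dots> = (\<Sum>n. \<integral>\<^sup>+z. h z * indicator (A n) z \<partial>\<gamma>)"
      unfolding F_def using L_int[OF h] by simp
    also have "\<dots> = (\<integral>\<^sup>+z. (\<Sum>n. h z * indicator (A n) z) \<partial>\<gamma>)"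
      by (subst nn_integral_suminf) auto
    also have "\<dots> = (\<integral>\<^sup>+z. h z \<partial>\<gamma>)"
    proof (intro nn_integral_cong)
      fix z assume "z \<in> space \<gamma>"
      then show "(\<Sum>n. h z * indicator (A n) z) = h z" by (rule pointwise[of z "\<lambda>_. h z"])
    qed
    finally show ?thesis unfolding F_def .
  qed
  moreover have "AE y in \<mu>. AE z in ?\<Lambda> y. dist y (fst z) < \<delta>"
  proof -
    \<comment> \<open>The countably many null cells are avoided almost surely, so almost every y
      lies in a cell of positive mass, and there the drawn first coordinate shares the cell of
      y.\<close>
    have "AE z in \<gamma>. \<forall>n. emeasure \<gamma> (A n) = 0 \<longrightarrow> z \<notin> A n"
      unfolding AE_all_countable using A by (auto intro!: AE_not_in simp: null_sets_def)
    then have "AE z in \<gamma>. emeasure \<gamma> (A (q (fst z))) \<noteq> 0"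
      using AE_space by eventually_elim (auto simp: A_def)
    then have "AE y in distr \<gamma> borel fst. emeasure \<gamma> (A (q y)) \<noteq> 0"
      by (subst AE_distr_iff) auto
    then have "AE y in \<mu>. emeasure \<gamma> (A (q y)) \<noteq> 0" unfolding D(3) .
    then show ?thesis
    proof eventually_elim
      case (elim y)
      have "AE z in uniform_measure \<gamma> (A (q y)). dist y (fst z) < \<delta>"
        by (rule AE_uniform_measureI) (auto intro!: AE_I2 q_dist simp: A_def)
      moreover have "L (q y) = uniform_measure \<gamma> (A (q y))" using elim by (simp add: L_def)
      ultimately show ?case by (simp only:)
    qed
  qed
  ultimately show ?thesis using that prob_L sets_L by blast
qed

text \<open>Cauchy-Schwarz for (sqrt A, sqrt B, sqrt C) and (a, b, c); the gap between the two sides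
  is Lagrange's sum of squares.\<close>

lemma sq_norm_sum3_le:
  fixes u v w :: "'a::real_normed_vector"
  assumes "0 < A" "0 < B" "0 < C"
  shows "(norm (u + v + w))\<^sup>2 \<le> (A + B + C) * ((norm u)\<^sup>2 / A + (norm v)\<^sup>2 / B + (norm w)\<^sup>2 / C)"
proof -
  define a b c where "a = norm u / sqrt A" "b = norm v / sqrt B" "c = norm w / sqrt C"
  have n: "norm u = sqrt A * a" "norm v = sqrt B * b" "norm w = sqrt C * c"
    using assms by (simp_all add: a_b_c_def)
  have "norm (u + v + w) \<le> norm u + norm v + norm w"
    by (intro order_trans[OF norm_triangle_ineq] add_mono norm_triangle_ineq order_refl)
  then have "(norm (u + v + w))\<^sup>2 \<le> (sqrt A * a + sqrt B * b + sqrt C * c)\<^sup>2"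
    unfolding n by (intro power_mono) auto
  also have "\<dots> \<le> ((sqrt A)\<^sup>2 + (sqrt B)\<^sup>2 + (sqrt C)\<^sup>2) * (a\<^sup>2 + b\<^sup>2 + c\<^sup>2)"
  proof -
    have "0 \<le> (sqrt A * b - sqrt B * a)\<^sup>2 + (sqrt A * c - sqrt C * a)\<^sup>2 + (sqrt B * c - sqrt C * b)\<^sup>2" by simp
    also have "\<dots> = ((sqrt A)\<^sup>2 + (sqrt B)\<^sup>2 + (sqrt C)\<^sup>2) * (a\<^sup>2 + b\<^sup>2 + c\<^sup>2) - (sqrt A * a + sqrt B * b + sqrt C * c)\<^sup>2"
      by (simp only: power2_eq_square) algebra
    finally show ?thesis by simp
  qed
  also have "\<dots> = (A + B + C) * ((norm u)\<^sup>2 / A + (norm v)\<^sup>2 / B + (norm w)\<^sup>2 / C)"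
    using assms by (simp add: a_b_c_def power_divide)
  finally show ?thesis .
qed

lemma ennreal_lincomb:
  assumes "0 \<le> a" "0 \<le> x" "0 \<le> b" "0 \<le> c" "0 \<le> y"
  shows "ennreal (a * x + b + c * y) = ennreal a * ennreal x + ennreal b + ennreal c * ennreal y"
  using assms by (simp add: ennreal_mult)

text \<open>The two plans are glued along \<open>\<mu>2\<close> only up to the cell diameter \<open>\<delta>\<close>; the weights in
  \<open>sq_norm_sum3_le\<close> are those for which the Cauchy-Schwarz bound reproduces Minkowski's inequality.\<close>

lemma W2_triangle:
  assumes P: "\<mu>1 \<in> P2" "\<mu>2 \<in> P2" "\<mu>3 \<in> (P2 :: 'a::euclidean_space measure set)"
  shows "W2 \<mu>1 \<mu>3 \<le> W2 \<mu>1 \<mu>2 + W2 \<mu>2 \<mu>3"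
proof (rule field_le_epsilon)
  fix e :: real assume e: "0 < e"
  \<comment> \<open>The thirds of e pay for the slack of the two plans and for the cell diameter,
    and make A, B and \<delta> positive, since they serve as divisors.\<close>
  define A B \<delta> where "A = W2 \<mu>1 \<mu>2 + e / 3" "B = W2 \<mu>2 \<mu>3 + e / 3" "\<delta> = e / 3"
  have pos: "0 < A" "0 < B" "0 < \<delta>"
    using e W2_nonneg[OF P(1,2)] W2_nonneg[OF P(2,3)] by (auto simp: A_B_\<delta>_def)
  have less: "W2 \<mu>1 \<mu>2 < A" "W2 \<mu>2 \<mu>3 < B" using e by (auto simp: A_B_\<delta>_def)
  from W2_lessD[OF P(1,2) less(1)] obtain \<gamma>1 where \<gamma>1: "\<gamma>1 \<in> couplings \<mu>1 \<mu>2" "sqcost \<gamma>1 \<le> ennreal (A\<^sup>2)" .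
  from W2_lessD[OF P(2,3) less(2)] obtain \<gamma>2 where \<gamma>2: "\<gamma>2 \<in> couplings \<mu>2 \<mu>3" "sqcost \<gamma>2 \<le> ennreal (B\<^sup>2)" .
  from approximate_disintegration[OF \<gamma>2(1) pos(3)] obtain \<Lambda> :: "'a \<Rightarrow> ('a \<times> 'a) measure"
  where \<Lambda>: "\<Lambda> \<in> borel \<rightarrow>\<^sub>M subprob_algebra borel" "\<And>y. prob_space (\<Lambda> y)" "\<And>y. sets (\<Lambda> y) = sets borel"
    "\<And>h. h \<in> borel_measurable borel \<Longrightarrow> (\<integral>\<^sup>+y. (\<integral>\<^sup>+z. h z \<partial>\<Lambda> y) \<partial>\<mu>2) = (\<integral>\<^sup>+z. h z \<partial>\<gamma>2)"
    "AE y in \<mu>2. AE z in \<Lambda> y. dist y (fst z) < \<delta>" by blast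
  note D1 = couplings_D[OF \<gamma>1(1)] and D2 = couplings_D[OF \<gamma>2(1)]
  note [measurable_cong] = D1(1) \<Lambda>(3)
  note [measurable] = \<Lambda>(1)
  interpret g1: prob_space \<gamma>1 by (rule D1)
  \<comment> \<open>Draw (x, y) from \<gamma>1, then (y', z) from the kernel at y, and keep (x, z).
    The points y and y' agree only up to \<delta>, which enters as the third term of the norm
    estimate.\<close>
  define T where "T = \<gamma>1 \<bind> (\<lambda>p. distr (\<Lambda> (snd p)) borel (\<lambda>w. (fst p, snd w)))"
  have K: "(\<lambda>p. distr (\<Lambda> (snd p)) borel (\<lambda>w. (fst p, snd w))) \<in> \<gamma>1 \<rightarrow>\<^sub>M subprob_algebra borel"
    by (rule measurable_distr2[where M = borel]) measurable
  have T_int: "(\<integral>\<^sup>+z. f z \<partial>T) = (\<integral>\<^sup>+p. (\<integral>\<^sup>+w. f (fst p, snd w) \<partial>\<Lambda> (snd p)) \<partial>\<gamma>1)"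
    if [measurable]: "f \<in> borel_measurable borel" for f
    unfolding T_def
    by (subst nn_integral_bind[OF that K]) (auto intro!: nn_integral_cong nn_integral_distr)
  have sets_T: "sets T = sets borel"
    unfolding T_def using g1.not_empty by (subst sets_bind[where N = borel]) auto
  have int_snd: "(\<integral>\<^sup>+p. (\<integral>\<^sup>+w. h w \<partial>\<Lambda> (snd p)) \<partial>\<gamma>1) = (\<integral>\<^sup>+z. h z \<partial>\<gamma>2)"
    if [measurable]: "h \<in> borel_measurable borel" for h
    using nn_integral_snd_coupling[OF \<gamma>1(1), of "\<lambda>y. (\<integral>\<^sup>+w. h w \<partial>\<Lambda> y)"] \<Lambda>(4)[OF that] by simp
  have one: "emeasure (\<Lambda> y) (space (\<Lambda> y)) = 1" for y
    by (rule prob_space.emeasure_space_1[OF \<Lambda>(2)])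
  have T1: "distr T borel fst = \<mu>1"
  proof (rule measure_eqI)
    fix X assume "X \<in> sets (distr T borel fst)"
    then have [measurable]: "X \<in> sets borel" by simp
    note [measurable_cong] = sets_T
    have "emeasure (distr T borel fst) X = (\<integral>\<^sup>+z. indicator X (fst z) \<partial>T)"
      by (simp add: nn_integral_indicator[symmetric] nn_integral_distr del: nn_integral_indicator)
    also have "\<dots> = (\<integral>\<^sup>+x. indicator X x \<partial>\<mu>1)"
      by (simp add: T_int one nn_integral_fst_coupling[OF \<gamma>1(1), of "indicator X"])
    finally show "emeasure (distr T borel fst) X = emeasure \<mu>1 X" using P2_D(1)[OF P(1)] by simp
  qed (simp add: P2_D(1)[OF P(1)])
  have T2: "distr T borel snd = \<mu>3"
  proof (rule measure_eqI)
    fix X assume "X \<in> sets (distr T borel snd)"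
    then have [measurable]: "X \<in> sets borel" by simp
    note [measurable_cong] = sets_T
    have "emeasure (distr T borel snd) X = (\<integral>\<^sup>+z. indicator X (snd z) \<partial>T)"
      by (simp add: nn_integral_indicator[symmetric] nn_integral_distr del: nn_integral_indicator)
    also have "\<dots> = (\<integral>\<^sup>+x. indicator X x \<partial>\<mu>3)"
      by (simp add: T_int int_snd[of "\<lambda>w. indicator X (snd w)"] nn_integral_snd_coupling[OF \<gamma>2(1), of "indicator X"])
    finally show "emeasure (distr T borel snd) X = emeasure \<mu>3 X" using P2_D(1)[OF P(3)] by simp
  qed (simp add: P2_D(1)[OF P(3)])
  have "prob_space T"
  proof (rule prob_space_distrD)
    show "fst \<in> T \<rightarrow>\<^sub>M borel" unfolding measurable_cong_sets[OF sets_T refl] by measurable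
    show "prob_space (distr T borel fst)" unfolding T1 by (rule P2_D(2)[OF P(1)])
  qed
  then have T: "T \<in> couplings \<mu>1 \<mu>3" using sets_T T1 T2 by (simp add: couplings_def)
  define S where "S = A + \<delta> + B"
  have S: "0 < S" using pos by (simp add: S_def)
  have AE: "AE p in \<gamma>1. AE w in \<Lambda> (snd p). dist (snd p) (fst w) < \<delta>"
  proof -
    have "snd \<in> \<gamma>1 \<rightarrow>\<^sub>M borel" by measurable
    moreover have "AE y in distr \<gamma>1 borel snd. AE z in \<Lambda> y. dist y (fst z) < \<delta>" using \<Lambda>(5) by (simp only: D1)
    ultimately show ?thesis by (rule AE_distrD)
  qed
  have "sqcost T = (\<integral>\<^sup>+p. (\<integral>\<^sup>+w. ennreal ((norm (fst p - snd w))\<^sup>2) \<partial>\<Lambda> (snd p)) \<partial>\<gamma>1)"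
    by (subst T_int) auto
  also have "\<dots> \<le> (\<integral>\<^sup>+p. (\<integral>\<^sup>+w. (ennreal (S / A) * ennreal ((norm (fst p - snd p))\<^sup>2) + ennreal (S * \<delta>))
       + ennreal (S / B) * ennreal ((norm (fst w - snd w))\<^sup>2) \<partial>\<Lambda> (snd p)) \<partial>\<gamma>1)"
  proof (rule nn_integral_mono_AE)
    show "AE p in \<gamma>1. (\<integral>\<^sup>+w. ennreal ((norm (fst p - snd w))\<^sup>2) \<partial>\<Lambda> (snd p)) \<le>
       (\<integral>\<^sup>+w. (ennreal (S / A) * ennreal ((norm (fst p - snd p))\<^sup>2) + ennreal (S * \<delta>))
       + ennreal (S / B) * ennreal ((norm (fst w - snd w))\<^sup>2) \<partial>\<Lambda> (snd p))"
      using AE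
    proof (eventually_elim, intro nn_integral_mono_AE)
      fix p :: "'a \<times> 'a" assume "AE w in \<Lambda> (snd p). dist (snd p) (fst w) < \<delta>"
      then show "AE w in \<Lambda> (snd p). ennreal ((norm (fst p - snd w))\<^sup>2) \<le>
        (ennreal (S / A) * ennreal ((norm (fst p - snd p))\<^sup>2) + ennreal (S * \<delta>)) + ennreal (S / B) * ennreal ((norm (fst w - snd w))\<^sup>2)"
      proof eventually_elim
        case (elim w)
        have "(norm (snd p - fst w))\<^sup>2 \<le> \<delta>\<^sup>2" using elim by (intro power_mono) (auto simp: dist_norm)
        then have d: "(norm (snd p - fst w))\<^sup>2 / \<delta> \<le> \<delta>" using pos by (simp add: field_simps power2_eq_square)
        have "fst p - snd w = (fst p - snd p) + (snd p - fst w) + (fst w - snd w)" by simp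
        then have "(norm (fst p - snd w))\<^sup>2 \<le> S * ((norm (fst p - snd p))\<^sup>2 / A + (norm (snd p - fst w))\<^sup>2 / \<delta> + (norm (fst w - snd w))\<^sup>2 / B)"
          unfolding S_def using sq_norm_sum3_le[OF pos(1) pos(3) pos(2), of "fst p - snd p" "snd p - fst w" "fst w - snd w"] by simp
        also have "\<dots> \<le> S * ((norm (fst p - snd p))\<^sup>2 / A + \<delta> + (norm (fst w - snd w))\<^sup>2 / B)"
          using d S by (intro mult_left_mono) auto
        also have "\<dots> = (S / A * (norm (fst p - snd p))\<^sup>2 + S * \<delta>) + S / B * (norm (fst w - snd w))\<^sup>2"
          by (simp add: distrib_left)
        finally have "ennreal ((norm (fst p - snd w))\<^sup>2) \<le> ennreal ((S / A * (norm (fst p - snd p))\<^sup>2 + S * \<delta>) + S / B * (norm (fst w - snd w))\<^sup>2)"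
          by (rule ennreal_leI)
        also have "\<dots> = (ennreal (S / A) * ennreal ((norm (fst p - snd p))\<^sup>2) + ennreal (S * \<delta>)) + ennreal (S / B) * ennreal ((norm (fst w - snd w))\<^sup>2)"
          using S pos by (intro ennreal_lincomb) auto
        finally show ?case .
      qed
    qed
  qed
  also have "\<dots> = (\<integral>\<^sup>+p. (ennreal (S / A) * ennreal ((norm (fst p - snd p))\<^sup>2) + ennreal (S * \<delta>))
       + ennreal (S / B) * (\<integral>\<^sup>+w. ennreal ((norm (fst w - snd w))\<^sup>2) \<partial>\<Lambda> (snd p)) \<partial>\<gamma>1)"
    by (intro nn_integral_cong) (subst nn_integral_add, auto simp: one nn_integral_cmult)
  also have "\<dots> = ennreal (S / A) * sqcost \<gamma>1 + ennreal (S * \<delta>) + ennreal (S / B) * sqcost \<gamma>2"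
    using int_snd[of "\<lambda>w. ennreal ((norm (fst w - snd w))\<^sup>2)"]
    by (subst nn_integral_add, simp, simp, subst nn_integral_add, simp, simp) (simp add: nn_integral_cmult g1.emeasure_space_1)
  also have "\<dots> \<le> ennreal (S / A) * ennreal (A\<^sup>2) + ennreal (S * \<delta>) + ennreal (S / B) * ennreal (B\<^sup>2)"
    by (intro add_mono mult_left_mono \<gamma>1 \<gamma>2) auto
  also have "\<dots> = ennreal (S / A * A\<^sup>2 + S * \<delta> + S / B * B\<^sup>2)"
    using S pos by (intro ennreal_lincomb[symmetric]) auto
  \<comment> \<open>The weights S / A and S / B cancel one factor each, leaving S * (A + \<delta> +
    B).\<close>
  also have "S / A * A\<^sup>2 + S * \<delta> + S / B * B\<^sup>2 = S\<^sup>2"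
  proof -
    have "S / A * A\<^sup>2 = S * A" "S / B * B\<^sup>2 = S * B" using pos by (simp_all add: power2_eq_square)
    then show ?thesis by (simp add: S_def power2_eq_square algebra_simps)
  qed
  finally have "W2 \<mu>1 \<mu>3 \<le> S" using T S by (intro W2_leI) auto
  then show "W2 \<mu>1 \<mu>3 \<le> W2 \<mu>1 \<mu>2 + W2 \<mu>2 \<mu>3 + e" by (simp add: S_def A_B_\<delta>_def)
qed

section \<open>Markov chains and completeness\<close>

text \<open>The Ionescu-Tulcea theorem for a transition law that looks only at the latest state.
  Integral identities for the first state and for consecutive states are enough to compute laws and
  step costs along the chain.\<close>

lemma markov_chain_exists:
  fixes K :: "nat \<Rightarrow> 'a::euclidean_space \<Rightarrow> 'a measure"
  assumes K: "\<And>n. K n \<in> borel \<rightarrow>\<^sub>M subprob_algebra borel" "\<And>n y. prob_space (K n y)"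
    and \<nu>: "prob_space \<nu>" "sets \<nu> = sets borel"
  obtains \<Omega> :: "(nat \<Rightarrow> 'a) measure"
  where "prob_space \<Omega>" "sets \<Omega> = sets (PiM UNIV (\<lambda>_. borel))"
    "\<And>f. f \<in> borel_measurable borel \<Longrightarrow> (\<integral>\<^sup>+\<omega>. f (\<omega> 0) \<partial>\<Omega>) = (\<integral>\<^sup>+x. f x \<partial>\<nu>)"
    "\<And>n f. f \<in> borel_measurable borel \<Longrightarrow>
      (\<integral>\<^sup>+\<omega>. f (\<omega> n, \<omega> (Suc n)) \<partial>\<Omega>) = (\<integral>\<^sup>+\<omega>. (\<integral>\<^sup>+y. f (\<omega> n, y) \<partial>K n (\<omega> n)) \<partial>\<Omega>)"
proof -
  let ?M = "\<lambda>_::nat. borel :: 'a measure"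
  define P where "P n \<omega> = (case n of 0 \<Rightarrow> \<nu> | Suc m \<Rightarrow> K m (\<omega> m))" for n :: nat and \<omega> :: "nat \<Rightarrow> 'a"
  interpret IT: Ionescu_Tulcea P ?M
  proof (rule Ionescu_Tulcea.intro)
    fix i
    show "P i \<in> PiM {0..<i} ?M \<rightarrow>\<^sub>M subprob_algebra borel"
    proof (cases i)
      case 0
      then show ?thesis
        using \<nu> by (auto simp: P_def[abs_def] space_subprob_algebra prob_space_imp_subprob_space intro!: measurable_const)
    next
      case (Suc m)
      have "(\<lambda>\<omega>. \<omega> m) \<in> PiM {0..<i} ?M \<rightarrow>\<^sub>M borel"
        using Suc by (intro measurable_component_singleton) auto
      from measurable_compose[OF this K(1)[of m]] show ?thesis by (simp add: P_def[abs_def] Suc)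
    qed
    show "prob_space (P i x)" if "x \<in> space (PiM {0..<i} ?M)" for x using K(2) \<nu>(1) by (auto simp: P_def split: nat.split)
  qed
  let ?\<Omega> = "IT.PF.lim"
  \<comment> \<open>Law of the first m coordinates; the chain starts from the unique function on the
    empty index set.\<close>
  let ?C = "\<lambda>m. IT.C 0 m (\<lambda>_. undefined)"
  have u: "(\<lambda>_. undefined) \<in> space (PiM {0..<0} ?M)" by (simp add: space_PiM)
  have c: "(\<lambda>\<omega>. \<omega> i) \<in> PiM {0..<m} ?M \<rightarrow>\<^sub>M borel" if "i < m" for i m
    using that by (intro measurable_component_singleton) auto
  have sets_\<Omega>: "sets ?\<Omega> = sets (PiM UNIV ?M)" by (rule IT.PF.sets_lim)
  have up_to: "IT.up_to {0..<m} = m" for m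
  proof (rule antisym)
    show "IT.up_to {0..<m} \<le> m" by (simp add: IT.up_to_iff_Ico)
    have "{0..<m} \<subseteq> {0..<IT.up_to {0..<m}}" by (rule IT.up_to) simp
    then show "m \<le> IT.up_to {0..<m}" by auto
  qed
  have dist_\<Omega>: "distr ?\<Omega> (PiM {0..<m} ?M) (\<lambda>\<omega>. restrict \<omega> {0..<m}) = ?C m" for m
    using IT.distr_lim[of "{0..<m}"] IT.distr_C[of m m "\<lambda>_. undefined" 0] u by (simp add: IT.CI_def up_to)
  have restr: "(\<lambda>\<omega>. restrict \<omega> {0..<m}) \<in> ?\<Omega> \<rightarrow>\<^sub>M PiM {0..<m} ?M" for m
    unfolding measurable_cong_sets[OF sets_\<Omega> refl] by (rule measurable_restrict_subset) simp
  have int_\<Omega>: "(\<integral>\<^sup>+\<omega>. g (restrict \<omega> {0..<m}) \<partial>?\<Omega>) = (\<integral>\<^sup>+\<omega>. g \<omega> \<partial>?C m)"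
    if "g \<in> borel_measurable (PiM {0..<m} ?M)" for g m
    unfolding dist_\<Omega>[symmetric] using that restr by (subst nn_integral_distr) auto
  have sets_C: "sets (?C m) = sets (PiM {0..<m} ?M)" for m
    using IT.sets_C[OF u, of m] by simp
  have step: "(\<integral>\<^sup>+\<omega>. g \<omega> \<partial>?C (Suc m)) = (\<integral>\<^sup>+\<omega>. (\<integral>\<^sup>+x. g (fun_upd \<omega> m x) \<partial>P m \<omega>) \<partial>?C m)"
    if g: "g \<in> borel_measurable (PiM {0..<Suc m} ?M)" for g m
  proof -
    have "IT.eP m \<in> ?C m \<rightarrow>\<^sub>M subprob_algebra (PiM {0..<Suc m} ?M)"
      unfolding measurable_cong_sets[OF sets_C refl] by (rule IT.measurable_eP)
    then have "(\<integral>\<^sup>+\<omega>. g \<omega> \<partial>?C (Suc m)) = (\<integral>\<^sup>+\<omega>. (\<integral>\<^sup>+x. g x \<partial>IT.eP m \<omega>) \<partial>?C m)"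
      using g by (simp add: nn_integral_bind[where B = "PiM {0..<Suc m} ?M"])
    also have "\<dots> = (\<integral>\<^sup>+\<omega>. (\<integral>\<^sup>+x. g (fun_upd \<omega> m x) \<partial>P m \<omega>) \<partial>?C m)"
    proof (rule nn_integral_cong)
      fix \<omega> assume "\<omega> \<in> space (?C m)"
      then have "\<omega> \<in> space (PiM {0..<m} ?M)" using sets_eq_imp_space_eq[OF sets_C[of m]] by simp
      then show "(\<integral>\<^sup>+x. g x \<partial>IT.eP m \<omega>) = (\<integral>\<^sup>+x. g (fun_upd \<omega> m x) \<partial>P m \<omega>)"
        using g by (rule IT.nn_integral_eP)
    qed
    finally show ?thesis .
  qed
  show ?thesis
  proof
    \<comment> \<open>Total mass 1 is inherited from the image under projection to no coordinates at
      all.\<close>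
    show "prob_space ?\<Omega>"
    proof (rule prob_space_distrD[OF restr])
      show "prob_space (distr ?\<Omega> (PiM {0..<0} ?M) (\<lambda>\<omega>. restrict \<omega> {0..<0}))"
        unfolding dist_\<Omega> by (rule IT.prob_space_C[OF u])
    qed
    show "sets ?\<Omega> = sets (PiM UNIV ?M)" by (rule sets_\<Omega>)
    show "(\<integral>\<^sup>+\<omega>. f (\<omega> 0) \<partial>?\<Omega>) = (\<integral>\<^sup>+x. f x \<partial>\<nu>)" if [measurable]: "f \<in> borel_measurable borel" for f
    proof -
      have m: "(\<lambda>\<omega>. f (\<omega> 0)) \<in> borel_measurable (PiM {0..<Suc 0} ?M)"
        by (rule measurable_compose[OF c that]) simp
      have "(\<integral>\<^sup>+\<omega>. f (\<omega> 0) \<partial>?\<Omega>) = (\<integral>\<^sup>+\<omega>. f (\<omega> 0) \<partial>?C (Suc 0))"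
        using int_\<Omega>[OF m] by simp
      also have "\<dots> = (\<integral>\<^sup>+\<omega>. (\<integral>\<^sup>+x. f x \<partial>\<nu>) \<partial>?C 0)"
        by (subst step[OF m]) (simp add: P_def)
      also have "\<dots> = (\<integral>\<^sup>+x. f x \<partial>\<nu>)"
        using prob_space.emeasure_space_1[OF IT.prob_space_C[OF u, of 0]] by (simp del: IT.C.simps)
      finally show ?thesis .
    qed
    show "(\<integral>\<^sup>+\<omega>. f (\<omega> n, \<omega> (Suc n)) \<partial>?\<Omega>) = (\<integral>\<^sup>+\<omega>. (\<integral>\<^sup>+y. f (\<omega> n, y) \<partial>K n (\<omega> n)) \<partial>?\<Omega>)"
      if [measurable]: "f \<in> borel_measurable borel" for f n
    proof -
      have m: "(\<lambda>\<omega>. f (\<omega> n, \<omega> (Suc n))) \<in> borel_measurable (PiM {0..<Suc (Suc n)} ?M)"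
        by (rule measurable_compose[OF borel_measurable_Pair that]) (auto intro: c)
      have h: "(\<lambda>y. \<integral>\<^sup>+x. f (y, x) \<partial>K n y) \<in> borel_measurable borel"
        using K(1)[of n] by (rule nn_integral_measurable_subprob_algebra2[rotated]) measurable
      have m2: "(\<lambda>\<omega>. \<integral>\<^sup>+x. f (\<omega> n, x) \<partial>K n (\<omega> n)) \<in> borel_measurable (PiM {0..<Suc n} ?M)"
        by (rule measurable_compose[OF c h]) simp
      have "(\<integral>\<^sup>+\<omega>. f (\<omega> n, \<omega> (Suc n)) \<partial>?\<Omega>) = (\<integral>\<^sup>+\<omega>. f (\<omega> n, \<omega> (Suc n)) \<partial>?C (Suc (Suc n)))"
        using int_\<Omega>[OF m] by simp
      also have "\<dots> = (\<integral>\<^sup>+\<omega>. (\<integral>\<^sup>+x. f (\<omega> n, x) \<partial>K n (\<omega> n)) \<partial>?C (Suc n))"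
        by (subst step[OF m]) (simp add: P_def)
      also have "\<dots> = (\<integral>\<^sup>+\<omega>. (\<integral>\<^sup>+x. f (\<omega> n, x) \<partial>K n (\<omega> n)) \<partial>?\<Omega>)"
        using int_\<Omega>[OF m2] by simp
      finally show ?thesis .
    qed
  qed
qed

lemma geometric_steps_converge:
  fixes x :: "nat \<Rightarrow> 'a::banach"
  assumes step: "\<And>n. norm (x n - x (Suc n)) \<le> c * (1/2)^n"
  shows "convergent x" "norm (x n - lim x) \<le> 2 * c * (1/2)^n"
proof -
  have c: "0 \<le> c" using order_trans[OF norm_ge_zero step[of 0]] by simp
  \<comment> \<open>The subtracted term makes the bound the exact partial geometric sum, so the
    induction closes.\<close>
  have b: "norm (x n - x (n + k)) \<le> 2 * c * (1/2)^n - 2 * c * (1/2)^(n + k)" for n k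
  proof (induction k)
    case (Suc k)
    have "norm (x n - x (n + Suc k)) \<le> norm (x n - x (n + k)) + norm (x (n + k) - x (Suc (n + k)))"
      using norm_triangle_ineq[of "x n - x (n + k)" "x (n + k) - x (Suc (n + k))"] by simp
    also have "\<dots> \<le> (2 * c * (1/2)^n - 2 * c * (1/2)^(n + k)) + c * (1/2)^(n + k)"
      by (intro add_mono Suc step)
    finally show ?case by simp
  qed simp
  have b2: "norm (x n - x m) \<le> 2 * c * (1/2)^n" if "n \<le> m" for n m
  proof -
    have "norm (x n - x (n + (m - n))) \<le> 2 * c * (1/2)^n"
      using b[of n "m - n"] c by (smt (verit) mult_nonneg_nonneg zero_le_power divide_nonneg_nonneg)
    then show ?thesis using that by simp
  qed
  have "(\<lambda>n. 2 * c * (1/2)^n) \<longlonglongrightarrow> 2 * c * 0"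
    by (intro tendsto_mult tendsto_const LIMSEQ_realpow_zero) auto
  then have lim0: "(\<lambda>n. 2 * c * (1/2)^n) \<longlonglongrightarrow> 0" by simp
  have "Cauchy x"
  proof (rule CauchyI')
    fix e :: real assume "e > 0"
    then have "eventually (\<lambda>n. 2 * c * (1/2)^n < e) sequentially"
      using order_tendstoD(2)[OF lim0] by simp
    then obtain N where "\<And>n. n \<ge> N \<Longrightarrow> 2 * c * (1/2)^n < e" by (auto simp: eventually_sequentially)
    then show "\<exists>M. \<forall>m\<ge>M. \<forall>n>m. dist (x m) (x n) < e"
      unfolding dist_norm using b2 by (intro exI[of _ N]) (meson le_less_trans less_imp_le)
  qed
  then show conv: "convergent x" by (simp add: Cauchy_convergent_iff)
  then have "(\<lambda>m. norm (x n - x m)) \<longlonglongrightarrow> norm (x n - lim x)"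
    by (intro tendsto_intros) (simp add: convergent_LIMSEQ_iff)
  then show "norm (x n - lim x) \<le> 2 * c * (1/2)^n"
    using b2 by (intro LIMSEQ_le_const2) auto
qed

text \<open>The measures are realised as the laws of a Markov chain whose steps are \<open>O(4\<^sup>-\<^sup>n)\<close> in \<open>L\<^sup>2\<close>. The
  chain converges almost surely and in \<open>L\<^sup>2\<close>, and the limit measure is the law of its limit.\<close>

lemma W2_Cauchy_converges:
  fixes \<mu> :: "nat \<Rightarrow> 'a::euclidean_space measure"
  assumes P: "\<And>n. \<mu> n \<in> P2" and step: "\<And>n. W2 (\<mu> n) (\<mu> (Suc n)) < (1/4)^n"
  obtains \<mu>' where "\<mu>' \<in> P2" "(\<lambda>n. W2 (\<mu> n) \<mu>') \<longlonglongrightarrow> 0"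
proof -
  \<comment> \<open>The cell diameter is matched to the transport error, so that conditioning costs
    no more than the plan: each accounts for 2 \<delta>^2 in \<open>cost\<close>.\<close>
  define \<delta> :: "nat \<Rightarrow> real" where "\<delta> n = (1/4)^n" for n
  have \<delta>: "0 < \<delta> n" for n by (simp add: \<delta>_def)
  have "\<forall>n. \<exists>\<gamma>. \<gamma> \<in> couplings (\<mu> n) (\<mu> (Suc n)) \<and> sqcost \<gamma> \<le> ennreal ((\<delta> n)\<^sup>2)"
    unfolding \<delta>_def using W2_lessD[OF P P step] by metis
  from choice[OF this] obtain \<gamma> where \<gamma>: "\<And>n. \<gamma> n \<in> couplings (\<mu> n) (\<mu> (Suc n))"
    "\<And>n. sqcost (\<gamma> n) \<le> ennreal ((\<delta> n)\<^sup>2)" by blast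
  define Q where "Q n \<Lambda> \<longleftrightarrow> \<Lambda> \<in> borel \<rightarrow>\<^sub>M subprob_algebra borel \<and> (\<forall>y. prob_space (\<Lambda> y)) \<and> (\<forall>y. sets (\<Lambda> y) = sets borel) \<and>
    (\<forall>h. h \<in> borel_measurable borel \<longrightarrow> (\<integral>\<^sup>+y. (\<integral>\<^sup>+z. h z \<partial>\<Lambda> y) \<partial>\<mu> n) = (\<integral>\<^sup>+z. h z \<partial>\<gamma> n)) \<and>
    (AE y in \<mu> n. AE z in \<Lambda> y. dist y (fst z) < \<delta> n)" for n and \<Lambda> :: "'a \<Rightarrow> ('a \<times> 'a) measure"
  have "\<exists>\<Lambda>. Q n \<Lambda>" for n
    by (rule approximate_disintegration[OF \<gamma>(1)[of n] \<delta>[of n]]) (unfold Q_def, blast)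
  then have "\<forall>n. \<exists>\<Lambda>. Q n \<Lambda>" by simp
  from choice[OF this] obtain \<Lambda> where Q: "\<And>n. Q n (\<Lambda> n)" by blast
  have \<Lambda>: "\<Lambda> n \<in> borel \<rightarrow>\<^sub>M subprob_algebra borel" "prob_space (\<Lambda> n y)" "sets (\<Lambda> n y) = sets borel"
    "h \<in> borel_measurable borel \<Longrightarrow> (\<integral>\<^sup>+y. (\<integral>\<^sup>+z. h z \<partial>\<Lambda> n y) \<partial>\<mu> n) = (\<integral>\<^sup>+z. h z \<partial>\<gamma> n)"
    "AE y in \<mu> n. AE z in \<Lambda> n y. dist y (fst z) < \<delta> n" for n y h
    using Q[of n] unfolding Q_def by simp_all
  note [measurable_cong] = \<Lambda>(3) and [measurable] = \<Lambda>(1)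
  \<comment> \<open>Only the target of the drawn pair becomes the next state. Consecutive states
    therefore need not have joint law \<gamma> n, but each single state still has law \<mu>
    n.\<close>
  define K where "K n y = distr (\<Lambda> n y) borel snd" for n y
  have K: "K n \<in> borel \<rightarrow>\<^sub>M subprob_algebra borel" for n
    unfolding K_def by (rule measurable_distr2[where M = borel]) measurable
  have K_prob: "prob_space (K n y)" for n y
    unfolding K_def by (rule prob_space.prob_space_distr[OF \<Lambda>(2)]) measurable
  have K_int: "(\<integral>\<^sup>+x. f x \<partial>K n y) = (\<integral>\<^sup>+w. f (snd w) \<partial>\<Lambda> n y)" if "f \<in> borel_measurable borel" for f n y
    unfolding K_def using that by (subst nn_integral_distr) auto
  have K_meas: "(\<lambda>y. \<integral>\<^sup>+x. f (y, x) \<partial>K n y) \<in> borel_measurable borel" if [measurable]: "f \<in> borel_measurable borel" for f n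
    using K[of n] by (rule nn_integral_measurable_subprob_algebra2[rotated]) measurable
  obtain \<Omega> :: "(nat \<Rightarrow> 'a) measure" where \<Omega>: "prob_space \<Omega>" "sets \<Omega> = sets (PiM UNIV (\<lambda>_. borel))"
    "\<And>f. f \<in> borel_measurable borel \<Longrightarrow> (\<integral>\<^sup>+\<omega>. f (\<omega> 0) \<partial>\<Omega>) = (\<integral>\<^sup>+x. f x \<partial>\<mu> 0)"
    "\<And>n f. f \<in> borel_measurable borel \<Longrightarrow>
      (\<integral>\<^sup>+\<omega>. f (\<omega> n, \<omega> (Suc n)) \<partial>\<Omega>) = (\<integral>\<^sup>+\<omega>. (\<integral>\<^sup>+y. f (\<omega> n, y) \<partial>K n (\<omega> n)) \<partial>\<Omega>)"
    by (rule markov_chain_exists[of K "\<mu> 0", OF K K_prob P2_D(2)[OF P[of 0]] P2_D(1)[OF P[of 0]]]) (rule that)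
  interpret \<Omega>: prob_space \<Omega> by (rule \<Omega>)
  have X[measurable]: "(\<lambda>\<omega>. \<omega> n) \<in> \<Omega> \<rightarrow>\<^sub>M borel" for n
    unfolding measurable_cong_sets[OF \<Omega>(2) refl] by (rule measurable_component_singleton) simp
  have law: "(\<integral>\<^sup>+\<omega>. f (\<omega> n) \<partial>\<Omega>) = (\<integral>\<^sup>+x. f x \<partial>\<mu> n)" if "f \<in> borel_measurable borel" for f n
    using that
  proof (induction n arbitrary: f)
    case (Suc n)
    note [measurable] = Suc.prems
    have "(\<integral>\<^sup>+\<omega>. f (\<omega> (Suc n)) \<partial>\<Omega>) = (\<integral>\<^sup>+\<omega>. (\<integral>\<^sup>+y. f y \<partial>K n (\<omega> n)) \<partial>\<Omega>)"
      using \<Omega>(4)[of "\<lambda>z. f (snd z)" n] by simp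
    also have "\<dots> = (\<integral>\<^sup>+x. (\<integral>\<^sup>+y. f y \<partial>K n x) \<partial>\<mu> n)"
      using K_meas[of "\<lambda>z. f (snd z)" n] by (intro Suc.IH) simp
    also have "\<dots> = (\<integral>\<^sup>+x. (\<integral>\<^sup>+w. f (snd w) \<partial>\<Lambda> n x) \<partial>\<mu> n)"
      by (simp add: K_int)
    also have "\<dots> = (\<integral>\<^sup>+z. f (snd z) \<partial>\<gamma> n)" by (rule \<Lambda>(4)) measurable
    also have "\<dots> = (\<integral>\<^sup>+x. f x \<partial>\<mu> (Suc n))" by (rule nn_integral_snd_coupling[OF \<gamma>(1)]) measurable
    finally show ?case .
  qed (rule \<Omega>(3))
  have cost: "(\<integral>\<^sup>+\<omega>. ennreal ((norm (\<omega> n - \<omega> (Suc n)))\<^sup>2) \<partial>\<Omega>) \<le> ennreal (4 * (\<delta> n)\<^sup>2)" for n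
  proof -
    have one: "emeasure (\<Lambda> n y) (space (\<Lambda> n y)) = 1" for y
      by (rule prob_space.emeasure_space_1[OF \<Lambda>(2)])
    have [measurable]: "(\<lambda>z::'a \<times> 'a. ennreal ((norm (fst z - snd z))\<^sup>2)) \<in> borel_measurable borel" by measurable
    have "(\<integral>\<^sup>+\<omega>. ennreal ((norm (\<omega> n - \<omega> (Suc n)))\<^sup>2) \<partial>\<Omega>) = (\<integral>\<^sup>+\<omega>. (\<integral>\<^sup>+y. ennreal ((norm (\<omega> n - y))\<^sup>2) \<partial>K n (\<omega> n)) \<partial>\<Omega>)"
      using \<Omega>(4)[of "\<lambda>z. ennreal ((norm (fst z - snd z))\<^sup>2)" n] by simp
    also have "\<dots> = (\<integral>\<^sup>+x. (\<integral>\<^sup>+y. ennreal ((norm (x - y))\<^sup>2) \<partial>K n x) \<partial>\<mu> n)"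
      using K_meas[of "\<lambda>z. ennreal ((norm (fst z - snd z))\<^sup>2)" n] by (intro law) simp
    also have "\<dots> = (\<integral>\<^sup>+x. (\<integral>\<^sup>+w. ennreal ((norm (x - snd w))\<^sup>2) \<partial>\<Lambda> n x) \<partial>\<mu> n)"
      by (intro nn_integral_cong K_int) measurable
    also have "\<dots> \<le> (\<integral>\<^sup>+x. (\<integral>\<^sup>+w. ennreal (2 * (\<delta> n)\<^sup>2) + 2 * ennreal ((norm (fst w - snd w))\<^sup>2) \<partial>\<Lambda> n x) \<partial>\<mu> n)"
    proof (rule nn_integral_mono_AE)
      show "AE x in \<mu> n. (\<integral>\<^sup>+w. ennreal ((norm (x - snd w))\<^sup>2) \<partial>\<Lambda> n x) \<le>
          (\<integral>\<^sup>+w. ennreal (2 * (\<delta> n)\<^sup>2) + 2 * ennreal ((norm (fst w - snd w))\<^sup>2) \<partial>\<Lambda> n x)"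
        using \<Lambda>(5)[of n]
      proof (eventually_elim, intro nn_integral_mono_AE)
        fix x :: 'a assume "AE z in \<Lambda> n x. dist x (fst z) < \<delta> n"
        then show "AE w in \<Lambda> n x. ennreal ((norm (x - snd w))\<^sup>2) \<le> ennreal (2 * (\<delta> n)\<^sup>2) + 2 * ennreal ((norm (fst w - snd w))\<^sup>2)"
        proof eventually_elim
          case (elim w)
          have "(norm (x - fst w))\<^sup>2 \<le> (\<delta> n)\<^sup>2" using elim by (intro power_mono) (auto simp: dist_norm)
          then have "(norm (x - snd w))\<^sup>2 \<le> 2 * (\<delta> n)\<^sup>2 + 2 * (norm (fst w - snd w))\<^sup>2"
            using sq_norm_diff_le[of "x - fst w" "snd w - fst w"] by (simp add: norm_minus_commute)
          then have "ennreal ((norm (x - snd w))\<^sup>2) \<le> ennreal (2 * (\<delta> n)\<^sup>2 + 2 * (norm (fst w - snd w))\<^sup>2)"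
            by (rule ennreal_leI)
          then show ?case by (simp add: ennreal_mult)
        qed
      qed
    qed
    also have "\<dots> = (\<integral>\<^sup>+w. ennreal (2 * (\<delta> n)\<^sup>2) + 2 * ennreal ((norm (fst w - snd w))\<^sup>2) \<partial>\<gamma> n)"
      by (rule \<Lambda>(4)) measurable
    also have "\<dots> = ennreal (2 * (\<delta> n)\<^sup>2) + 2 * sqcost (\<gamma> n)"
    proof -
      note [measurable_cong] = couplings_D(1)[OF \<gamma>(1)[of n]]
      show ?thesis
        using prob_space.emeasure_space_1[OF couplings_D(2)[OF \<gamma>(1)[of n]]]
        by (subst nn_integral_add) (auto simp: nn_integral_cmult)
    qed
    also have "\<dots> \<le> ennreal (2 * (\<delta> n)\<^sup>2) + 2 * ennreal ((\<delta> n)\<^sup>2)"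
      by (intro add_mono mult_left_mono \<gamma>) auto
    also have "\<dots> = ennreal (2 * (\<delta> n)\<^sup>2) + ennreal (2 * (\<delta> n)\<^sup>2)" by (simp add: ennreal_mult)
    also have "\<dots> = ennreal (4 * (\<delta> n)\<^sup>2)" by (subst ennreal_plus[symmetric]) auto
    finally show ?thesis .
  qed
  \<comment> \<open>The weight 4^n balances two demands: the expected n-th term is at most 4 *
    (1/4)^n, hence summable, and a finite value of S forces the n-th step below sqrt S * (1/2)^n,
    hence convergence of the path.\<close>
  define S where "S \<omega> = (\<Sum>n. ennreal (4^n * (norm (\<omega> n - \<omega> (Suc n)))\<^sup>2))" for \<omega> :: "nat \<Rightarrow> 'a"
  have [measurable]: "S \<in> borel_measurable \<Omega>" unfolding S_def by measurable
  have S_fin: "(\<integral>\<^sup>+\<omega>. S \<omega> \<partial>\<Omega>) < \<infinity>"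
  proof -
    have "(\<integral>\<^sup>+\<omega>. S \<omega> \<partial>\<Omega>) = (\<Sum>n. \<integral>\<^sup>+\<omega>. ennreal (4^n * (norm (\<omega> n - \<omega> (Suc n)))\<^sup>2) \<partial>\<Omega>)"
      unfolding S_def by (rule nn_integral_suminf) measurable
    also have "\<dots> \<le> (\<Sum>n. ennreal (4 * (1/4)^n))"
    proof (rule suminf_le)
      fix n
      have "(\<integral>\<^sup>+\<omega>. ennreal (4^n * (norm (\<omega> n - \<omega> (Suc n)))\<^sup>2) \<partial>\<Omega>) = ennreal (4^n) * (\<integral>\<^sup>+\<omega>. ennreal ((norm (\<omega> n - \<omega> (Suc n)))\<^sup>2) \<partial>\<Omega>)"
        by (simp add: ennreal_mult nn_integral_cmult)
      also have "\<dots> \<le> ennreal (4^n) * ennreal (4 * (\<delta> n)\<^sup>2)" by (intro mult_left_mono cost) auto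
      also have "\<dots> = ennreal (4^n * (4 * (\<delta> n)\<^sup>2))" by (simp add: ennreal_mult)
      also have "4^n * (4 * (\<delta> n)\<^sup>2) = 4 * (1/4)^n"
        by (simp add: \<delta>_def power2_eq_square power_divide)
      finally show "(\<integral>\<^sup>+\<omega>. ennreal (4^n * (norm (\<omega> n - \<omega> (Suc n)))\<^sup>2) \<partial>\<Omega>) \<le> ennreal (4 * (1/4)^n)" .
    qed auto
    also have "\<dots> < \<infinity>"
    proof -
      have "summable (\<lambda>n. 4 * (1/4)^n :: real)" by (intro summable_mult summable_geometric) simp
      then show ?thesis by (simp add: suminf_ennreal2 less_top[symmetric])
    qed
    finally show ?thesis .
  qed
  have term_le: "a k \<le> suminf a" for a :: "nat \<Rightarrow> ennreal" and k
    using sum_le_suminf[of a "{k}"] by simp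
  define E where "E = enn2real (\<integral>\<^sup>+\<omega>. S \<omega> \<partial>\<Omega>)"
  have E: "ennreal E = (\<integral>\<^sup>+\<omega>. S \<omega> \<partial>\<Omega>)" "0 \<le> E" using S_fin by (auto simp: E_def less_top)
  \<comment> \<open>\<open>lim\<close> is total, so Y is defined and measurable on all paths,
    including the null set of those that diverge.\<close>
  define Y where "Y \<omega> = lim \<omega>" for \<omega> :: "nat \<Rightarrow> 'a"
  have [measurable]: "Y \<in> \<Omega> \<rightarrow>\<^sub>M borel" unfolding Y_def by (rule borel_measurable_lim_metric) measurable
  have dist_Y: "AE \<omega> in \<Omega>. ennreal ((norm (\<omega> n - Y \<omega>))\<^sup>2) \<le> ennreal (4 * (1/4)^n) * S \<omega>" for n
  proof -
    have "AE \<omega> in \<Omega>. S \<omega> \<noteq> \<infinity>" using S_fin by (intro nn_integral_noteq_infinite) auto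
    then show ?thesis
    proof eventually_elim
      case (elim \<omega>)
      define s where "s = enn2real (S \<omega>)"
      have s: "S \<omega> = ennreal s" "0 \<le> s" using elim by (auto simp: s_def less_top)
      have "norm (\<omega> k - \<omega> (Suc k)) \<le> sqrt s * (1/2)^k" for k
      proof -
        have "ennreal (4^k * (norm (\<omega> k - \<omega> (Suc k)))\<^sup>2) \<le> S \<omega>"
          unfolding S_def by (rule term_le)
        then have "4^k * (norm (\<omega> k - \<omega> (Suc k)))\<^sup>2 \<le> s" using s by simp
        moreover have "4^k * (norm (\<omega> k - \<omega> (Suc k)))\<^sup>2 = (2^k * norm (\<omega> k - \<omega> (Suc k)))\<^sup>2"
        proof -
          have "(4::real)^k = (2^k)\<^sup>2" by (simp add: power2_eq_square power_mult_distrib[symmetric])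
          then show ?thesis by (simp add: power_mult_distrib)
        qed
        ultimately have "2^k * norm (\<omega> k - \<omega> (Suc k)) \<le> sqrt s" by (simp add: real_le_rsqrt)
        then show ?thesis by (simp add: field_simps power_divide)
      qed
      from geometric_steps_converge(2)[of \<omega>, OF this] have "norm (\<omega> n - Y \<omega>) \<le> 2 * sqrt s * (1/2)^n" by (simp add: Y_def)
      then have "(norm (\<omega> n - Y \<omega>))\<^sup>2 \<le> (2 * sqrt s * (1/2)^n)\<^sup>2" by (intro power_mono) auto
      also have "\<dots> = 4 * (1/4)^n * s"
      proof -
        have "((1/2::real)^n)\<^sup>2 = (1/4)^n" by (simp add: power2_eq_square power_mult_distrib[symmetric])
        then show ?thesis using s by (simp add: power_mult_distrib)
      qed
      finally have "ennreal ((norm (\<omega> n - Y \<omega>))\<^sup>2) \<le> ennreal (4 * (1/4)^n * s)" by (rule ennreal_leI)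
      also have "\<dots> = ennreal (4 * (1/4)^n) * S \<omega>" using s by (simp add: ennreal_mult)
      finally show ?case .
    qed
  qed
  have cost_Y: "(\<integral>\<^sup>+\<omega>. ennreal ((norm (\<omega> n - Y \<omega>))\<^sup>2) \<partial>\<Omega>) \<le> ennreal ((2 * sqrt E * (1/2)^n)\<^sup>2)" for n
  proof -
    have "(\<integral>\<^sup>+\<omega>. ennreal ((norm (\<omega> n - Y \<omega>))\<^sup>2) \<partial>\<Omega>) \<le> (\<integral>\<^sup>+\<omega>. ennreal (4 * (1/4)^n) * S \<omega> \<partial>\<Omega>)"
      by (rule nn_integral_mono_AE[OF dist_Y])
    also have "\<dots> = ennreal (4 * (1/4)^n) * ennreal E" unfolding E by (rule nn_integral_cmult) measurable
    also have "\<dots> = ennreal (4 * (1/4)^n * E)" using E(2) by (simp add: ennreal_mult)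
    also have "4 * (1/4)^n * E = (2 * sqrt E * (1/2)^n)\<^sup>2"
    proof -
      have "((1/2::real)^n)\<^sup>2 = (1/4)^n" by (simp add: power2_eq_square power_mult_distrib[symmetric])
      then show ?thesis using E by (simp add: power_mult_distrib)
    qed
    finally show ?thesis .
  qed
  define \<mu>' where "\<mu>' = distr \<Omega> borel Y"
  have law_X: "distr \<Omega> borel (\<lambda>\<omega>. \<omega> n) = \<mu> n" for n
  proof (rule measure_eqI)
    fix A assume "A \<in> sets (distr \<Omega> borel (\<lambda>\<omega>. \<omega> n))"
    then have [measurable]: "A \<in> sets borel" by simp
    have "emeasure (distr \<Omega> borel (\<lambda>\<omega>. \<omega> n)) A = (\<integral>\<^sup>+\<omega>. indicator A (\<omega> n) \<partial>\<Omega>)"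
      by (simp add: nn_integral_indicator[symmetric] nn_integral_distr del: nn_integral_indicator)
    also have "\<dots> = (\<integral>\<^sup>+x. indicator A x \<partial>\<mu> n)" by (rule law) measurable
    finally show "emeasure (distr \<Omega> borel (\<lambda>\<omega>. \<omega> n)) A = emeasure (\<mu> n) A" using P2_D(1)[OF P[of n]] by simp
  qed (simp add: P2_D(1)[OF P])
  \<comment> \<open>The joint law of the n-th state and the limit is itself a plan, so the L2
    distance on path space bounds \<open>W2\<close>.\<close>
  have coup: "distr \<Omega> borel (\<lambda>\<omega>. (\<omega> n, Y \<omega>)) \<in> couplings (\<mu> n) \<mu>'" for n
    unfolding couplings_def \<mu>'_def law_X[symmetric]
    by (simp add: \<Omega>.prob_space_distr distr_distr comp_def)
  have W: "W2 (\<mu> n) \<mu>' \<le> 2 * sqrt E * (1/2)^n" for n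
  proof (rule W2_leI[OF coup])
    show "sqcost (distr \<Omega> borel (\<lambda>\<omega>. (\<omega> n, Y \<omega>))) \<le> ennreal ((2 * sqrt E * (1/2)^n)\<^sup>2)"
      using cost_Y[of n] by (subst nn_integral_distr) auto
  qed (use E in simp)
  have "\<mu>' \<in> P2"
  proof (rule P2_I)
    have "(\<integral>\<^sup>+x. ennreal ((norm x)\<^sup>2) \<partial>\<mu>') = (\<integral>\<^sup>+\<omega>. ennreal ((norm (Y \<omega>))\<^sup>2) \<partial>\<Omega>)"
      unfolding \<mu>'_def by (subst nn_integral_distr) auto
    also have "\<dots> \<le> (\<integral>\<^sup>+\<omega>. 2 * ennreal ((norm (\<omega> 0))\<^sup>2) + 2 * ennreal ((norm (\<omega> 0 - Y \<omega>))\<^sup>2) \<partial>\<Omega>)"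
    proof (rule nn_integral_mono)
      fix \<omega> :: "nat \<Rightarrow> 'a"
      have "ennreal ((norm (Y \<omega>))\<^sup>2) \<le> ennreal (2 * (norm (\<omega> 0))\<^sup>2 + 2 * (norm (\<omega> 0 - Y \<omega>))\<^sup>2)"
        using sq_norm_diff_le[of "\<omega> 0" "\<omega> 0 - Y \<omega>"] by (intro ennreal_leI) simp
      then show "ennreal ((norm (Y \<omega>))\<^sup>2) \<le> 2 * ennreal ((norm (\<omega> 0))\<^sup>2) + 2 * ennreal ((norm (\<omega> 0 - Y \<omega>))\<^sup>2)"
        by (simp add: ennreal_mult)
    qed
    also have "\<dots> = 2 * (\<integral>\<^sup>+\<omega>. ennreal ((norm (\<omega> 0))\<^sup>2) \<partial>\<Omega>) + 2 * (\<integral>\<^sup>+\<omega>. ennreal ((norm (\<omega> 0 - Y \<omega>))\<^sup>2) \<partial>\<Omega>)"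
      by (subst nn_integral_add) (auto simp: nn_integral_cmult)
    also have "\<dots> < \<infinity>"
      using P2_nn_integral[OF P[of 0]] law[of "\<lambda>x. ennreal ((norm x)\<^sup>2)" 0] cost_Y[of 0]
      by (auto simp: ennreal_mult_less_top intro: le_less_trans)
    finally show "(\<integral>\<^sup>+x. ennreal ((norm x)\<^sup>2) \<partial>\<mu>') < \<infinity>" .
  qed (auto simp: \<mu>'_def \<Omega>.prob_space_distr)
  moreover have "(\<lambda>n. W2 (\<mu> n) \<mu>') \<longlonglongrightarrow> 0"
  proof (rule tendsto_sandwich)
    show "eventually (\<lambda>n. 0 \<le> W2 (\<mu> n) \<mu>') sequentially"
      using W2_nonneg[OF P \<open>\<mu>' \<in> P2\<close>] by simp
    show "eventually (\<lambda>n. W2 (\<mu> n) \<mu>' \<le> 2 * sqrt E * (1/2)^n) sequentially"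
      using W by simp
    have "(\<lambda>n. 2 * sqrt E * (1/2)^n) \<longlonglongrightarrow> 2 * sqrt E * 0"
      by (intro tendsto_mult tendsto_const LIMSEQ_realpow_zero) auto
    then show "(\<lambda>n. 2 * sqrt E * (1/2)^n) \<longlonglongrightarrow> 0" by simp
  qed simp
  ultimately show ?thesis using that by blast
qed

section \<open>Energy decay under the gradient inequality\<close>

text \<open>The scalar core, detached from measures: E is the energy gap, md the metric derivative,
  and g a majorant witnessing the absolute continuity of E.\<close>

locale dissipated_energy =
  fixes E md g :: "real \<Rightarrow> real" and c \<theta> :: real
  assumes E_nonneg: "0 \<le> t \<Longrightarrow> 0 \<le> E t"
    and E_decreasing: "0 \<le> s \<Longrightarrow> s \<le> t \<Longrightarrow> E t \<le> E s"
    and g: "0 \<le> s \<Longrightarrow> set_integrable lborel {s..t} g"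
    and E_ac: "0 \<le> s \<Longrightarrow> s \<le> t \<Longrightarrow> \<bar>E t - E s\<bar> \<le> (LINT x:{s..t}|lborel. g x)"
    and dissipation: "AE t in lborel. 0 < t \<longrightarrow> (E has_real_derivative - (md t)\<^sup>2) (at t)"
    and slope: "AE t in lborel. 0 < t \<longrightarrow> 0 < E t \<longrightarrow> c * E t powr (1 - \<theta>) \<le> md t"
    and md_integrable: "0 \<le> s \<Longrightarrow> set_integrable lborel {s..t} md"
    and md_nonneg: "AE t in lborel. 0 < t \<longrightarrow> 0 \<le> md t"
    and c: "0 < c" and \<theta>: "0 < \<theta>" "\<theta> \<le> 1"
begin

text \<open>While E > 0, the time derivative of this quantity is - E^(\<theta>-1) md^2 / c, which is
  at most - md by the slope bound. It therefore bounds the length still to be travelled after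
  t.\<close>

definition remaining_length :: "real \<Rightarrow> real" where
  "remaining_length t = E t powr \<theta> / (c * \<theta>)"

lemma remaining_length_nonneg: "0 \<le> remaining_length t"
  unfolding remaining_length_def using c \<theta> by simp

lemma set_integrable_const: "set_integrable lborel {0..t :: real} (\<lambda>_. k :: real)"
  unfolding set_integrable_def
  by (intro integrable_scaleR_left integrable_real_indicator) (auto simp: emeasure_lborel_Icc_eq)

text \<open>By dissipation the derivative of \<psi> (E x) is - \<psi>' (E x) md^2, so the last
  hypothesis says that it is at most w. Positivity of E and the slope bound are at hand where this
  is checked.\<close>

lemma compare:
  assumes "0 \<le> s" "s \<le> t" "0 < E t"
    and \<psi>: "\<And>y. 0 < y \<Longrightarrow> (\<psi> has_real_derivative \<psi>' y) (at y)" "continuous_on {0<..} \<psi>'"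
    and w: "set_integrable lborel {s..t} w"
    and le: "\<And>x. s < x \<Longrightarrow> x < t \<Longrightarrow> 0 < E x \<Longrightarrow> c * E x powr (1 - \<theta>) \<le> md x \<Longrightarrow> - w x \<le> \<psi>' (E x) * (md x)\<^sup>2"
  shows "\<psi> (E t) - \<psi> (E s) \<le> (LINT x:{s..t}|lborel. w x)"
proof (rule comparison_along_decreasing[where e' = "\<lambda>x. - (md x)\<^sup>2" and E = E and g = g and w = w
      and \<psi> = \<psi> and \<psi>' = \<psi>' and s = s and t = t])
  show "AE x in lborel. s < x \<longrightarrow> x < t \<longrightarrow> (E has_real_derivative - (md x)\<^sup>2) (at x)"
    using dissipation by eventually_elim (use assms(1) in auto)
  show "AE x in lborel. s < x \<longrightarrow> x < t \<longrightarrow> \<psi>' (E x) * - (md x)\<^sup>2 \<le> w x"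
    using slope
  proof (eventually_elim, intro impI)
    fix x assume A: "0 < x \<longrightarrow> 0 < E x \<longrightarrow> c * E x powr (1 - \<theta>) \<le> md x" "s < x" "x < t"
    then have "0 < E x" using E_decreasing[of x t] assms(1,3) by simp
    then show "\<psi>' (E x) * - (md x)\<^sup>2 \<le> w x" using A le[of x] assms(1) by simp
  qed
qed (use assms E_decreasing E_ac g in auto)

lemma length_le_remaining_pos:
  assumes "0 \<le> s" "s \<le> t" "0 < E t"
  shows "(LINT x:{s..t}|lborel. md x) \<le> remaining_length s - remaining_length t"
proof -
  have "remaining_length t - remaining_length s \<le> (LINT x:{s..t}|lborel. - md x)"
    unfolding remaining_length_def
  proof (rule compare[OF assms, where \<psi> = "\<lambda>y. y powr \<theta> / (c * \<theta>)" and \<psi>' = "\<lambda>y. y powr (\<theta> - 1) / c"])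
    show "((\<lambda>y. y powr \<theta> / (c * \<theta>)) has_real_derivative y powr (\<theta> - 1) / c) (at y)" if "0 < y" for y
      using that c \<theta> by (auto intro!: derivative_eq_intros)
    show "continuous_on {0<..} (\<lambda>y. y powr (\<theta> - 1) / c)"
      using c by (intro continuous_intros) auto
    show "set_integrable lborel {s..t} (\<lambda>x. - md x)"
      using md_integrable[OF assms(1), of t] unfolding set_integrable_def by simp
    fix x assume x: "0 < E x" "c * E x powr (1 - \<theta>) \<le> md x"
    then have "0 < md x" using c by (smt (verit) mult_pos_pos powr_gt_zero)
    then have "c * E x powr (1 - \<theta>) * md x \<le> md x * md x" using x by (intro mult_right_mono) auto
    then have "(E x powr (\<theta> - 1) / c) * (c * E x powr (1 - \<theta>) * md x) \<le> (E x powr (\<theta> - 1) / c) * (md x * md x)"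
      using c by (intro mult_left_mono) auto
    moreover have "E x powr (\<theta> - 1) * E x powr (1 - \<theta>) = 1"
      using x(1) by (simp add: powr_add[symmetric])
    then have "(E x powr (\<theta> - 1) / c) * (c * E x powr (1 - \<theta>) * md x) = md x" using c by (simp add: mult.assoc[symmetric])
    ultimately show "- (- md x) \<le> E x powr (\<theta> - 1) / c * (md x)\<^sup>2" by (simp add: power2_eq_square)
  qed
  also have "(LINT x:{s..t}|lborel. - md x) = - (LINT x:{s..t}|lborel. md x)"
    by (simp add: set_lebesgue_integral_def)
  finally show ?thesis by simp
qed

text \<open>Where E vanishes on an interval its derivative is 0, and the dissipation identity forces
  md = 0 almost everywhere.\<close>

lemma length_zero:
  assumes "0 \<le> s" "\<And>x. s < x \<Longrightarrow> x < t \<Longrightarrow> E x = 0"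
  shows "(LINT x:{s..t}|lborel. md x) = 0"
proof -
  have "AE x in lborel. x \<noteq> s" "AE x in lborel. x \<noteq> t" by (rule AE_lborel_singleton)+
  with dissipation have "AE x in lborel. indicator {s..t} x *\<^sub>R md x = 0"
  proof eventually_elim
    case (elim x)
    show ?case
    proof (cases "s < x \<and> x < t")
      case True
      have "((\<lambda>_. 0) has_real_derivative - (md x)\<^sup>2) (at x)"
      proof (rule has_field_derivative_transform_within_open)
        show "(E has_real_derivative - (md x)\<^sup>2) (at x)" using elim True assms(1) by simp
        show "E y = 0" if "y \<in> {s<..<t}" for y using assms(2) that by simp
      qed (use True in auto)
      then have "- (md x)\<^sup>2 = 0" by (rule DERIV_unique) simp
      then show ?thesis by simp
    qed (use elim in \<open>auto simp: indicator_def\<close>)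
  qed
  then show ?thesis unfolding set_lebesgue_integral_def by (rule integral_eq_zero_AE)
qed

lemma length_combine:
  assumes "0 \<le> r" "r \<le> s" "s \<le> t"
  shows "(LINT x:{r..s}|lborel. md x) + (LINT x:{s..t}|lborel. md x) = (LINT x:{r..t}|lborel. md x)"
  using set_borel_integral_eq_integral[OF md_integrable] assms
  by (simp add: Henstock_Kurzweil_Integration.integral_combine)

text \<open>If the gap has vanished by time t, the interval is split at the supremum T0 of the times
  with positive gap. Up to T0 the bound follows from earlier times by continuity of the length, and
  after T0 the curve is at rest.\<close>

lemma length_le_remaining:
  assumes "0 \<le> s" "s \<le> t"
  shows "(LINT x:{s..t}|lborel. md x) \<le> remaining_length s - remaining_length t"
proof (cases "0 < E t")
  case True
  then show ?thesis using length_le_remaining_pos assms by blast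
next
  case False
  then have Et: "E t = 0" "remaining_length t = 0" using E_nonneg[of t] assms by (auto simp: remaining_length_def)
  define A where "A x = (LINT y:{s..x}|lborel. md y)" for x
  have A_eq: "A x = integral {s..x} md" for x
    unfolding A_def by (rule set_borel_integral_eq_integral(2)[OF md_integrable[OF assms(1)]])
  have contA: "continuous_on {s..t} A"
    unfolding A_eq using set_borel_integral_eq_integral(1)[OF md_integrable[OF assms(1)]]
    by (intro indefinite_integral_continuous_1)
  let ?S = "{x \<in> {s..t}. 0 < E x}"
  show ?thesis
  proof (cases "?S = {}")
    case True
    have "E x = 0" if "s < x" "x < t" for x
    proof -
      have "x \<notin> ?S" using True by blast
      then have "\<not> 0 < E x" using that by simp
      then show ?thesis using E_nonneg[of x] that assms(1) by simp
    qed
    then have "(LINT x:{s..t}|lborel. md x) = 0" by (intro length_zero assms) auto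
    then show ?thesis using Et remaining_length_nonneg[of s] by simp
  next
    case False
    define T0 where "T0 = Sup ?S"
    have bdd: "bdd_above ?S" by (rule bdd_aboveI[of _ t]) auto
    \<comment> \<open>T0 need not belong to ?S, so the bound is extended to the closure, which
      contains the supremum.\<close>
    have "closed {x \<in> {s..t}. A x \<le> remaining_length s}"
      by (rule continuous_on_closed_Collect_le[OF contA continuous_on_const]) simp
    moreover have "?S \<subseteq> {x \<in> {s..t}. A x \<le> remaining_length s}"
    proof
      fix x assume x: "x \<in> ?S"
      then have "A x \<le> remaining_length s - remaining_length x"
        unfolding A_def using assms by (intro length_le_remaining_pos) auto
      then show "x \<in> {x \<in> {s..t}. A x \<le> remaining_length s}" using x remaining_length_nonneg[of x] by simp
    qed
    ultimately have "closure ?S \<subseteq> {x \<in> {s..t}. A x \<le> remaining_length s}" by (rule closure_minimal[rotated])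
    then have T0: "s \<le> T0" "T0 \<le> t" "A T0 \<le> remaining_length s"
      unfolding T0_def using closure_contains_Sup[OF False bdd] by auto
    have "E x = 0" if "T0 < x" "x < t" for x
    proof (rule ccontr)
      assume "E x \<noteq> 0"
      then have "x \<in> ?S" using that T0 assms E_nonneg[of x] by auto
      then have "x \<le> T0" unfolding T0_def using bdd by (rule cSup_upper)
      then show False using that by simp
    qed
    then have "(LINT x:{T0..t}|lborel. md x) = 0" using T0 assms by (intro length_zero) auto
    then show ?thesis using length_combine[of s T0 t] T0 assms Et by (simp add: A_def)
  qed
qed

section \<open>Decay rates of the energy gap\<close>

text \<open>Separation of variables in E' \<le> - c^2 E^(2 - 2 \<theta>). The primitive \<psi> will
  be y^k / k with k = 2 \<theta> - 1, or ln when \<theta> = 1/2.\<close>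

lemma rate:
  assumes "0 \<le> t" "0 < E t"
    and \<psi>: "\<And>y. 0 < y \<Longrightarrow> (\<psi> has_real_derivative y powr (2 * \<theta> - 2)) (at y)"
  shows "\<psi> (E t) \<le> \<psi> (E 0) - c\<^sup>2 * t"
proof -
  have "\<psi> (E t) - \<psi> (E 0) \<le> (LINT x:{0..t}|lborel. - c\<^sup>2)"
  proof (rule compare[OF order_refl assms(1,2) \<psi>])
    show "continuous_on {0<..} (\<lambda>y::real. y powr (2 * \<theta> - 2))" by (intro continuous_intros) auto
    show "set_integrable lborel {0..t} (\<lambda>x. - c\<^sup>2)" by (rule set_integrable_const)
    fix x assume x: "0 < E x" "c * E x powr (1 - \<theta>) \<le> md x"
    have "(c * E x powr (1 - \<theta>))\<^sup>2 \<le> (md x)\<^sup>2" using x c by (intro power_mono) auto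
    then have "E x powr (2 * \<theta> - 2) * (c * E x powr (1 - \<theta>))\<^sup>2 \<le> E x powr (2 * \<theta> - 2) * (md x)\<^sup>2"
      by (intro mult_left_mono) auto
    moreover have "E x powr (2 * \<theta> - 2) * (E x powr (1 - \<theta>))\<^sup>2 = 1"
      using x(1) by (simp add: power2_eq_square powr_add[symmetric])
    then have "E x powr (2 * \<theta> - 2) * (c * E x powr (1 - \<theta>))\<^sup>2 = c\<^sup>2" by (simp add: power_mult_distrib mult.left_commute)
    ultimately show "- (- c\<^sup>2) \<le> E x powr (2 * \<theta> - 2) * (md x)\<^sup>2" by simp
  qed
  also have "(LINT x:{0..t}|lborel. - c\<^sup>2) = - c\<^sup>2 * t"
    using assms(1) by (simp add: set_lebesgue_integral_def)
  finally show ?thesis by simp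
qed

text \<open>While E stays at least e, it is dissipated at rate at least k = c^2 e^(2 - 2 \<theta>),
  which would exhaust it in finite time. The argument is uniform in \<theta>.\<close>

lemma E_tendsto_0: "(E \<longlongrightarrow> 0) at_top"
proof -
  have ex: "\<exists>T\<ge>0. E T < e" if e: "0 < e" for e
  proof (rule ccontr)
    assume "\<not> ?thesis"
    then have ge: "e \<le> E t" if "0 \<le> t" for t using that by force
    define k where "k = c\<^sup>2 * e powr (2 - 2 * \<theta>)"
    have k: "0 < k" using c e by (simp add: k_def)
    \<comment> \<open>At this time the loss k * t = E 0 + 1 exceeds the initial gap.\<close>
    define t where "t = (E 0 + 1) / k"
    have t: "0 \<le> t" using k E_nonneg[of 0] by (simp add: t_def)
    have "E t - E 0 \<le> (LINT x:{0..t}|lborel. - k)"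
    proof (rule compare[where \<psi> = "\<lambda>y. y" and \<psi>' = "\<lambda>_. 1"])
      show "0 < E t" using ge[OF t] e by simp
      show "set_integrable lborel {0..t} (\<lambda>x. - k)" by (rule set_integrable_const)
      fix x assume x: "0 < x" "c * E x powr (1 - \<theta>) \<le> md x"
      have "c * e powr (1 - \<theta>) \<le> c * E x powr (1 - \<theta>)"
        using ge[of x] x c e \<theta> by (intro mult_left_mono powr_mono2) auto
      from this x(2) have "c * e powr (1 - \<theta>) \<le> md x" by (rule order_trans)
      then have "(c * e powr (1 - \<theta>))\<^sup>2 \<le> (md x)\<^sup>2" by (rule power_mono) (use c in simp)
      moreover have "(c * e powr (1 - \<theta>))\<^sup>2 = k"
        using e by (simp add: k_def power_mult_distrib power2_eq_square powr_add[symmetric])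
      ultimately show "- (- k) \<le> 1 * (md x)\<^sup>2" by simp
    qed (use t in auto)
    also have "\<dots> = - (E 0 + 1)" using t k by (simp add: set_lebesgue_integral_def t_def)
    finally show False using E_nonneg[OF t] by simp
  qed
  show ?thesis
  proof (rule tendstoI)
    fix e :: real assume "0 < e"
    then obtain T where T: "0 \<le> T" "E T < e" using ex by blast
    show "eventually (\<lambda>t. dist (E t) 0 < e) at_top"
      using eventually_ge_at_top[of T]
    proof eventually_elim
      case (elim t)
      then show ?case using E_decreasing[OF T(1) elim] E_nonneg[of t] T by simp
    qed
  qed
qed

lemma remaining_length_tendsto_0: "(remaining_length \<longlongrightarrow> 0) at_top"
proof -
  have "((\<lambda>t. E t powr \<theta> / (c * \<theta>)) \<longlongrightarrow> 0 powr \<theta> / (c * \<theta>)) at_top"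
  proof (intro tendsto_intros tendsto_powr' E_tendsto_0)
    have "\<forall>\<^sub>F t in at_top. 0 \<le> E t"
      using eventually_ge_at_top[of 0] by eventually_elim (rule E_nonneg)
    then show "0 \<noteq> (0::real) \<or> 0 < \<theta> \<and> (\<forall>\<^sub>F t in at_top. 0 \<le> E t)" using \<theta> by simp
  qed (use c \<theta> in auto)
  then show ?thesis by (simp add: remaining_length_def[abs_def])
qed

lemma remaining_length_mono:
  "0 \<le> E t \<Longrightarrow> E t \<le> y \<Longrightarrow> remaining_length t \<le> 1 / (c * \<theta>) * y powr \<theta>"
  unfolding remaining_length_def using c \<theta> by (simp add: divide_right_mono powr_mono2)

text \<open>The case \<open>E 0 = 0\<close> is set apart because
  \<open>0 powr (2 * \<theta> - 1)\<close> evaluates to 0 and not to the +infinity of the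
  convention. The bound on the remaining length is the \<theta>-th power of the energy bound,
  divided by c \<theta>.\<close>

lemma rate_sublinear:
  assumes "\<theta> < 1/2" "0 \<le> t" "E 0 \<noteq> 0"
  defines "B \<equiv> E 0 powr (2 * \<theta> - 1) + c\<^sup>2 * (1 - 2 * \<theta>) * t"
  shows "E t \<le> B powr (- 1 / (1 - 2 * \<theta>))" "remaining_length t \<le> 1 / (c * \<theta>) * B powr (- \<theta> / (1 - 2 * \<theta>))"
proof -
  define k where "k = 2 * \<theta> - 1"
  have k: "k < 0" "1 - 2 * \<theta> = - k" "2 * \<theta> - 2 = k - 1" using assms(1) by (auto simp: k_def)
  have E0: "0 < E 0" using assms(3) E_nonneg[of 0] by simp
  have B: "B = E 0 powr k - c\<^sup>2 * k * t" by (simp add: B_def k_def algebra_simps)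
  have Bpos: "0 < B"
  proof -
    have "0 < E 0 powr k" using E0 by simp
    moreover have "c\<^sup>2 * k * t \<le> 0" using k(1) assms(2) by (intro mult_nonpos_nonneg mult_nonneg_nonpos) auto
    ultimately show ?thesis unfolding B by linarith
  qed
  show 1: "E t \<le> B powr (- 1 / (1 - 2 * \<theta>))"
  proof (cases "E t = 0")
    case False
    then have Et: "0 < E t" using E_nonneg[OF assms(2)] by simp
    have "E t powr k / k \<le> E 0 powr k / k - c\<^sup>2 * t"
    proof (rule rate[OF assms(2) Et])
      show "((\<lambda>y. y powr k / k) has_real_derivative y powr (2 * \<theta> - 2)) (at y)" if "0 < y" for y
        unfolding k(3) using that k(1) by (auto intro!: derivative_eq_intros)
    qed
    \<comment> \<open>Multiplication by the negative k reverses the inequality, and the antitone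
      power 1/k reverses it once more.\<close>
    then have "(E 0 powr k / k - c\<^sup>2 * t) * k \<le> E t powr k / k * k" using k(1) by (intro mult_right_mono_neg) auto
    then have "B \<le> E t powr k" using k(1) by (simp add: B left_diff_distrib mult.assoc mult.commute[of k])
    then have "(E t powr k) powr (1 / k) \<le> B powr (1 / k)" using Bpos k(1) by (intro powr_mono2') auto
    moreover have "(E t powr k) powr (1 / k) = E t" using Et k(1) by (simp add: powr_powr)
    moreover have "- 1 / (1 - 2 * \<theta>) = 1 / k" by (simp add: k)
    ultimately show ?thesis by simp
  qed simp
  have "remaining_length t \<le> 1 / (c * \<theta>) * (B powr (- 1 / (1 - 2 * \<theta>))) powr \<theta>"
    by (rule remaining_length_mono[OF E_nonneg[OF assms(2)] 1])
  then show "remaining_length t \<le> 1 / (c * \<theta>) * B powr (- \<theta> / (1 - 2 * \<theta>))" by (simp add: powr_powr)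
qed

text \<open>Here the primitive is \<open>ln\<close>, the prefactor 1/(c \<theta>) becomes 2/c, and
  the square root of the energy bound halves the exponent.\<close>

lemma rate_exponential:
  assumes "\<theta> = 1/2" "0 \<le> t"
  shows "E t \<le> E 0 * exp (- (c\<^sup>2 * t))" "remaining_length t \<le> 2 / c * sqrt (E 0) * exp (- (c\<^sup>2 * t / 2))"
proof -
  show 1: "E t \<le> E 0 * exp (- (c\<^sup>2 * t))"
  proof (cases "E t = 0")
    case False
    then have Et: "0 < E t" using E_nonneg[OF assms(2)] by simp
    then have E0: "0 < E 0" using E_decreasing[of 0 t] assms(2) by simp
    have "ln (E t) \<le> ln (E 0) - c\<^sup>2 * t"
    proof (rule rate[OF assms(2) Et])
      show "(ln has_real_derivative y powr (2 * \<theta> - 2)) (at y)" if "0 < y" for y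
      proof -
        have "2 * \<theta> - 2 = - 1" using assms(1) by simp
        then have "y powr (2 * \<theta> - 2) = 1 / y" using that by (simp only: powr_minus_divide) simp
        then show ?thesis using DERIV_ln_divide[OF that] by simp
      qed
    qed
    then have "exp (ln (E t)) \<le> exp (ln (E 0) - c\<^sup>2 * t)" by simp
    then show ?thesis using Et E0 by (simp add: exp_diff exp_minus field_simps)
  qed (use E_nonneg[of 0] in simp)
  have "remaining_length t \<le> 1 / (c * \<theta>) * (E 0 * exp (- (c\<^sup>2 * t))) powr \<theta>"
    by (rule remaining_length_mono[OF E_nonneg[OF assms(2)] 1])
  also have "(E 0 * exp (- (c\<^sup>2 * t))) powr \<theta> = sqrt (E 0) * sqrt (exp (- (c\<^sup>2 * t)))"
    using E_nonneg[of 0] by (simp add: assms(1) powr_half_sqrt real_sqrt_mult)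
  also have "sqrt (exp (- (c\<^sup>2 * t))) = exp (- (c\<^sup>2 * t / 2))"
    by (rule real_sqrt_unique) (auto simp: power2_eq_square exp_add[symmetric])
  finally have "remaining_length t \<le> 1 / (c * \<theta>) * (sqrt (E 0) * exp (- (c\<^sup>2 * t / 2)))" .
  moreover have "1 / (c * \<theta>) = 2 / c" unfolding assms(1) by simp
  ultimately show "remaining_length t \<le> 2 / c * sqrt (E 0) * exp (- (c\<^sup>2 * t / 2))"
    by (simp only: mult.assoc)
qed

text \<open>B may turn negative after extinction; the bounds survive because then E t = 0 and
  \<open>powr\<close> is never negative. Conversely a positive gap forces B > 0, which is the source
  of the finite extinction time.\<close>

lemma rate_superlinear:
  assumes "1/2 < \<theta>" "0 \<le> t"
  defines "B \<equiv> E 0 powr (2 * \<theta> - 1) - c\<^sup>2 * (2 * \<theta> - 1) * t"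
  shows "0 < E t \<Longrightarrow> 0 < B"
    "E t \<le> B powr (1 / (2 * \<theta> - 1))" "remaining_length t \<le> 1 / (c * \<theta>) * B powr (\<theta> / (2 * \<theta> - 1))"
proof -
  define k where "k = 2 * \<theta> - 1"
  have k: "0 < k" "2 * \<theta> - 2 = k - 1" using assms(1) by (auto simp: k_def)
  have B: "B = E 0 powr k - c\<^sup>2 * k * t" by (simp add: B_def k_def)
  have *: "E t powr k \<le> B" if Et: "0 < E t"
  proof -
    have "E t powr k / k \<le> E 0 powr k / k - c\<^sup>2 * t"
    proof (rule rate[OF assms(2) Et])
      show "((\<lambda>y. y powr k / k) has_real_derivative y powr (2 * \<theta> - 2)) (at y)" if "0 < y" for y
        unfolding k(2) using that k(1) by (auto intro!: derivative_eq_intros)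
    qed
    then have "E t powr k / k * k \<le> (E 0 powr k / k - c\<^sup>2 * t) * k" using k(1) by (intro mult_right_mono) auto
    then show ?thesis using k(1) by (simp add: B left_diff_distrib mult.assoc mult.commute[of k])
  qed
  show "0 < B" if "0 < E t" using *[OF that] that by (smt (verit) powr_gt_zero)
  show 1: "E t \<le> B powr (1 / (2 * \<theta> - 1))"
  proof (cases "E t = 0")
    case False
    then have Et: "0 < E t" using E_nonneg[OF assms(2)] by simp
    have "(E t powr k) powr (1 / k) \<le> B powr (1 / k)" using *[OF Et] k(1) by (intro powr_mono2) auto
    moreover have "(E t powr k) powr (1 / k) = E t" using Et k(1) by (simp add: powr_powr)
    ultimately show ?thesis by (simp add: k_def)
  qed simp
  have "remaining_length t \<le> 1 / (c * \<theta>) * (B powr (1 / (2 * \<theta> - 1))) powr \<theta>"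
    by (rule remaining_length_mono[OF E_nonneg[OF assms(2)] 1])
  then show "remaining_length t \<le> 1 / (c * \<theta>) * B powr (\<theta> / (2 * \<theta> - 1))" by (simp add: powr_powr)
qed

lemma extinction:
  assumes "1/2 < \<theta>" "E 0 powr (2 * \<theta> - 1) / (c\<^sup>2 * (2 * \<theta> - 1)) \<le> t"
  shows "E t = 0"
proof (rule ccontr)
  let ?T = "E 0 powr (2 * \<theta> - 1) / (c\<^sup>2 * (2 * \<theta> - 1))"
  have k: "0 < c\<^sup>2 * (2 * \<theta> - 1)" using assms(1) c by simp
  then have T: "0 \<le> ?T" by simp
  then have t: "0 \<le> t" using assms(2) by linarith
  assume "E t \<noteq> 0"
  then have "0 < E t" using E_nonneg[OF t] by simp
  from rate_superlinear(1)[OF assms(1) t this] have "c\<^sup>2 * (2 * \<theta> - 1) * t < E 0 powr (2 * \<theta> - 1)" by simp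
  then have "t < ?T" using k by (simp add: pos_less_divide_eq mult.commute)
  then show False using assms(2) by simp
qed

text \<open>Monotone convergence over [0, n], each partial length being at most
  \<open>remaining_length 0\<close>.\<close>

lemma finite_total_length:
  assumes "set_borel_measurable lborel {0..} md"
  shows "set_integrable lborel {0..} md"
  unfolding set_integrable_def
proof (rule integrableI_bounded)
  have meas: "(\<lambda>x. indicator {0..} x *\<^sub>R md x) \<in> borel_measurable lborel"
    using assms by (simp add: set_borel_measurable_def)
  show "(\<lambda>x. indicator {0..} x *\<^sub>R md x) \<in> borel_measurable lborel" by (rule meas)
  have ms: "(\<lambda>x. ennreal (indicator {0..real n} x *\<^sub>R norm (md x))) \<in> borel_measurable lborel" for n
  proof -
    have "set_integrable lborel {0..real n} (\<lambda>x. \<bar>md x\<bar>)" by (rule set_integrable_abs[OF md_integrable]) simp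
    from borel_measurable_integrable[OF this[unfolded set_integrable_def]] show ?thesis by simp
  qed
  have SUPeq: "ennreal (norm (indicator {0..} x *\<^sub>R md x)) = (SUP n. ennreal (indicator {0..real n} x *\<^sub>R norm (md x)))" for x
  proof -
    obtain n where n: "x < real n" using reals_Archimedean2 by blast
    show ?thesis
    proof (rule antisym)
      show "ennreal (norm (indicator {0..} x *\<^sub>R md x)) \<le> (SUP n. ennreal (indicator {0..real n} x *\<^sub>R norm (md x)))"
        by (rule SUP_upper2[of n]) (use n in \<open>auto split: split_indicator\<close>)
      show "(SUP n. ennreal (indicator {0..real n} x *\<^sub>R norm (md x))) \<le> ennreal (norm (indicator {0..} x *\<^sub>R md x))"
        by (rule SUP_least) (auto split: split_indicator)
    qed
  qed
  have "(\<integral>\<^sup>+ x. ennreal (norm (indicator {0..} x *\<^sub>R md x)) \<partial>lborel) =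
      (SUP n. \<integral>\<^sup>+ x. ennreal (indicator {0..real n} x *\<^sub>R norm (md x)) \<partial>lborel)"
    unfolding SUPeq
  proof (rule nn_integral_monotone_convergence_SUP)
    show "incseq (\<lambda>n x. ennreal (indicator {0..real n} x *\<^sub>R norm (md x)))"
      by (auto simp: incseq_def le_fun_def split: split_indicator)
  qed (rule ms)
  also have "\<dots> \<le> ennreal (remaining_length 0)"
  proof (rule SUP_least)
    fix n
    \<comment> \<open>Nonnegativity of md is known only almost everywhere at positive times, so the
      norm is dropped almost everywhere and time 0 is discarded.\<close>
    have "AE x in lborel. x \<noteq> (0::real)" by (rule AE_lborel_singleton)
    with md_nonneg have ae: "AE x in lborel. indicator {0..real n} x *\<^sub>R norm (md x) = indicator {0..real n} x *\<^sub>R md x"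
    proof eventually_elim
      case (elim x)
      then show ?case by (cases "x \<in> {0..real n}") auto
    qed
    have "(\<integral>\<^sup>+ x. ennreal (indicator {0..real n} x *\<^sub>R norm (md x)) \<partial>lborel) = (\<integral>\<^sup>+ x. ennreal (indicator {0..real n} x *\<^sub>R md x) \<partial>lborel)"
      by (rule nn_integral_cong_AE) (use ae in \<open>auto elim!: eventually_mono\<close>)
    also have "\<dots> = ennreal (LINT x:{0..real n}|lborel. md x)"
      unfolding set_lebesgue_integral_def
    proof (rule nn_integral_eq_integral)
      show "integrable lborel (\<lambda>x. indicator {0..real n} x *\<^sub>R md x)"
        using md_integrable[of 0 "real n"] by (simp add: set_integrable_def)
      show "AE x in lborel. 0 \<le> indicator {0..real n} x *\<^sub>R md x"
        using ae by eventually_elim (metis abs_ge_zero indicator_pos_le real_norm_def scaleR_nonneg_nonneg)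
    qed
    also have "\<dots> \<le> ennreal (remaining_length 0)"
      using length_le_remaining[of 0 "real n"] remaining_length_nonneg[of "real n"] by (intro ennreal_leI) simp
    finally show "(\<integral>\<^sup>+ x. ennreal (indicator {0..real n} x *\<^sub>R norm (md x)) \<partial>lborel) \<le> ennreal (remaining_length 0)" .
  qed
  also have "\<dots> < \<infinity>" by simp
  finally show "(\<integral>\<^sup>+ x. ennreal (norm (indicator {0..} x *\<^sub>R md x)) \<partial>lborel) < \<infinity>" .
qed

end

section \<open>Convergence of the trajectory\<close>

text \<open>The alternative on \<open>E\<^sub>0 = 0\<close> encodes the convention of (i). In (iii)
  the value 0 of \<open>0 powr (2 * \<theta> - 1)\<close> is the right one: a trajectory starting at
  a minimiser has T = 0.\<close>

theorem theorem2:
  fixes J :: "'a::euclidean_space measure \<Rightarrow> ereal"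
    and lam Jhat \<theta> c\<^sub>g E\<^sub>0 :: real
    and r\<^sub>0 :: ereal
    and \<rho>\<^sub>0 :: "'a measure"
    and \<rho> :: "real \<Rightarrow> 'a measure"
  assumes not_minus_infty: "\<forall>\<mu>\<in>P2. J \<mu> \<noteq> -\<infinity>"
    and proper: "domJ J \<noteq> {}"
    and lsc: "W2_lsc J"
    and convex: "lambda_convex_gg lam J"
    and minimum: "\<exists>\<mu>. is_minimiser J \<mu> \<and> J \<mu> = ereal Jhat"
    and r0: "ereal Jhat < r\<^sub>0"
    and theta: "0 < \<theta>" "\<theta> \<le> 1"
    and cg: "c\<^sub>g > 0"
    and gradient_inequality:
      "\<forall>\<mu>\<in>P2. ereal Jhat < J \<mu> \<and> J \<mu> < r\<^sub>0 \<longrightarrow>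
         (\<forall>\<nu>\<in>subdiff lam J \<mu>. c\<^sub>g * (real_of_ereal (J \<mu>) - Jhat) powr (1 - \<theta>) \<le> L2_norm_on \<mu> \<nu>)"
    and initial: "\<rho>\<^sub>0 \<in> P2" "ereal Jhat \<le> J \<rho>\<^sub>0" "J \<rho>\<^sub>0 < r\<^sub>0"
    and solution: "subgradient_solution lam J \<rho>\<^sub>0 \<rho>"
    \<comment> \<open>Known facts on the subgradient dynamics (Ambrosio--Gigli--Savare)\<close>
    and energy_nonincreasing: "\<forall>s t. 0 \<le> s \<longrightarrow> s \<le> t \<longrightarrow> J (\<rho> t) \<le> J (\<rho> s)"
    and energy_abs_cont: "abs_cont_curve dist (\<lambda>t. real_of_ereal (J (\<rho> t)))"
    and energy_dissipation: "AE t in lborel. t > 0 \<longrightarrow>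
      ((\<lambda>s. real_of_ereal (J (\<rho> s))) has_real_derivative - (metric_deriv W2 \<rho> t)\<^sup>2) (at t)"
    and E0: "E\<^sub>0 = real_of_ereal (J \<rho>\<^sub>0) - Jhat"
  shows "finite_length W2 \<rho> \<and>
    (\<exists>\<rho>inf. is_minimiser J \<rho>inf \<and> ((\<lambda>t. W2 (\<rho> t) \<rho>inf) \<longlongrightarrow> 0) at_top
      \<and> (\<theta> < 1/2 \<longrightarrow> (\<forall>t\<ge>0.
            J (\<rho> t) - ereal Jhat \<le> ereal (if E\<^sub>0 = 0 then 0 else
              (E\<^sub>0 powr (2 * \<theta> - 1) + c\<^sub>g\<^sup>2 * (1 - 2 * \<theta>) * t) powr (- 1 / (1 - 2 * \<theta>)))
          \<and> W2 (\<rho> t) \<rho>inf \<le> (if E\<^sub>0 = 0 then 0 else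
              1 / (c\<^sub>g * \<theta>) *
                (E\<^sub>0 powr (2 * \<theta> - 1) + c\<^sub>g\<^sup>2 * (1 - 2 * \<theta>) * t) powr (- \<theta> / (1 - 2 * \<theta>)))))
      \<and> (\<theta> = 1/2 \<longrightarrow> (\<forall>t\<ge>0.
            J (\<rho> t) - ereal Jhat \<le> ereal (E\<^sub>0 * exp (- (c\<^sub>g\<^sup>2 * t)))
          \<and> W2 (\<rho> t) \<rho>inf \<le> 2 / c\<^sub>g * sqrt E\<^sub>0 * exp (- (c\<^sub>g\<^sup>2 * t / 2))))
      \<and> (\<theta> > 1/2 \<longrightarrow> (let T = E\<^sub>0 powr (2 * \<theta> - 1) / (c\<^sub>g\<^sup>2 * (2 * \<theta> - 1)) in
            (\<exists>t\<^sub>f. 0 \<le> t\<^sub>f \<and> t\<^sub>f \<le> T \<and> (\<forall>t\<ge>t\<^sub>f. \<rho> t = \<rho>inf))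
          \<and> (\<forall>t\<in>{0..T}.
              J (\<rho> t) - ereal Jhat \<le> ereal
                ((E\<^sub>0 powr (2 * \<theta> - 1) - c\<^sub>g\<^sup>2 * (2 * \<theta> - 1) * t) powr (1 / (2 * \<theta> - 1)))
            \<and> W2 (\<rho> t) \<rho>inf \<le> 1 / (c\<^sub>g * \<theta>) *
                (E\<^sub>0 powr (2 * \<theta> - 1) - c\<^sub>g\<^sup>2 * (2 * \<theta> - 1) * t) powr (\<theta> / (2 * \<theta> - 1))))))"
proof -
  let ?md = "metric_deriv W2 \<rho>"
  define e where "e t = real_of_ereal (J (\<rho> t)) - Jhat" for t
  have P: "\<rho> t \<in> P2" if "0 \<le> t" for t using solution that by (simp add: subgradient_solution_def)
  have \<rho>_0: "\<rho> 0 = \<rho>\<^sub>0" and ac: "abs_cont_curve W2 \<rho>"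
    using solution by (simp_all add: subgradient_solution_def)
  obtain v where v: "tangent_velocity \<rho> v"
    "AE t in lborel. t > 0 \<longrightarrow> (\<lambda>x. - v t x) \<in> subdiff lam J (\<rho> t)"
    using solution unfolding subgradient_solution_def by blast
  obtain \<mu> where \<mu>: "is_minimiser J \<mu>" "J \<mu> = ereal Jhat" using minimum by blast
  have below_r0: "J (\<rho> t) < r\<^sub>0" if "0 \<le> t" for t
    using energy_nonincreasing[rule_format, of 0 t] that initial(3) \<rho>_0 by (simp add: le_less_trans)
  have J_ge: "ereal Jhat \<le> J (\<rho> t)" if "0 \<le> t" for t
    using \<mu> P[OF that] unfolding is_minimiser_def by metis
  \<comment> \<open>Lying strictly below the threshold excludes +infinity and the minimum excludes
    -infinity, so passing to reals loses nothing along the trajectory.\<close>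
  have J_eq: "J (\<rho> t) = ereal (e t + Jhat)" if "0 \<le> t" for t
    using J_ge[OF that] below_r0[OF that] by (cases "J (\<rho> t)") (auto simp: e_def)
  have e_nonneg: "0 \<le> e t" if "0 \<le> t" for t
    using J_ge[OF that] J_eq[OF that] by simp
  have e_0: "e 0 = E\<^sub>0" by (simp add: e_def \<rho>_0 E0)
  have e_decr: "e t \<le> e s" if "0 \<le> s" "s \<le> t" for s t
    using energy_nonincreasing[rule_format, OF that] J_eq[of s] J_eq[of t] that by simp
  obtain g where g: "\<And>T. 0 \<le> T \<Longrightarrow> set_integrable lborel {0..T} g"
    "\<And>s t. 0 \<le> s \<Longrightarrow> s \<le> t \<Longrightarrow> dist (real_of_ereal (J (\<rho> s))) (real_of_ereal (J (\<rho> t))) \<le> (LINT \<tau>:{s..t}|lborel. g \<tau>)"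
    using energy_abs_cont unfolding abs_cont_curve_def by blast
  have W: "0 \<le> W2 (\<rho> s) (\<rho> t)" if "0 \<le> s" "0 \<le> t" for s t
    by (rule W2_nonneg[OF P[OF that(1)] P[OF that(2)]])
  have W_sym: "W2 (\<rho> s) (\<rho> t) = W2 (\<rho> t) (\<rho> s)" if "0 \<le> s" "0 \<le> t" for s t
    by (rule W2_sym[OF P[OF that(1)] P[OF that(2)]])
  have W_tri: "W2 (\<rho> r) (\<rho> t) \<le> W2 (\<rho> r) (\<rho> s) + W2 (\<rho> s) (\<rho> t)" if "0 \<le> r" "0 \<le> s" "0 \<le> t" for r s t
    by (rule W2_triangle[OF P[OF that(1)] P[OF that(2)] P[OF that(3)]])
  have md: "set_borel_measurable lborel {0..} ?md"
    "0 \<le> s \<Longrightarrow> set_integrable lborel {s..t} ?md"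
    "0 \<le> s \<Longrightarrow> s \<le> t \<Longrightarrow> W2 (\<rho> s) (\<rho> t) \<le> (LINT x:{s..t}|lborel. ?md x)"
    "AE t in lborel. 0 < t \<longrightarrow> 0 \<le> ?md t" for s t
    by (rule half_line_metric_derivative; (rule W W_sym W_tri ac; assumption | assumption | rule ac))+
  interpret dissipated_energy e ?md g c\<^sub>g \<theta>
  proof
    show "0 \<le> e t" if "0 \<le> t" for t by (rule e_nonneg[OF that])
    show "e t \<le> e s" if "0 \<le> s" "s \<le> t" for s t by (rule e_decr[OF that])
    show "set_integrable lborel {s..t} g" if "0 \<le> s" for s t
      by (rule set_integrable_subset[OF g(1)[of "max 0 t"]]) (use that in auto)
    show "\<bar>e t - e s\<bar> \<le> (LINT x:{s..t}|lborel. g x)" if "0 \<le> s" "s \<le> t" for s t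
      using g(2)[OF that] by (simp add: e_def dist_real_def abs_minus_commute)
    show "AE t in lborel. 0 < t \<longrightarrow> (e has_real_derivative - (?md t)\<^sup>2) (at t)"
      using energy_dissipation
    proof (eventually_elim, intro impI)
      fix t :: real
      assume "0 < t \<longrightarrow> ((\<lambda>s. real_of_ereal (J (\<rho> s))) has_real_derivative - (?md t)\<^sup>2) (at t)" "0 < t"
      then show "(e has_real_derivative - (?md t)\<^sup>2) (at t)"
        unfolding e_def[abs_def] by (auto intro!: derivative_eq_intros)
    qed
    \<comment> \<open>The subgradient is - v; the sign does not affect its norm, which is the metric
      derivative.\<close>
    have "AE t in lborel. t > 0 \<longrightarrow> L2_norm_on (\<rho> t) (v t) = ?md t"
      using conjunct1[OF conjunct2[OF v(1)[unfolded tangent_velocity_def]]] by eventually_elim simp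
    with v(2) show "AE t in lborel. 0 < t \<longrightarrow> 0 < e t \<longrightarrow> c\<^sub>g * e t powr (1 - \<theta>) \<le> ?md t"
    proof (eventually_elim, intro impI)
      fix t :: real
      assume A: "0 < t \<longrightarrow> (\<lambda>x. - v t x) \<in> subdiff lam J (\<rho> t)" "0 < t \<longrightarrow> L2_norm_on (\<rho> t) (v t) = ?md t"
        and t: "0 < t" "0 < e t"
      have "ereal Jhat < J (\<rho> t)" using J_eq[of t] t by simp
      then have "c\<^sub>g * (real_of_ereal (J (\<rho> t)) - Jhat) powr (1 - \<theta>) \<le> L2_norm_on (\<rho> t) (\<lambda>x. - v t x)"
        using gradient_inequality P[of t] below_r0[of t] A(1) t by simp
      then show "c\<^sub>g * e t powr (1 - \<theta>) \<le> ?md t"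
        using A(2) t by (simp add: e_def L2_norm_on_def)
    qed
    show "set_integrable lborel {s..t} ?md" if "0 \<le> s" for s t by (rule md(2)[OF that])
    show "AE t in lborel. 0 < t \<longrightarrow> 0 \<le> ?md t" by (rule md(4))
  qed (use cg theta in auto)
  have W_le: "W2 (\<rho> s) (\<rho> t) \<le> remaining_length s - remaining_length t" if "0 \<le> s" "s \<le> t" for s t
    using md(3)[of s t] length_le_remaining[OF that] that by linarith
  have "\<exists>N\<ge>0. \<forall>t\<ge>N. remaining_length t < (1/4)^n" for n :: nat
  proof -
    have "eventually (\<lambda>t. remaining_length t < (1/4)^n) at_top"
      by (rule order_tendstoD(2)[OF remaining_length_tendsto_0]) simp
    then obtain N where "\<And>t. t \<ge> N \<Longrightarrow> remaining_length t < (1/4)^n" by (auto simp: eventually_at_top_linorder)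
    then show ?thesis by (intro exI[of _ "max 0 N"]) auto
  qed
  then have "\<forall>n::nat. \<exists>N. 0 \<le> N \<and> (\<forall>t\<ge>N. remaining_length t < (1/4)^n)" by blast
  from choice[OF this] obtain N :: "nat \<Rightarrow> real"
    where N: "\<And>n. 0 \<le> N n" "\<And>n t. N n \<le> t \<Longrightarrow> remaining_length t < (1/4)^n" by blast
  \<comment> \<open>The sum makes \<tau> increasing and at least N n, and the summand n drives it to
    infinity. Successive points are then (1/4)^n-close, the speed that
    \<open>W2_Cauchy_converges\<close> asks for.\<close>
  define \<tau> where "\<tau> n = (\<Sum>k\<le>n. N k) + real n" for n
  have \<tau>: "N n \<le> \<tau> n" "real n \<le> \<tau> n" "0 \<le> \<tau> n" "\<tau> n \<le> \<tau> (Suc n)" for n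
    using member_le_sum[of n "{..n}" N] sum_nonneg[of "{..n}" N] N(1) by (auto simp: \<tau>_def)
  have \<tau>_lim: "filterlim \<tau> at_top sequentially"
    by (rule filterlim_at_top_mono[OF filterlim_real_sequentially]) (simp add: \<tau>(2))
  obtain \<rho>inf where inf: "\<rho>inf \<in> P2" "(\<lambda>n. W2 (\<rho> (\<tau> n)) \<rho>inf) \<longlonglongrightarrow> 0"
  proof (rule W2_Cauchy_converges[of "\<lambda>n. \<rho> (\<tau> n)"])
    show "\<rho> (\<tau> n) \<in> P2" for n by (rule P[OF \<tau>(3)])
    show "W2 (\<rho> (\<tau> n)) (\<rho> (\<tau> (Suc n))) < (1/4)^n" for n
      using W_le[OF \<tau>(3,4), of n] N(2)[OF \<tau>(1), of n] remaining_length_nonneg[of "\<tau> (Suc n)"] by linarith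
  qed
  \<comment> \<open>The length bound between times t and \<tau> n passes to the limit in n through
    the triangle inequality; taking n above t ensures t \<le> \<tau> n.\<close>
  have W_inf: "W2 (\<rho> t) \<rho>inf \<le> remaining_length t" if t: "0 \<le> t" for t
  proof (rule LIMSEQ_le_const)
    show "(\<lambda>n. remaining_length t + W2 (\<rho> (\<tau> n)) \<rho>inf) \<longlonglongrightarrow> remaining_length t"
      using tendsto_add[OF tendsto_const inf(2), of "remaining_length t"] by simp
    have "W2 (\<rho> t) \<rho>inf \<le> remaining_length t + W2 (\<rho> (\<tau> n)) \<rho>inf" if n: "nat \<lceil>t\<rceil> \<le> n" for n
    proof -
      have "t \<le> \<tau> n" using n \<tau>(2)[of n] by linarith
      then have "W2 (\<rho> t) (\<rho> (\<tau> n)) \<le> remaining_length t"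
        using W_le[OF t, of "\<tau> n"] remaining_length_nonneg[of "\<tau> n"] by linarith
      then show ?thesis using W2_triangle[OF P[OF t] P[OF \<tau>(3)] inf(1), of n] by linarith
    qed
    then show "\<exists>N. \<forall>n\<ge>N. W2 (\<rho> t) \<rho>inf \<le> remaining_length t + W2 (\<rho> (\<tau> n)) \<rho>inf" by blast
  qed
  have lim: "((\<lambda>t. W2 (\<rho> t) \<rho>inf) \<longlongrightarrow> 0) at_top"
  proof (rule tendsto_sandwich[OF _ _ tendsto_const remaining_length_tendsto_0])
    show "eventually (\<lambda>t. 0 \<le> W2 (\<rho> t) \<rho>inf) at_top"
      using eventually_ge_at_top[of 0] by eventually_elim (rule W2_nonneg[OF P inf(1)])
    show "eventually (\<lambda>t. W2 (\<rho> t) \<rho>inf \<le> remaining_length t) at_top"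
      using eventually_ge_at_top[of 0] by eventually_elim (rule W_inf)
  qed
  have minimiser: "is_minimiser J \<rho>inf"
  proof -
    have "(\<lambda>n. e (\<tau> n) + Jhat) \<longlonglongrightarrow> 0 + Jhat"
      by (intro tendsto_intros filterlim_compose[OF E_tendsto_0 \<tau>_lim])
    then have "(\<lambda>n. J (\<rho> (\<tau> n))) \<longlonglongrightarrow> ereal Jhat"
      by (simp add: J_eq[OF \<tau>(3)] del: ereal_plus_eq_PInfty)
    then have "liminf (\<lambda>n. J (\<rho> (\<tau> n))) = ereal Jhat"
      by (intro lim_imp_Liminf) auto
    moreover have "J \<rho>inf \<le> liminf (\<lambda>n. J (\<rho> (\<tau> n)))"
      using lsc[unfolded W2_lsc_def, rule_format, OF inf(1), of "\<lambda>n. \<rho> (\<tau> n)"] P[OF \<tau>(3)] inf(2) by blast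
    ultimately have "J \<rho>inf \<le> J \<mu>" using \<mu>(2) by simp
    then show ?thesis
      using \<mu>(1) inf(1) unfolding is_minimiser_def by (meson order_trans)
  qed
  have gap: "J (\<rho> t) - ereal Jhat = ereal (e t)" if "0 \<le> t" for t using J_eq[OF that] by simp
  have slow: "J (\<rho> t) - ereal Jhat \<le> ereal (if E\<^sub>0 = 0 then 0 else
        (E\<^sub>0 powr (2 * \<theta> - 1) + c\<^sub>g\<^sup>2 * (1 - 2 * \<theta>) * t) powr (- 1 / (1 - 2 * \<theta>)))
      \<and> W2 (\<rho> t) \<rho>inf \<le> (if E\<^sub>0 = 0 then 0 else 1 / (c\<^sub>g * \<theta>) *
        (E\<^sub>0 powr (2 * \<theta> - 1) + c\<^sub>g\<^sup>2 * (1 - 2 * \<theta>) * t) powr (- \<theta> / (1 - 2 * \<theta>)))"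
    if "\<theta> < 1/2" "0 \<le> t" for t
  proof (cases "E\<^sub>0 = 0")
    case True
    then have "e t = 0" using e_decr[of 0 t] e_nonneg[of t] e_0 that by simp
    then show ?thesis using True gap[OF that(2)] W_inf[OF that(2)] by (simp add: remaining_length_def)
  next
    case False
    then show ?thesis
      using rate_sublinear[OF that] W_inf[OF that(2)] gap[OF that(2)] e_0 by simp
  qed
  have critical: "J (\<rho> t) - ereal Jhat \<le> ereal (E\<^sub>0 * exp (- (c\<^sub>g\<^sup>2 * t)))
      \<and> W2 (\<rho> t) \<rho>inf \<le> 2 / c\<^sub>g * sqrt E\<^sub>0 * exp (- (c\<^sub>g\<^sup>2 * t / 2))"
    if "\<theta> = 1/2" "0 \<le> t" for t
    using rate_exponential[OF that] W_inf[OF that(2)] gap[OF that(2)] e_0 by simp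
  have fast: "J (\<rho> t) - ereal Jhat \<le> ereal
        ((E\<^sub>0 powr (2 * \<theta> - 1) - c\<^sub>g\<^sup>2 * (2 * \<theta> - 1) * t) powr (1 / (2 * \<theta> - 1)))
      \<and> W2 (\<rho> t) \<rho>inf \<le> 1 / (c\<^sub>g * \<theta>) *
        (E\<^sub>0 powr (2 * \<theta> - 1) - c\<^sub>g\<^sup>2 * (2 * \<theta> - 1) * t) powr (\<theta> / (2 * \<theta> - 1))"
    if "\<theta> > 1/2" "0 \<le> t" for t
    using rate_superlinear(2,3)[OF that] W_inf[OF that(2)] gap[OF that(2)] e_0 by simp
  have stop: "0 \<le> T \<and> (\<forall>t\<ge>T. \<rho> t = \<rho>inf)"
    if "\<theta> > 1/2" and T: "T = E\<^sub>0 powr (2 * \<theta> - 1) / (c\<^sub>g\<^sup>2 * (2 * \<theta> - 1))" for T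
  proof -
    have T0: "0 \<le> T" using that cg by simp
    have "\<rho> t = \<rho>inf" if "T \<le> t" for t
    proof -
      have t: "0 \<le> t" using T0 that by linarith
      have "e t = 0" using extinction[OF \<open>\<theta> > 1/2\<close>, of t] that T e_0 by simp
      then have "W2 (\<rho> t) \<rho>inf \<le> 0" using W_inf[OF t] by (simp add: remaining_length_def)
      then show ?thesis using W2_nonneg[OF P[OF t] inf(1)] by (intro W2_eq_0_imp_eq P[OF t] inf(1)) simp
    qed
    with T0 show ?thesis by blast
  qed
  show ?thesis
    unfolding Let_def finite_length_def
  proof (intro conjI exI[of _ \<rho>inf] impI)
    show "set_integrable lborel {0..} ?md" by (rule finite_total_length[OF md(1)])
    show "\<exists>t\<^sub>f. 0 \<le> t\<^sub>f \<and> t\<^sub>f \<le> E\<^sub>0 powr (2 * \<theta> - 1) / (c\<^sub>g\<^sup>2 * (2 * \<theta> - 1)) \<and> (\<forall>t\<ge>t\<^sub>f. \<rho> t = \<rho>inf)"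
      if "\<theta> > 1/2" using stop[OF that refl] by blast
  qed (use minimiser lim slow critical fast in auto)
qed

end
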